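(* Let $\mathcal{V}$ be a symmetric monoidal model category and let $\mathcal{C}$ be a $\mathcal{V}$-enriched model category satisfying SM7 and weakly tensored over $\mathcal{V}$. Consider the following conditions. (1) ($\pi_0$ of mapping space) For any cofibrant $x\in\mathcal{C}$ and fibrant $y\in\mathcal{C}$, the canonical map $[x,y]\to[\mathbb{1},\underline{\mathcal{C}}(x,y)]$ is a bijection. (2) (Detection property) If a map $f\colon x\to y$ between cofibrant objects in $\mathcal{C}$ is such that the restriction map $f^*\colon\underline{\mathcal{C}}(y,z)\to\underline{\mathcal{C}}(x,z)$ is a weak equivalence in $\mathcal{V}$ for every fibrant object $z\in\mathcal{C}$, then $f$ is a weak equivalence in $\mathcal{C}$. (3) (External unit axiom) For any cofibrant replacement $q\colon Q\mathbb{1}\to\mathbb{1}$ in $\mathcal{V}$ and cofibrant object $x\in\mathcal{C}$, the composite $x\otimes Q\mathbb{1}\xrightarrow{x\otimes q}x\otimes\mathbb{1}\xrightarrow{\rho_x}x$ is a weak equivalence in $\mathcal{C}$. The implications (1) $\implies$ (2) $\implies$ (3) hold. If moreover the weak tensoring on $\mathcal{C}$ is set-compatible, then all three conditions are equivalent.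
   Context: A symmetric monoidal model category is a model category with a closed symmetric monoidal structure $(\otimes,\mathbb{1})$ satisfying the pushout-product axiom (for cofibrations $i\colon a\to b$, $k\colon x\to y$, the map $(a\otimes y)\amalg_{a\otimes x}(b\otimes x)\to b\otimes y$ is a cofibration, acyclic if $i$ or $k$ is) and the unit axiom (for $x$ cofibrant and every cofibrant replacement $q\colon Q\mathbb{1}\to\mathbb{1}$, the map $x\otimes Q\mathbb{1}\to x\otimes\mathbb{1}\cong x$ is a weak equivalence). The internal hom is $\underline{\mathcal{V}}(-,-)$, and $U=\mathcal{V}(\mathbb{1},-)\colon\mathcal{V}\to\mathrm{Set}$. A $\mathcal{V}$-enriched model category is a $\mathcal{V}$-category $\mathcal{C}$ (hom-objects $\underline{\mathcal{C}}(x,y)$) with a model structure on its underlying category $\mathcal{C}_0$, whose hom-sets are $\mathcal{C}(x,y)=\mathcal{V}(\mathbb{1},\underline{\mathcal{C}}(x,y))$. It satisfies SM7 if for each cofibration $i\colon a\to b$ and fibration $p\colon x\to y$ in $\mathcal{C}_0$, the map $\underline{\mathcal{C}}(b,x)\to\underline{\mathcal{C}}(a,x)\times_{\underline{\mathcal{C}}(a,y)}\underline{\mathcal{C}}(b,y)$ is a fibration in $\mathcal{V}$, acyclic if $i$ or $p$ is. A weak tensoring of such a $\mathcal{C}$ over $\mathcal{V}$ is a bifunctor $\otimes\colon\mathcal{C}\times\mathcal{V}\to\mathcal{C}$ (on underlying categories) satisfying the external pushout-product axiom (for cofibrations $i\colon x\to y$ in $\mathcal{C}_0$ and $k\colon a\to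 b$ in $\mathcal{V}$, $(x\otimes b)\amalg_{x\otimes a}(y\otimes a)\to y\otimes b$ is a cofibration, acyclic if $i$ or $k$ is), with a natural map $\varphi_{v,x,y}\colon\underline{\mathcal{C}}(x\otimes v,y)\to\underline{\mathcal{V}}(v,\underline{\mathcal{C}}(x,y))$ in $\mathcal{V}$ that is a weak equivalence for $v,x$ cofibrant and $y$ fibrant, and a natural map $\rho_x\colon x\otimes\mathbb{1}\to x$ such that $\varphi_{\mathbb{1},x,y}\circ\rho_x^*$ is the canonical isomorphism $\underline{\mathcal{C}}(x,y)\cong\underline{\mathcal{V}}(\mathbb{1},\underline{\mathcal{C}}(x,y))$. It is set-compatible if $U\varphi_{v,x,y}$ is a bijection for all $v\in\mathcal{V}$, $x,y\in\mathcal{C}$. $[-,-]$ denotes hom-sets in the homotopy category ($\mathrm{Ho}(\mathcal{C})$ or $\mathrm{Ho}(\mathcal{V})$). For $x$ cofibrant and $y$ fibrant, the canonical map $[x,y]\to[\mathbb{1},\underline{\mathcal{C}}(x,y)]$ is induced, via $[x,y]\cong\mathcal{C}(x,y)/\!\sim$ (homotopy relation), by $\mathcal{C}(x,y)\cong\mathcal{V}(\mathbb{1},\underline{\mathcal{C}}(x,y))\to[\mathbb{1},\underline{\mathcal{C}}(x,y)]$, the last map being the localization functor (this is well defined).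
   Formalization: Added assumptions, without which (2) ⟹ (3) can fail: the initial and terminal objects of C_0 are so in the enriched sense (C(0,y) and C(y,* ) are terminal in V), and the bifunctor ⊗ of the weak tensoring preserves initial objects in each variable. *)

theory Defs
  imports Main
begin

section \<open>Categories\<close>

record ('o, 'a) cat =
  Obj :: "'o set"
  Arr :: "'a set"
  Dom :: "'a \<Rightarrow> 'o"
  Cod :: "'a \<Rightarrow> 'o"
  Idn :: "'o \<Rightarrow> 'a"
  Cmp :: "'a \<Rightarrow> 'a \<Rightarrow> 'a" (infixr "\<cdot>\<index>" 70)

definition hom :: "('o, 'a, 'z) cat_scheme \<Rightarrow> 'o \<Rightarrow> 'o \<Rightarrow> 'a set" where
  "hom C x y = {f \<in> Arr C. Dom C f = x \<and> Cod C f = y}"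

locale category =
  fixes C :: "('o, 'a, 'z) cat_scheme" (structure)
  assumes Dom_Obj: "f \<in> Arr C \<Longrightarrow> Dom C f \<in> Obj C"
    and Cod_Obj: "f \<in> Arr C \<Longrightarrow> Cod C f \<in> Obj C"
    and Idn_hom: "x \<in> Obj C \<Longrightarrow> Idn C x \<in> hom C x x"
    and Cmp_hom: "f \<in> hom C x y \<Longrightarrow> g \<in> hom C y z \<Longrightarrow> g \<cdot> f \<in> hom C x z"
    and Cmp_Idn: "f \<in> hom C x y \<Longrightarrow> f \<cdot> Idn C x = f"
    and Idn_Cmp: "f \<in> hom C x y \<Longrightarrow> Idn C y \<cdot> f = f"
    and Cmp_assoc: "f \<in> hom C w x \<Longrightarrow> g \<in> hom C x y \<Longrightarrow> h \<in> hom C y z \<Longrightarrow>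
      (h \<cdot> g) \<cdot> f = h \<cdot> (g \<cdot> f)"

definition inverses :: "('o, 'a, 'z) cat_scheme \<Rightarrow> 'a \<Rightarrow> 'a \<Rightarrow> bool" where
  "inverses C f g \<longleftrightarrow> f \<in> Arr C \<and> g \<in> hom C (Cod C f) (Dom C f) \<and>
     g \<cdot>\<^bsub>C\<^esub> f = Idn C (Dom C f) \<and> f \<cdot>\<^bsub>C\<^esub> g = Idn C (Cod C f)"

definition iso :: "('o, 'a, 'z) cat_scheme \<Rightarrow> 'a \<Rightarrow> bool" where
  "iso C f \<longleftrightarrow> (\<exists>g. inverses C f g)"

definition inv_arr :: "('o, 'a, 'z) cat_scheme \<Rightarrow> 'a \<Rightarrow> 'a" where
  "inv_arr C f = (THE g. inverses C f g)"

definition initial :: "('o, 'a, 'z) cat_scheme \<Rightarrow> 'o \<Rightarrow> bool" where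
  "initial C e \<longleftrightarrow> e \<in> Obj C \<and> (\<forall>x \<in> Obj C. \<exists>!f. f \<in> hom C e x)"

definition terminal :: "('o, 'a, 'z) cat_scheme \<Rightarrow> 'o \<Rightarrow> bool" where
  "terminal C t \<longleftrightarrow> t \<in> Obj C \<and> (\<forall>x \<in> Obj C. \<exists>!f. f \<in> hom C x t)"

definition is_coproduct ::
  "('o, 'a, 'z) cat_scheme \<Rightarrow> 'o \<Rightarrow> 'o \<Rightarrow> 'o \<Rightarrow> 'a \<Rightarrow> 'a \<Rightarrow> bool" where
  "is_coproduct C a b s i j \<longleftrightarrow> i \<in> hom C a s \<and> j \<in> hom C b s \<and>
     (\<forall>c u v. u \<in> hom C a c \<and> v \<in> hom C b c \<longrightarrow>
        (\<exists>!h. h \<in> hom C s c \<and> h \<cdot>\<^bsub>C\<^esub> i = u \<and> h \<cdot>\<^bsub>C\<^esub> j = v))"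

definition is_product ::
  "('o, 'a, 'z) cat_scheme \<Rightarrow> 'o \<Rightarrow> 'o \<Rightarrow> 'o \<Rightarrow> 'a \<Rightarrow> 'a \<Rightarrow> bool" where
  "is_product C a b s p q \<longleftrightarrow> p \<in> hom C s a \<and> q \<in> hom C s b \<and>
     (\<forall>c u v. u \<in> hom C c a \<and> v \<in> hom C c b \<longrightarrow>
        (\<exists>!h. h \<in> hom C c s \<and> p \<cdot>\<^bsub>C\<^esub> h = u \<and> q \<cdot>\<^bsub>C\<^esub> h = v))"

text \<open>In \<open>is_pushout C f g p q\<close> the maps \<open>f\<close>, \<open>g\<close> form the span and \<open>p\<close>, \<open>q\<close> the cocone, with
  \<open>p \<cdot> f = q \<cdot> g\<close>; dually for \<open>is_pullback\<close>.\<close>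

definition is_pushout ::
  "('o, 'a, 'z) cat_scheme \<Rightarrow> 'a \<Rightarrow> 'a \<Rightarrow> 'a \<Rightarrow> 'a \<Rightarrow> bool" where
  "is_pushout C f g p q \<longleftrightarrow> f \<in> Arr C \<and> g \<in> Arr C \<and> Dom C f = Dom C g \<and>
     p \<in> Arr C \<and> q \<in> Arr C \<and> Dom C p = Cod C f \<and> Dom C q = Cod C g \<and> Cod C p = Cod C q \<and>
     p \<cdot>\<^bsub>C\<^esub> f = q \<cdot>\<^bsub>C\<^esub> g \<and>
     (\<forall>c u v. u \<in> hom C (Cod C f) c \<and> v \<in> hom C (Cod C g) c \<and> u \<cdot>\<^bsub>C\<^esub> f = v \<cdot>\<^bsub>C\<^esub> g \<longrightarrow>
        (\<exists>!h. h \<in> hom C (Cod C p) c \<and> h \<cdot>\<^bsub>C\<^esub> p = u \<and> h \<cdot>\<^bsub>C\<^esub> q = v))"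

definition is_pullback ::
  "('o, 'a, 'z) cat_scheme \<Rightarrow> 'a \<Rightarrow> 'a \<Rightarrow> 'a \<Rightarrow> 'a \<Rightarrow> bool" where
  "is_pullback C f g p q \<longleftrightarrow> f \<in> Arr C \<and> g \<in> Arr C \<and> Cod C f = Cod C g \<and>
     p \<in> Arr C \<and> q \<in> Arr C \<and> Cod C p = Dom C f \<and> Cod C q = Dom C g \<and> Dom C p = Dom C q \<and>
     f \<cdot>\<^bsub>C\<^esub> p = g \<cdot>\<^bsub>C\<^esub> q \<and>
     (\<forall>c u v. u \<in> hom C c (Dom C f) \<and> v \<in> hom C c (Dom C g) \<and> f \<cdot>\<^bsub>C\<^esub> u = g \<cdot>\<^bsub>C\<^esub> v \<longrightarrow>
        (\<exists>!h. h \<in> hom C c (Dom C p) \<and> p \<cdot>\<^bsub>C\<^esub> h = u \<and> q \<cdot>\<^bsub>C\<^esub> h = v))"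

text \<open>\<open>TO\<close> and \<open>TA\<close> are the actions of a functor \<open>A \<times> B \<rightarrow> E\<close> on objects and on arrows.\<close>

locale bifunctor =
  fixes A :: "('o1, 'a1, 'z1) cat_scheme"
    and B :: "('o2, 'a2, 'z2) cat_scheme"
    and E :: "('o3, 'a3, 'z3) cat_scheme"
    and TO :: "'o1 \<Rightarrow> 'o2 \<Rightarrow> 'o3"
    and TA :: "'a1 \<Rightarrow> 'a2 \<Rightarrow> 'a3"
  assumes bif_Obj: "x \<in> Obj A \<Longrightarrow> v \<in> Obj B \<Longrightarrow> TO x v \<in> Obj E"
    and bif_hom: "f \<in> hom A x y \<Longrightarrow> k \<in> hom B v w \<Longrightarrow> TA f k \<in> hom E (TO x v) (TO y w)"
    and bif_Idn: "x \<in> Obj A \<Longrightarrow> v \<in> Obj B \<Longrightarrow> TA (Idn A x) (Idn B v) = Idn E (TO x v)"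
    and bif_Cmp: "f \<in> hom A x y \<Longrightarrow> g \<in> hom A y z \<Longrightarrow> k \<in> hom B u v \<Longrightarrow> l \<in> hom B v w \<Longrightarrow>
      TA (g \<cdot>\<^bsub>A\<^esub> f) (l \<cdot>\<^bsub>B\<^esub> k) = TA g l \<cdot>\<^bsub>E\<^esub> TA f k"

section \<open>Model categories\<close>

record 'a model_structure =
  weq :: "'a set"
  cof :: "'a set"
  fib :: "'a set"

definition retract_of :: "('o, 'a, 'z) cat_scheme \<Rightarrow> 'a \<Rightarrow> 'a \<Rightarrow> bool" where
  "retract_of C f g \<longleftrightarrow> f \<in> Arr C \<and> g \<in> Arr C \<and>
     (\<exists>i r j s. i \<in> hom C (Dom C f) (Dom C g) \<and> r \<in> hom C (Dom C g) (Dom C f) \<and>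
        j \<in> hom C (Cod C f) (Cod C g) \<and> s \<in> hom C (Cod C g) (Cod C f) \<and>
        r \<cdot>\<^bsub>C\<^esub> i = Idn C (Dom C f) \<and> s \<cdot>\<^bsub>C\<^esub> j = Idn C (Cod C f) \<and>
        g \<cdot>\<^bsub>C\<^esub> i = j \<cdot>\<^bsub>C\<^esub> f \<and> f \<cdot>\<^bsub>C\<^esub> r = s \<cdot>\<^bsub>C\<^esub> g)"

definition lifts :: "('o, 'a, 'z) cat_scheme \<Rightarrow> 'a \<Rightarrow> 'a \<Rightarrow> bool" where
  "lifts C i p \<longleftrightarrow>
     (\<forall>u v. u \<in> hom C (Dom C i) (Dom C p) \<and> v \<in> hom C (Cod C i) (Cod C p) \<and>
        p \<cdot>\<^bsub>C\<^esub> u = v \<cdot>\<^bsub>C\<^esub> i \<longrightarrow>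
        (\<exists>h \<in> hom C (Cod C i) (Dom C p). h \<cdot>\<^bsub>C\<^esub> i = u \<and> p \<cdot>\<^bsub>C\<^esub> h = v))"

text \<open>Quillen's axioms for a closed model category: only finite limits and colimits are required,
  and factorizations need not be functorial. Finite (co)completeness is expressed by a terminal
  object and pullbacks (an initial object and pushouts).\<close>

locale model_category = category C
  for C :: "('o, 'a, 'z) cat_scheme" (structure) +
  fixes M :: "'a model_structure"
  assumes weq_Arr: "weq M \<subseteq> Arr C"
    and cof_Arr: "cof M \<subseteq> Arr C"
    and fib_Arr: "fib M \<subseteq> Arr C"
    and ex_initial: "\<exists>e. initial C e"
    and ex_terminal: "\<exists>t. terminal C t"
    and ex_pushout: "f \<in> Arr C \<Longrightarrow> g \<in> Arr C \<Longrightarrow> Dom C f = Dom C g \<Longrightarrow>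
      \<exists>p q. is_pushout C f g p q"
    and ex_pullback: "f \<in> Arr C \<Longrightarrow> g \<in> Arr C \<Longrightarrow> Cod C f = Cod C g \<Longrightarrow>
      \<exists>p q. is_pullback C f g p q"
    and weq_Cmp: "f \<in> hom C x y \<Longrightarrow> g \<in> hom C y z \<Longrightarrow> f \<in> weq M \<Longrightarrow> g \<in> weq M \<Longrightarrow>
      g \<cdot> f \<in> weq M"
    and weq_cancel_left: "f \<in> hom C x y \<Longrightarrow> g \<in> hom C y z \<Longrightarrow> g \<in> weq M \<Longrightarrow> g \<cdot> f \<in> weq M \<Longrightarrow>
      f \<in> weq M"
    and weq_cancel_right: "f \<in> hom C x y \<Longrightarrow> g \<in> hom C y z \<Longrightarrow> f \<in> weq M \<Longrightarrow> g \<cdot> f \<in> weq M \<Longrightarrow>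
      g \<in> weq M"
    and weq_retract: "retract_of C f g \<Longrightarrow> g \<in> weq M \<Longrightarrow> f \<in> weq M"
    and cof_retract: "retract_of C f g \<Longrightarrow> g \<in> cof M \<Longrightarrow> f \<in> cof M"
    and fib_retract: "retract_of C f g \<Longrightarrow> g \<in> fib M \<Longrightarrow> f \<in> fib M"
    and cof_lifts: "i \<in> cof M \<Longrightarrow> p \<in> fib M \<Longrightarrow> p \<in> weq M \<Longrightarrow> lifts C i p"
    and acyclic_cof_lifts: "i \<in> cof M \<Longrightarrow> i \<in> weq M \<Longrightarrow> p \<in> fib M \<Longrightarrow> lifts C i p"
    and factor_cof: "f \<in> hom C x y \<Longrightarrow>
      \<exists>z i p. i \<in> hom C x z \<and> p \<in> hom C z y \<and> f = p \<cdot> i \<and> i \<in> cof M \<and> p \<in> fib M \<and> p \<in> weq M"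
    and factor_acyclic_cof: "f \<in> hom C x y \<Longrightarrow>
      \<exists>z i p. i \<in> hom C x z \<and> p \<in> hom C z y \<and> f = p \<cdot> i \<and> i \<in> cof M \<and> i \<in> weq M \<and> p \<in> fib M"

definition cofibrant :: "('o, 'a, 'z) cat_scheme \<Rightarrow> 'a model_structure \<Rightarrow> 'o \<Rightarrow> bool" where
  "cofibrant C M x \<longleftrightarrow> x \<in> Obj C \<and> (\<forall>e f. initial C e \<and> f \<in> hom C e x \<longrightarrow> f \<in> cof M)"

definition fibrant :: "('o, 'a, 'z) cat_scheme \<Rightarrow> 'a model_structure \<Rightarrow> 'o \<Rightarrow> bool" where
  "fibrant C M x \<longleftrightarrow> x \<in> Obj C \<and> (\<forall>t f. terminal C t \<and> f \<in> hom C x t \<longrightarrow> f \<in> fib M)"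

text \<open>A cofibrant replacement is any weak equivalence from a cofibrant object; it is not required to
  be a fibration.\<close>

definition cofibrant_replacement ::
  "('o, 'a, 'z) cat_scheme \<Rightarrow> 'a model_structure \<Rightarrow> 'o \<Rightarrow> 'o \<Rightarrow> 'a \<Rightarrow> bool" where
  "cofibrant_replacement C M x Q q \<longleftrightarrow> cofibrant C M Q \<and> q \<in> hom C Q x \<and> q \<in> weq M"

definition left_homotopic ::
  "('o, 'a, 'z) cat_scheme \<Rightarrow> 'a model_structure \<Rightarrow> 'o \<Rightarrow> 'o \<Rightarrow> 'a \<Rightarrow> 'a \<Rightarrow> bool" where
  "left_homotopic C M x y f g \<longleftrightarrow>
     (\<exists>s i\<^sub>0 i\<^sub>1 c j w H. is_coproduct C x x s i\<^sub>0 i\<^sub>1 \<and>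
        j \<in> hom C s c \<and> j \<in> cof M \<and> w \<in> hom C c x \<and> w \<in> weq M \<and>
        w \<cdot>\<^bsub>C\<^esub> (j \<cdot>\<^bsub>C\<^esub> i\<^sub>0) = Idn C x \<and> w \<cdot>\<^bsub>C\<^esub> (j \<cdot>\<^bsub>C\<^esub> i\<^sub>1) = Idn C x \<and>
        H \<in> hom C c y \<and> H \<cdot>\<^bsub>C\<^esub> (j \<cdot>\<^bsub>C\<^esub> i\<^sub>0) = f \<and> H \<cdot>\<^bsub>C\<^esub> (j \<cdot>\<^bsub>C\<^esub> i\<^sub>1) = g)"

definition right_homotopic ::
  "('o, 'a, 'z) cat_scheme \<Rightarrow> 'a model_structure \<Rightarrow> 'o \<Rightarrow> 'o \<Rightarrow> 'a \<Rightarrow> 'a \<Rightarrow> bool" where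
  "right_homotopic C M x y f g \<longleftrightarrow>
     (\<exists>s p\<^sub>0 p\<^sub>1 c j w H. is_product C y y s p\<^sub>0 p\<^sub>1 \<and>
        j \<in> hom C c s \<and> j \<in> fib M \<and> w \<in> hom C y c \<and> w \<in> weq M \<and>
        (p\<^sub>0 \<cdot>\<^bsub>C\<^esub> j) \<cdot>\<^bsub>C\<^esub> w = Idn C y \<and> (p\<^sub>1 \<cdot>\<^bsub>C\<^esub> j) \<cdot>\<^bsub>C\<^esub> w = Idn C y \<and>
        H \<in> hom C x c \<and> (p\<^sub>0 \<cdot>\<^bsub>C\<^esub> j) \<cdot>\<^bsub>C\<^esub> H = f \<and> (p\<^sub>1 \<cdot>\<^bsub>C\<^esub> j) \<cdot>\<^bsub>C\<^esub> H = g)"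

definition homotopy_rel ::
  "('o, 'a, 'z) cat_scheme \<Rightarrow> 'a model_structure \<Rightarrow> 'o \<Rightarrow> 'o \<Rightarrow> ('a \<times> 'a) set" where
  "homotopy_rel C M x y = {(f, g). f \<in> hom C x y \<and> g \<in> hom C x y \<and>
     left_homotopic C M x y f g \<and> right_homotopic C M x y f g}"

section \<open>The homotopy category\<close>

text \<open>\<open>Ho(C)\<close> is the localization of \<open>C\<close> at the weak equivalences: it has the objects of \<open>C\<close>, and
  its arrows are zigzags (written in diagrammatic order, \<open>Bwd w\<close> standing for the formal inverse of
  \<open>w\<close>) modulo the congruence making \<open>f \<mapsto> [Fwd f]\<close> a functor and \<open>Bwd w\<close> inverse to \<open>Fwd w\<close>.\<close>

datatype 'a step = Fwd 'a | Bwd 'a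

fun zigzag :: "('o, 'a, 'z) cat_scheme \<Rightarrow> 'a set \<Rightarrow> 'o \<Rightarrow> 'a step list \<Rightarrow> 'o \<Rightarrow> bool" where
  "zigzag C W x [] y \<longleftrightarrow> x \<in> Obj C \<and> x = y"
| "zigzag C W x (Fwd f # s) y \<longleftrightarrow> f \<in> Arr C \<and> Dom C f = x \<and> zigzag C W (Cod C f) s y"
| "zigzag C W x (Bwd w # s) y \<longleftrightarrow> w \<in> Arr C \<and> w \<in> W \<and> Cod C w = x \<and> zigzag C W (Dom C w) s y"

inductive zigzag_equiv ::
  "('o, 'a, 'z) cat_scheme \<Rightarrow> 'a set \<Rightarrow> 'o \<Rightarrow> 'o \<Rightarrow> 'a step list \<Rightarrow> 'a step list \<Rightarrow> bool"
  for C W where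
  zz_refl: "zigzag C W x s y \<Longrightarrow> zigzag_equiv C W x y s s"
| zz_sym: "zigzag_equiv C W x y s t \<Longrightarrow> zigzag_equiv C W x y t s"
| zz_trans: "zigzag_equiv C W x y s t \<Longrightarrow> zigzag_equiv C W x y t u \<Longrightarrow> zigzag_equiv C W x y s u"
| zz_append: "zigzag_equiv C W x y s s' \<Longrightarrow> zigzag_equiv C W y z t t' \<Longrightarrow>
    zigzag_equiv C W x z (s @ t) (s' @ t')"
| zz_Idn: "x \<in> Obj C \<Longrightarrow> zigzag_equiv C W x x [Fwd (Idn C x)] []"
| zz_Cmp: "f \<in> hom C x y \<Longrightarrow> g \<in> hom C y z \<Longrightarrow>
    zigzag_equiv C W x z [Fwd f, Fwd g] [Fwd (g \<cdot>\<^bsub>C\<^esub> f)]"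
| zz_Fwd_Bwd: "w \<in> W \<Longrightarrow> w \<in> hom C x y \<Longrightarrow> zigzag_equiv C W x x [Fwd w, Bwd w] []"
| zz_Bwd_Fwd: "w \<in> W \<Longrightarrow> w \<in> hom C x y \<Longrightarrow> zigzag_equiv C W y y [Bwd w, Fwd w] []"

definition ho_hom ::
  "('o, 'a, 'z) cat_scheme \<Rightarrow> 'a model_structure \<Rightarrow> 'o \<Rightarrow> 'o \<Rightarrow> 'a step list set set" where
  "ho_hom C M x y =
     {s. zigzag C (weq M) x s y} // {(s, t). zigzag_equiv C (weq M) x y s t}"

definition localization ::
  "('o, 'a, 'z) cat_scheme \<Rightarrow> 'a model_structure \<Rightarrow> 'a \<Rightarrow> 'a step list set" where
  "localization C M f = {t. zigzag_equiv C (weq M) (Dom C f) (Cod C f) [Fwd f] t}"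

section \<open>Closed symmetric monoidal categories\<close>

text \<open>The internal hom is given by the objects \<open>Ihom x y\<close> and the evaluations
  \<open>Ev x y : Ihom x y \<otimes> x \<rightarrow> y\<close>.\<close>

record ('o, 'a) smcat = "('o, 'a) cat" +
  TenO :: "'o \<Rightarrow> 'o \<Rightarrow> 'o" (infixr "\<otimes>\<index>" 80)
  TenA :: "'a \<Rightarrow> 'a \<Rightarrow> 'a" (infixr "\<boxtimes>\<index>" 80)
  Unit :: "'o"
  Assoc :: "'o \<Rightarrow> 'o \<Rightarrow> 'o \<Rightarrow> 'a"
  Lunit :: "'o \<Rightarrow> 'a"
  Runit :: "'o \<Rightarrow> 'a"
  Symm :: "'o \<Rightarrow> 'o \<Rightarrow> 'a"
  Ihom :: "'o \<Rightarrow> 'o \<Rightarrow> 'o"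
  Ev :: "'o \<Rightarrow> 'o \<Rightarrow> 'a"

locale closed_symmetric_monoidal_category =
  category V + bifunctor V V V "TenO V" "TenA V"
  for V :: "('o, 'a, 'z) smcat_scheme" (structure) +
  assumes Unit_Obj: "Unit V \<in> Obj V"
    and Assoc_hom: "x \<in> Obj V \<Longrightarrow> y \<in> Obj V \<Longrightarrow> z \<in> Obj V \<Longrightarrow>
      Assoc V x y z \<in> hom V ((x \<otimes> y) \<otimes> z) (x \<otimes> (y \<otimes> z))"
    and Assoc_iso: "x \<in> Obj V \<Longrightarrow> y \<in> Obj V \<Longrightarrow> z \<in> Obj V \<Longrightarrow> iso V (Assoc V x y z)"
    and Assoc_natural: "f \<in> hom V x x' \<Longrightarrow> g \<in> hom V y y' \<Longrightarrow> h \<in> hom V z z' \<Longrightarrow>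
      Assoc V x' y' z' \<cdot> ((f \<boxtimes> g) \<boxtimes> h) = (f \<boxtimes> (g \<boxtimes> h)) \<cdot> Assoc V x y z"
    and Lunit_hom: "x \<in> Obj V \<Longrightarrow> Lunit V x \<in> hom V (Unit V \<otimes> x) x"
    and Lunit_iso: "x \<in> Obj V \<Longrightarrow> iso V (Lunit V x)"
    and Lunit_natural: "f \<in> hom V x y \<Longrightarrow> Lunit V y \<cdot> (Idn V (Unit V) \<boxtimes> f) = f \<cdot> Lunit V x"
    and Runit_hom: "x \<in> Obj V \<Longrightarrow> Runit V x \<in> hom V (x \<otimes> Unit V) x"
    and Runit_iso: "x \<in> Obj V \<Longrightarrow> iso V (Runit V x)"
    and Runit_natural: "f \<in> hom V x y \<Longrightarrow> Runit V y \<cdot> (f \<boxtimes> Idn V (Unit V)) = f \<cdot> Runit V x"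
    and Symm_hom: "x \<in> Obj V \<Longrightarrow> y \<in> Obj V \<Longrightarrow> Symm V x y \<in> hom V (x \<otimes> y) (y \<otimes> x)"
    and Symm_natural: "f \<in> hom V x x' \<Longrightarrow> g \<in> hom V y y' \<Longrightarrow>
      Symm V x' y' \<cdot> (f \<boxtimes> g) = (g \<boxtimes> f) \<cdot> Symm V x y"
    and Symm_Symm: "x \<in> Obj V \<Longrightarrow> y \<in> Obj V \<Longrightarrow> Symm V y x \<cdot> Symm V x y = Idn V (x \<otimes> y)"
    and triangle: "x \<in> Obj V \<Longrightarrow> y \<in> Obj V \<Longrightarrow>
      (Idn V x \<boxtimes> Lunit V y) \<cdot> Assoc V x (Unit V) y = Runit V x \<boxtimes> Idn V y"
    and pentagon: "w \<in> Obj V \<Longrightarrow> x \<in> Obj V \<Longrightarrow> y \<in> Obj V \<Longrightarrow> z \<in> Obj V \<Longrightarrow>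
      Assoc V w x (y \<otimes> z) \<cdot> Assoc V (w \<otimes> x) y z =
      (Idn V w \<boxtimes> Assoc V x y z) \<cdot> (Assoc V w (x \<otimes> y) z \<cdot> (Assoc V w x y \<boxtimes> Idn V z))"
    and hexagon: "x \<in> Obj V \<Longrightarrow> y \<in> Obj V \<Longrightarrow> z \<in> Obj V \<Longrightarrow>
      Assoc V y z x \<cdot> (Symm V x (y \<otimes> z) \<cdot> Assoc V x y z) =
      (Idn V y \<boxtimes> Symm V x z) \<cdot> (Assoc V y x z \<cdot> (Symm V x y \<boxtimes> Idn V z))"
    and Ihom_Obj: "x \<in> Obj V \<Longrightarrow> y \<in> Obj V \<Longrightarrow> Ihom V x y \<in> Obj V"
    and Ev_hom: "x \<in> Obj V \<Longrightarrow> y \<in> Obj V \<Longrightarrow> Ev V x y \<in> hom V (Ihom V x y \<otimes> x) y"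
    and Ev_universal: "x \<in> Obj V \<Longrightarrow> y \<in> Obj V \<Longrightarrow> z \<in> Obj V \<Longrightarrow> f \<in> hom V (z \<otimes> x) y \<Longrightarrow>
      \<exists>!g. g \<in> hom V z (Ihom V x y) \<and> Ev V x y \<cdot> (g \<boxtimes> Idn V x) = f"

definition transpose ::
  "('o, 'a, 'z) smcat_scheme \<Rightarrow> 'o \<Rightarrow> 'o \<Rightarrow> 'o \<Rightarrow> 'a \<Rightarrow> 'a" where
  "transpose V z x y f =
     (THE g. g \<in> hom V z (Ihom V x y) \<and> Ev V x y \<cdot>\<^bsub>V\<^esub> (g \<boxtimes>\<^bsub>V\<^esub> Idn V x) = f)"

text \<open>For \<open>h : v' \<rightarrow> v\<close> and \<open>k : w \<rightarrow> w'\<close>, the induced map \<open>Ihom v w \<rightarrow> Ihom v' w'\<close>.\<close>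

definition IhomA :: "('o, 'a, 'z) smcat_scheme \<Rightarrow> 'a \<Rightarrow> 'a \<Rightarrow> 'a" where
  "IhomA V h k =
     transpose V (Ihom V (Cod V h) (Dom V k)) (Dom V h) (Cod V k)
       (k \<cdot>\<^bsub>V\<^esub> (Ev V (Cod V h) (Dom V k) \<cdot>\<^bsub>V\<^esub> (Idn V (Ihom V (Cod V h) (Dom V k)) \<boxtimes>\<^bsub>V\<^esub> h)))"

definition Ihom_Unit_iso :: "('o, 'a, 'z) smcat_scheme \<Rightarrow> 'o \<Rightarrow> 'a" where
  "Ihom_Unit_iso V w = transpose V w (Unit V) w (Runit V w)"

section \<open>Symmetric monoidal model categories\<close>

text \<open>The pushout-product axiom for a bifunctor \<open>A \<times> B \<rightarrow> E\<close>. For \<open>i : x \<rightarrow> y\<close> in \<open>A\<close> and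
  \<open>k : a \<rightarrow> b\<close> in \<open>B\<close>, the arrow \<open>u\<close> is the induced map from a pushout of
  \<open>x \<otimes> b \<leftarrow> x \<otimes> a \<rightarrow> y \<otimes> a\<close> (with cocone \<open>p\<close>, \<open>q\<close>) to \<open>y \<otimes> b\<close>.\<close>

definition pushout_product_axiom ::
  "('o1, 'a1, 'z1) cat_scheme \<Rightarrow> 'a1 model_structure \<Rightarrow>
   ('o2, 'a2, 'z2) cat_scheme \<Rightarrow> 'a2 model_structure \<Rightarrow>
   ('o3, 'a3, 'z3) cat_scheme \<Rightarrow> 'a3 model_structure \<Rightarrow> ('a1 \<Rightarrow> 'a2 \<Rightarrow> 'a3) \<Rightarrow> bool" where
  "pushout_product_axiom A MA B MB E ME TA \<longleftrightarrow>
     (\<forall>x y i a b k p q u.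
        i \<in> hom A x y \<and> i \<in> cof MA \<and> k \<in> hom B a b \<and> k \<in> cof MB \<and>
        is_pushout E (TA (Idn A x) k) (TA i (Idn B a)) p q \<and>
        u \<in> hom E (Cod E p) (Cod E (TA i k)) \<and>
        u \<cdot>\<^bsub>E\<^esub> p = TA i (Idn B b) \<and> u \<cdot>\<^bsub>E\<^esub> q = TA (Idn A y) k \<longrightarrow>
        u \<in> cof ME \<and> (i \<in> weq MA \<or> k \<in> weq MB \<longrightarrow> u \<in> weq ME))"

locale symmetric_monoidal_model_category =
  closed_symmetric_monoidal_category V + model_category V M
  for V :: "('o, 'a, 'z) smcat_scheme" (structure) and M :: "'a model_structure" +
  assumes pushout_product: "pushout_product_axiom V M V M V M (TenA V)"
    and unit_axiom: "cofibrant V M x \<Longrightarrow> cofibrant_replacement V M (Unit V) Q q \<Longrightarrow>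
      Runit V x \<cdot> (Idn V x \<boxtimes> q) \<in> weq M"

section \<open>Enriched model categories\<close>

text \<open>\<open>Hob x y\<close> is the hom-object, \<open>Eid x : 1 \<rightarrow> Hob x x\<close> the unit and
  \<open>Ecmp x y z : Hob y z \<otimes> Hob x y \<rightarrow> Hob x z\<close> the composition.\<close>

record ('c, 'o, 'a) ecat =
  Eob :: "'c set"
  Hob :: "'c \<Rightarrow> 'c \<Rightarrow> 'o"
  Eid :: "'c \<Rightarrow> 'a"
  Ecmp :: "'c \<Rightarrow> 'c \<Rightarrow> 'c \<Rightarrow> 'a"

locale enriched_category =
  fixes V :: "('o, 'a, 'z) smcat_scheme" (structure)
    and C :: "('c, 'o, 'a) ecat"
  assumes Hob_Obj: "x \<in> Eob C \<Longrightarrow> y \<in> Eob C \<Longrightarrow> Hob C x y \<in> Obj V"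
    and Eid_hom: "x \<in> Eob C \<Longrightarrow> Eid C x \<in> hom V (Unit V) (Hob C x x)"
    and Ecmp_hom: "x \<in> Eob C \<Longrightarrow> y \<in> Eob C \<Longrightarrow> z \<in> Eob C \<Longrightarrow>
      Ecmp C x y z \<in> hom V (Hob C y z \<otimes> Hob C x y) (Hob C x z)"
    and Ecmp_assoc: "w \<in> Eob C \<Longrightarrow> x \<in> Eob C \<Longrightarrow> y \<in> Eob C \<Longrightarrow> z \<in> Eob C \<Longrightarrow>
      Ecmp C w x z \<cdot> (Ecmp C x y z \<boxtimes> Idn V (Hob C w x)) =
      Ecmp C w y z \<cdot> ((Idn V (Hob C y z) \<boxtimes> Ecmp C w x y) \<cdot>
        Assoc V (Hob C y z) (Hob C x y) (Hob C w x))"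
    and Eid_Ecmp: "x \<in> Eob C \<Longrightarrow> y \<in> Eob C \<Longrightarrow>
      Ecmp C x y y \<cdot> (Eid C y \<boxtimes> Idn V (Hob C x y)) = Lunit V (Hob C x y)"
    and Ecmp_Eid: "x \<in> Eob C \<Longrightarrow> y \<in> Eob C \<Longrightarrow>
      Ecmp C x x y \<cdot> (Idn V (Hob C x y) \<boxtimes> Eid C x) = Runit V (Hob C x y)"

text \<open>An arrow \<open>x \<rightarrow> y\<close> of the underlying category is a triple \<open>(x, y, u)\<close> with
  \<open>u : 1 \<rightarrow> Hob x y\<close> in \<open>V\<close>; the endpoints are recorded because \<open>u\<close> need not determine them.\<close>

type_synonym ('c, 'a) uarr = "'c \<times> 'c \<times> 'a"

definition point :: "('c, 'a) uarr \<Rightarrow> 'a" where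
  "point f = snd (snd f)"

definition underlying ::
  "('o, 'a, 'z) smcat_scheme \<Rightarrow> ('c, 'o, 'a) ecat \<Rightarrow> ('c, ('c, 'a) uarr) cat" where
  "underlying V C = \<lparr>
     Obj = Eob C,
     Arr = {(x, y, u). x \<in> Eob C \<and> y \<in> Eob C \<and> u \<in> hom V (Unit V) (Hob C x y)},
     Dom = (\<lambda>(x, y, u). x),
     Cod = (\<lambda>(x, y, u). y),
     Idn = (\<lambda>x. (x, x, Eid C x)),
     Cmp = (\<lambda>(y, z, v) (x, y', u).
       (x, z, Ecmp C x y z \<cdot>\<^bsub>V\<^esub> ((v \<boxtimes>\<^bsub>V\<^esub> u) \<cdot>\<^bsub>V\<^esub> inv_arr V (Lunit V (Unit V)))))\<rparr>"

text \<open>Postcomposition \<open>Hob x y \<rightarrow> Hob x z\<close> with \<open>g : y \<rightarrow> z\<close>, precomposition (restriction)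
  \<open>Hob y z \<rightarrow> Hob x z\<close> with \<open>f : x \<rightarrow> y\<close>, and for \<open>f : x' \<rightarrow> x\<close>, \<open>g : y \<rightarrow> y'\<close> the joint action
  \<open>Hob x y \<rightarrow> Hob x' y'\<close>.\<close>

definition post ::
  "('o, 'a, 'z) smcat_scheme \<Rightarrow> ('c, 'o, 'a) ecat \<Rightarrow> 'c \<Rightarrow> ('c, 'a) uarr \<Rightarrow> 'a" where
  "post V C x g = (case g of (y, z, v) \<Rightarrow>
     Ecmp C x y z \<cdot>\<^bsub>V\<^esub> ((v \<boxtimes>\<^bsub>V\<^esub> Idn V (Hob C x y)) \<cdot>\<^bsub>V\<^esub> inv_arr V (Lunit V (Hob C x y))))"

definition pre ::
  "('o, 'a, 'z) smcat_scheme \<Rightarrow> ('c, 'o, 'a) ecat \<Rightarrow> ('c, 'a) uarr \<Rightarrow> 'c \<Rightarrow> 'a" where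
  "pre V C f z = (case f of (x, y, u) \<Rightarrow>
     Ecmp C x y z \<cdot>\<^bsub>V\<^esub> ((Idn V (Hob C y z) \<boxtimes>\<^bsub>V\<^esub> u) \<cdot>\<^bsub>V\<^esub> inv_arr V (Runit V (Hob C y z))))"

definition HobA ::
  "('o, 'a, 'z) smcat_scheme \<Rightarrow> ('c, 'o, 'a) ecat \<Rightarrow> ('c, 'a) uarr \<Rightarrow> ('c, 'a) uarr \<Rightarrow> 'a" where
  "HobA V C f g =
     post V C (Dom (underlying V C) f) g \<cdot>\<^bsub>V\<^esub> pre V C f (Dom (underlying V C) g)"

text \<open>As usual for enriched categories, the initial and terminal objects of the underlying category
  are understood in the enriched sense: \<open>Hob e y\<close> and \<open>Hob y t\<close> are terminal in \<open>V\<close>. Without this,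
  the cases \<open>\<emptyset> \<rightarrow> b\<close> and \<open>x \<rightarrow> *\<close> of SM7 say nothing about the absolute hom-objects; in particular
  \<open>Hob x y\<close> need not be fibrant for cofibrant \<open>x\<close> and fibrant \<open>y\<close>.\<close>

locale enriched_model_category =
  enriched_category V C + model_category "underlying V C" M
  for V :: "('o, 'a, 'z) smcat_scheme" (structure)
    and C :: "('c, 'o, 'a) ecat"
    and M :: "('c, 'a) uarr model_structure" +
  assumes enriched_initial: "initial (underlying V C) e \<Longrightarrow> y \<in> Eob C \<Longrightarrow> terminal V (Hob C e y)"
    and enriched_terminal: "terminal (underlying V C) t \<Longrightarrow> y \<in> Eob C \<Longrightarrow> terminal V (Hob C y t)"

text \<open>For \<open>i : a \<rightarrow> b\<close> and \<open>p : x \<rightarrow> y\<close>, the arrow \<open>u\<close> is the induced map from \<open>Hob b x\<close> to a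
  pullback of \<open>Hob a x \<rightarrow> Hob a y \<leftarrow> Hob b y\<close> (with projections \<open>r\<close>, \<open>s\<close>).\<close>

definition SM7 ::
  "('o, 'a, 'z) smcat_scheme \<Rightarrow> 'a model_structure \<Rightarrow>
   ('c, 'o, 'a) ecat \<Rightarrow> ('c, 'a) uarr model_structure \<Rightarrow> bool" where
  "SM7 V MV C MC \<longleftrightarrow>
     (\<forall>a b i x y p r s u.
        i \<in> hom (underlying V C) a b \<and> i \<in> cof MC \<and>
        p \<in> hom (underlying V C) x y \<and> p \<in> fib MC \<and>
        is_pullback V (post V C a p) (pre V C i y) r s \<and>
        u \<in> hom V (Hob C b x) (Dom V r) \<and>
        r \<cdot>\<^bsub>V\<^esub> u = pre V C i x \<and> s \<cdot>\<^bsub>V\<^esub> u = post V C b p \<longrightarrow>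
        u \<in> fib MV \<and> (i \<in> weq MC \<or> p \<in> weq MC \<longrightarrow> u \<in> weq MV))"

section \<open>Weak tensorings\<close>

text \<open>\<open>Phi v x y\<close> is the map \<open>Hob (x \<otimes> v) y \<rightarrow> Ihom v (Hob x y)\<close> and \<open>Rho x\<close> the map
  \<open>x \<otimes> 1 \<rightarrow> x\<close>.\<close>

record ('c, 'o, 'a) wtens =
  WO :: "'c \<Rightarrow> 'o \<Rightarrow> 'c"
  WA :: "('c, 'a) uarr \<Rightarrow> 'a \<Rightarrow> ('c, 'a) uarr"
  Phi :: "'o \<Rightarrow> 'c \<Rightarrow> 'c \<Rightarrow> 'a"
  Rho :: "'c \<Rightarrow> ('c, 'a) uarr"

text \<open>The bifunctor is understood to preserve initial objects in each variable, as is implicit in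
  reading the pushout-product axiom at \<open>\<emptyset> \<rightarrow> x\<close> and \<open>\<emptyset> \<rightarrow> v\<close> as saying that \<open>x \<otimes> v\<close> is cofibrant.\<close>

locale weak_tensoring =
  bifunctor "underlying V C" V "underlying V C" "WO T" "WA T"
  for V :: "('o, 'a, 'z) smcat_scheme" (structure)
    and MV :: "'a model_structure"
    and C :: "('c, 'o, 'a) ecat"
    and MC :: "('c, 'a) uarr model_structure"
    and T :: "('c, 'o, 'a) wtens" +
  assumes external_pushout_product:
      "pushout_product_axiom (underlying V C) MC V MV (underlying V C) MC (WA T)"
    and WO_initial_left: "initial (underlying V C) e \<Longrightarrow> v \<in> Obj V \<Longrightarrow>
      initial (underlying V C) (WO T e v)"
    and WO_initial_right: "x \<in> Eob C \<Longrightarrow> initial V w \<Longrightarrow> initial (underlying V C) (WO T x w)"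
    and Phi_hom: "v \<in> Obj V \<Longrightarrow> x \<in> Eob C \<Longrightarrow> y \<in> Eob C \<Longrightarrow>
      Phi T v x y \<in> hom V (Hob C (WO T x v) y) (Ihom V v (Hob C x y))"
    and Phi_natural: "h \<in> hom V v' v \<Longrightarrow> f \<in> hom (underlying V C) x' x \<Longrightarrow>
      g \<in> hom (underlying V C) y y' \<Longrightarrow>
      Phi T v' x' y' \<cdot> HobA V C (WA T f h) g = IhomA V h (HobA V C f g) \<cdot> Phi T v x y"
    and Phi_weq: "cofibrant V MV v \<Longrightarrow> cofibrant (underlying V C) MC x \<Longrightarrow>
      fibrant (underlying V C) MC y \<Longrightarrow> Phi T v x y \<in> weq MV"
    and Rho_hom: "x \<in> Eob C \<Longrightarrow> Rho T x \<in> hom (underlying V C) (WO T x (Unit V)) x"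
    and Rho_natural: "f \<in> hom (underlying V C) x y \<Longrightarrow>
      Rho T y \<cdot>\<^bsub>underlying V C\<^esub> WA T f (Idn V (Unit V)) = f \<cdot>\<^bsub>underlying V C\<^esub> Rho T x"
    and Phi_Rho: "x \<in> Eob C \<Longrightarrow> y \<in> Eob C \<Longrightarrow>
      Phi T (Unit V) x y \<cdot> pre V C (Rho T x) y = Ihom_Unit_iso V (Hob C x y)"

definition set_compatible ::
  "('o, 'a, 'z) smcat_scheme \<Rightarrow> ('c, 'o, 'a) ecat \<Rightarrow> ('c, 'o, 'a) wtens \<Rightarrow> bool" where
  "set_compatible V C T \<longleftrightarrow>
     (\<forall>v \<in> Obj V. \<forall>x \<in> Eob C. \<forall>y \<in> Eob C.
        bij_betw (\<lambda>u. Phi T v x y \<cdot>\<^bsub>V\<^esub> u)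
          (hom V (Unit V) (Hob C (WO T x v) y)) (hom V (Unit V) (Ihom V v (Hob C x y))))"

section \<open>The three conditions\<close>

text \<open>The bijection from homotopy classes of maps to \<open>[x, y]\<close>, and the map from homotopy classes to
  \<open>[1, Hob x y]\<close> induced by \<open>f \<mapsto> localization (point f)\<close>. Both are constant on homotopy classes for
  \<open>x\<close> cofibrant and \<open>y\<close> fibrant, so that \<open>the_elem\<close> picks out their value.\<close>

definition class_to_ho ::
  "('o, 'a, 'z) cat_scheme \<Rightarrow> 'a model_structure \<Rightarrow> 'a set \<Rightarrow> 'a step list set" where
  "class_to_ho C M K = the_elem (localization C M ` K)"

definition class_to_ho_Hob ::
  "('o, 'a, 'z) smcat_scheme \<Rightarrow> 'a model_structure \<Rightarrow> ('c, 'a) uarr set \<Rightarrow> 'a step list set" where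
  "class_to_ho_Hob V MV K = the_elem ((\<lambda>f. localization V MV (point f)) ` K)"

definition canonical_map ::
  "('o, 'a, 'z) smcat_scheme \<Rightarrow> 'a model_structure \<Rightarrow>
   ('c, 'o, 'a) ecat \<Rightarrow> ('c, 'a) uarr model_structure \<Rightarrow> 'c \<Rightarrow> 'c \<Rightarrow>
   ('c, 'a) uarr step list set \<Rightarrow> 'a step list set" where
  "canonical_map V MV C MC x y \<alpha> =
     class_to_ho_Hob V MV
       (inv_into (hom (underlying V C) x y // homotopy_rel (underlying V C) MC x y)
         (class_to_ho (underlying V C) MC) \<alpha>)"

definition pi0_of_mapping_space ::
  "('o, 'a, 'z) smcat_scheme \<Rightarrow> 'a model_structure \<Rightarrow>
   ('c, 'o, 'a) ecat \<Rightarrow> ('c, 'a) uarr model_structure \<Rightarrow> bool" where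
  "pi0_of_mapping_space V MV C MC \<longleftrightarrow>
     (\<forall>x y. cofibrant (underlying V C) MC x \<and> fibrant (underlying V C) MC y \<longrightarrow>
        bij_betw (canonical_map V MV C MC x y)
          (ho_hom (underlying V C) MC x y) (ho_hom V MV (Unit V) (Hob C x y)))"

definition detection_property ::
  "('o, 'a, 'z) smcat_scheme \<Rightarrow> 'a model_structure \<Rightarrow>
   ('c, 'o, 'a) ecat \<Rightarrow> ('c, 'a) uarr model_structure \<Rightarrow> bool" where
  "detection_property V MV C MC \<longleftrightarrow>
     (\<forall>x y f. cofibrant (underlying V C) MC x \<and> cofibrant (underlying V C) MC y \<and>
        f \<in> hom (underlying V C) x y \<and>
        (\<forall>z. fibrant (underlying V C) MC z \<longrightarrow> pre V C f z \<in> weq MV) \<longrightarrow>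
        f \<in> weq MC)"

definition external_unit_axiom ::
  "('o, 'a, 'z) smcat_scheme \<Rightarrow> 'a model_structure \<Rightarrow> ('c, 'o, 'a) ecat \<Rightarrow>
   ('c, 'a) uarr model_structure \<Rightarrow> ('c, 'o, 'a) wtens \<Rightarrow> bool" where
  "external_unit_axiom V MV C MC T \<longleftrightarrow>
     (\<forall>Q q x. cofibrant_replacement V MV (Unit V) Q q \<and> cofibrant (underlying V C) MC x \<longrightarrow>
        Rho T x \<cdot>\<^bsub>underlying V C\<^esub> WA T (Idn (underlying V C) x) q \<in> weq MC)"

end

theory Submission
  imports Defs
begin

text \<open>
  Everything rests on one fact about model categories: for \<open>x\<close> cofibrant and \<open>y\<close> fibrant, the maps
  \<open>x \<rightarrow> y\<close> of the homotopy category are the homotopy classes of arrows \<open>x \<rightarrow> y\<close>. It is proved in the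
  form \<open>cofibrant_zigzag_representable\<close> (every zigzag is an arrow), \<open>ho_eq_cylinder_homotopy\<close> and
  \<open>ho_eq_path_homotopy\<close> (arrows with the same image are homotopic through any prescribed cylinder
  or path object). It gives saturation, that is, arrows invertible in the homotopy category are weak
  equivalences, and hence Yoneda criteria for weak equivalences (\<open>weq_if_pre_bijective\<close>,
  \<open>weq_if_post_bijective\<close>). Write \<open>\<C>(x, y)\<close> for the hom-object \<open>Hob C x y\<close>, \<open>\<V>(v, w)\<close> for
  the internal hom \<open>Ihom V v w\<close> and \<open>1\<close> for the unit, and let \<open>q : Q \<rightarrow> 1\<close> be a cofibrant replacement.

  Assume the \<open>\<pi>\<^sub>0\<close> condition. If \<open>f : x \<rightarrow> y\<close> induces weak equivalences \<open>\<C>(y, z) \<rightarrow> \<C>(x, z)\<close>, then it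
  induces bijections on \<open>[1, -]\<close>, that is, bijections \<open>[y, z] \<rightarrow> [x, z]\<close> for all fibrant \<open>z\<close>. By Yoneda,
  \<open>f\<close> is a weak equivalence.

  Assume the detection property. Let \<open>f : x \<otimes> Q \<rightarrow> x\<close> be the map in the external unit axiom. The weak
  equivalence \<open>\<phi> : \<C>(x \<otimes> Q, z) \<rightarrow> \<V>(Q, \<C>(x, z))\<close> turns \<open>f\<^sup>*\<close> into the map \<open>W \<rightarrow> \<V>(Q, W)\<close> given by \<open>q\<close>, where
  \<open>W = \<C>(x, z)\<close> is fibrant by SM7. Through the Quillen adjunction between \<open>- \<otimes> Q\<close> and \<open>\<V>(Q, -)\<close>, this
  map acts on \<open>[a, -]\<close> as precomposition with \<open>a \<otimes> Q \<rightarrow> a\<close>, which is a weak equivalence for cofibrant \<open>a\<close>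
  by the unit axiom of \<open>\<V>\<close>. By Yoneda, \<open>W \<rightarrow> \<V>(Q, W)\<close> is a weak equivalence, hence so is \<open>f\<^sup>*\<close>.

  Assume the external unit axiom and set-compatibility. The latter makes \<open>x \<otimes> -\<close> left adjoint to \<open>\<C>(x, -)\<close> on
  underlying categories, and the adjunction is Quillen for cofibrant \<open>x\<close>. So
  \<open>[x, y] \<cong> [x \<otimes> Q, y] \<cong> [Q, \<C>(x, y)] \<cong> [1, \<C>(x, y)]\<close>, where the first bijection is the external unit axiom;
  the composite is the canonical map because the adjunct of \<open>g f\<close> is the point of \<open>g\<close> composed with \<open>q\<close>.
\<close>

section \<open>Categories and their duals\<close>

lemma hom_iff: "f \<in> hom C x y \<longleftrightarrow> f \<in> Arr C \<and> Dom C f = x \<and> Cod C f = y"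
  by (auto simp: hom_def)

context category
begin

lemma arr_hom: "f \<in> Arr C \<Longrightarrow> f \<in> hom C (Dom C f) (Cod C f)"
  by (simp add: hom_iff)

lemma Cmp_simps [simp]:
  assumes "f \<in> Arr C" "g \<in> Arr C" "Dom C g = Cod C f"
  shows "g \<cdot> f \<in> Arr C" "Dom C (g \<cdot> f) = Dom C f" "Cod C (g \<cdot> f) = Cod C g"
  using Cmp_hom[of f "Dom C f" "Cod C f" g "Cod C g"] assms by (simp_all add: hom_iff)

lemma Idn_simps [simp]:
  assumes "x \<in> Obj C"
  shows "Idn C x \<in> Arr C" "Dom C (Idn C x) = x" "Cod C (Idn C x) = x"
  using Idn_hom[OF assms] by (simp_all add: hom_iff)

lemma Cmp_Idn_simps [simp]:
  assumes "f \<in> Arr C"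
  shows "Dom C f = x \<Longrightarrow> f \<cdot> Idn C x = f" "Cod C f = y \<Longrightarrow> Idn C y \<cdot> f = f"
  using Cmp_Idn Idn_Cmp assms by (auto simp: hom_iff)

lemma assoc [simp]:
  assumes "f \<in> Arr C" "g \<in> Arr C" "h \<in> Arr C" "Dom C g = Cod C f" "Dom C h = Cod C g"
  shows "(h \<cdot> g) \<cdot> f = h \<cdot> (g \<cdot> f)"
  using Cmp_assoc[of f "Dom C f" "Cod C f" g "Cod C g" h "Cod C h"] assms by (simp add: hom_iff)

lemma Dom_Cod_Obj [simp]: "f \<in> Arr C \<Longrightarrow> Dom C f \<in> Obj C" "f \<in> Arr C \<Longrightarrow> Cod C f \<in> Obj C"
  by (simp_all add: Dom_Obj Cod_Obj)

lemma hom_Obj: "f \<in> hom C x y \<Longrightarrow> x \<in> Obj C" "f \<in> hom C x y \<Longrightarrow> y \<in> Obj C"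
  by (auto simp: hom_iff)

text \<open>Composites are normalised to the right, so that an equation \<open>g \<cdot> f = k\<close> is not visible inside
  \<open>g \<cdot> (f \<cdot> r)\<close>; this lemma applies it there.\<close>

lemma assoc_subst:
  assumes "g \<cdot> f = k" "f \<in> Arr C" "g \<in> Arr C" "Dom C g = Cod C f" "r \<in> Arr C" "Dom C f = Cod C r"
  shows "g \<cdot> (f \<cdot> r) = k \<cdot> r"
  using assms by (simp flip: assoc)

lemma inverses_unique:
  assumes "inverses C f g" "inverses C f g'"
  shows "g = g'"
proof -
  have "g = g \<cdot> (f \<cdot> g')" using assms by (simp add: inverses_def hom_iff)
  also have "\<dots> = (g \<cdot> f) \<cdot> g'" using assms by (subst assoc) (simp_all add: inverses_def hom_iff)
  also have "\<dots> = g'" using assms by (simp add: inverses_def hom_iff)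
  finally show ?thesis .
qed

lemma inv_arr_inverses:
  assumes "iso C f" shows "inverses C f (inv_arr C f)"
  using assms inverses_unique unfolding inv_arr_def iso_def by (metis theI)

lemma inv_arr_simps:
  assumes "iso C f"
  shows "f \<in> Arr C" "inv_arr C f \<in> Arr C" "Dom C (inv_arr C f) = Cod C f"
    "Cod C (inv_arr C f) = Dom C f" "inv_arr C f \<cdot> f = Idn C (Dom C f)"
    "f \<cdot> inv_arr C f = Idn C (Cod C f)"
  using inv_arr_inverses[OF assms] by (simp_all add: inverses_def hom_iff)

lemma iso_cancel_right:
  assumes "iso C f" "g \<in> Arr C" "h \<in> Arr C" "Dom C g = Cod C f" "Dom C h = Cod C f"
    and "g \<cdot> f = h \<cdot> f"
  shows "g = h"
proof -
  have "k \<cdot> (f \<cdot> inv_arr C f) = (k \<cdot> f) \<cdot> inv_arr C f" if "k \<in> Arr C" "Dom C k = Cod C f" for k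
    using that assms(1) by (simp add: inv_arr_simps)
  from this[of g] this[of h] show ?thesis using assms by (simp add: inv_arr_simps)
qed

lemma iso_cancel_left:
  assumes "iso C f" "g \<in> Arr C" "h \<in> Arr C" "Cod C g = Dom C f" "Cod C h = Dom C f"
    and "f \<cdot> g = f \<cdot> h"
  shows "g = h"
proof -
  have "(inv_arr C f \<cdot> f) \<cdot> k = inv_arr C f \<cdot> (f \<cdot> k)" if "k \<in> Arr C" "Cod C k = Dom C f" for k
    using that assms(1) by (subst assoc) (simp_all add: inv_arr_simps)
  from this[of g] this[of h] show ?thesis using assms by (simp add: inv_arr_simps)
qed

lemma initial_arr:
  assumes "initial C e" "x \<in> Obj C"
  obtains f where "f \<in> hom C e x"
  using assms by (auto simp: initial_def)

lemma initial_eq: "initial C e \<Longrightarrow> f \<in> hom C e x \<Longrightarrow> g \<in> hom C e x \<Longrightarrow> f = g"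
  unfolding initial_def using hom_Obj(2) by metis

lemma initial_iso:
  assumes "initial C e" "f \<in> hom C e e'" "g \<in> hom C e' e" "f \<cdot> g = Idn C e'"
  shows "initial C e'"
  unfolding initial_def
proof (intro conjI ballI)
  show "e' \<in> Obj C" using assms hom_Obj by blast
  fix x assume "x \<in> Obj C"
  then obtain k where k: "k \<in> hom C e x" using initial_arr assms(1) by blast
  show "\<exists>!h. h \<in> hom C e' x"
  proof
    show "k \<cdot> g \<in> hom C e' x" using k assms by (simp add: hom_iff)
    fix h assume h: "h \<in> hom C e' x"
    have "h \<cdot> f = k" using h k assms by (intro initial_eq[OF assms(1)]) (simp_all add: hom_iff)
    then have "k \<cdot> g = h \<cdot> (f \<cdot> g)" using h assms by (auto simp: hom_iff)
    then show "h = k \<cdot> g" using h assms by (simp add: hom_iff)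
  qed
qed

end

text \<open>Dualising exchanges cofibrations with fibrations and cylinders with path objects, so that only
  one half of each pair of dual facts needs an argument.\<close>

definition dual :: "('o, 'a, 'z) cat_scheme \<Rightarrow> ('o, 'a) cat" where
  "dual C = \<lparr>Obj = Obj C, Arr = Arr C, Dom = Cod C, Cod = Dom C, Idn = Idn C,
     Cmp = (\<lambda>f g. g \<cdot>\<^bsub>C\<^esub> f)\<rparr>"

definition dual_model :: "'a model_structure \<Rightarrow> 'a model_structure" where
  "dual_model M = \<lparr>weq = weq M, cof = fib M, fib = cof M\<rparr>"

lemma dual_simps [simp]:
  "Obj (dual C) = Obj C" "Arr (dual C) = Arr C" "Dom (dual C) = Cod C" "Cod (dual C) = Dom C"
  "Idn (dual C) = Idn C" "f \<cdot>\<^bsub>dual C\<^esub> g = g \<cdot>\<^bsub>C\<^esub> f" "hom (dual C) x y = hom C y x"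
  "weq (dual_model M) = weq M" "cof (dual_model M) = fib M" "fib (dual_model M) = cof M"
  by (auto simp: dual_def dual_model_def hom_def)

lemma dual_notions [simp]:
  "initial (dual C) e \<longleftrightarrow> terminal C e" "terminal (dual C) e \<longleftrightarrow> initial C e"
  "is_coproduct (dual C) a b s i j \<longleftrightarrow> is_product C a b s i j"
  "is_product (dual C) a b s i j \<longleftrightarrow> is_coproduct C a b s i j"
  "is_pushout (dual C) f g p q \<longleftrightarrow> is_pullback C f g p q"
  "is_pullback (dual C) f g p q \<longleftrightarrow> is_pushout C f g p q"
  by (simp_all add: initial_def terminal_def is_coproduct_def is_product_def
      is_pushout_def is_pullback_def)

lemma dual_cofibrant [simp]:
  "cofibrant (dual C) (dual_model M) x \<longleftrightarrow> fibrant C M x"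
  "fibrant (dual C) (dual_model M) x \<longleftrightarrow> cofibrant C M x"
  by (simp_all add: cofibrant_def fibrant_def)

lemma lifts_dual [simp]: "lifts (dual C) p i \<longleftrightarrow> lifts C i p"
  unfolding lifts_def dual_simps eq_commute[of "_ \<cdot>\<^bsub>C\<^esub> i" "p \<cdot>\<^bsub>C\<^esub> _"] by blast

lemma retract_dual:
  assumes "retract_of (dual C) f g"
  shows "retract_of C f g"
proof -
  obtain i r j s where "i \<in> hom C (Cod C g) (Cod C f)" "r \<in> hom C (Cod C f) (Cod C g)"
    "j \<in> hom C (Dom C g) (Dom C f)" "s \<in> hom C (Dom C f) (Dom C g)"
    "i \<cdot>\<^bsub>C\<^esub> r = Idn C (Cod C f)" "j \<cdot>\<^bsub>C\<^esub> s = Idn C (Dom C f)"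
    "i \<cdot>\<^bsub>C\<^esub> g = f \<cdot>\<^bsub>C\<^esub> j" "r \<cdot>\<^bsub>C\<^esub> f = g \<cdot>\<^bsub>C\<^esub> s"
    using assms unfolding retract_of_def dual_simps by blast
  with assms show ?thesis unfolding retract_of_def dual_simps
    by (intro conjI exI[of _ s] exI[of _ j] exI[of _ r] exI[of _ i]) simp_all
qed

lemma (in category) category_dual: "category (dual C)"
  by unfold_locales (auto simp: hom_iff)

lemma (in model_category) model_category_dual: "model_category (dual C) (dual_model M)"
proof -
  interpret d: category "dual C" by (rule category_dual)
  show ?thesis
  proof
    fix f x y
    show "\<exists>z i p. i \<in> hom (dual C) x z \<and> p \<in> hom (dual C) z y \<and> f = p \<cdot>\<^bsub>dual C\<^esub> i \<and>
        i \<in> cof (dual_model M) \<and> p \<in> fib (dual_model M) \<and> p \<in> weq (dual_model M)"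
      if "f \<in> hom (dual C) x y"
      using factor_acyclic_cof[of f y x] that by auto
    show "\<exists>z i p. i \<in> hom (dual C) x z \<and> p \<in> hom (dual C) z y \<and> f = p \<cdot>\<^bsub>dual C\<^esub> i \<and>
        i \<in> cof (dual_model M) \<and> i \<in> weq (dual_model M) \<and> p \<in> fib (dual_model M)"
      if "f \<in> hom (dual C) x y"
      using factor_cof[of f y x] that by auto
  next
    fix f g x y z assume fg: "f \<in> hom (dual C) x y" "g \<in> hom (dual C) y z"
    then have hom: "f \<in> hom C y x" "g \<in> hom C z y" by simp_all
    show "f \<in> weq (dual_model M) \<Longrightarrow> g \<in> weq (dual_model M) \<Longrightarrow> g \<cdot>\<^bsub>dual C\<^esub> f \<in> weq (dual_model M)"
      using weq_Cmp[OF hom(2,1)] by simp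
    show "g \<in> weq (dual_model M) \<Longrightarrow> g \<cdot>\<^bsub>dual C\<^esub> f \<in> weq (dual_model M) \<Longrightarrow> f \<in> weq (dual_model M)"
      using weq_cancel_right[OF hom(2,1)] by simp
    show "f \<in> weq (dual_model M) \<Longrightarrow> g \<cdot>\<^bsub>dual C\<^esub> f \<in> weq (dual_model M) \<Longrightarrow> g \<in> weq (dual_model M)"
      using weq_cancel_left[OF hom(2,1)] by simp
  next
    fix f g assume r: "retract_of (dual C) f g"
    show "g \<in> weq (dual_model M) \<Longrightarrow> f \<in> weq (dual_model M)"
      using weq_retract[OF retract_dual[OF r]] by simp
    show "g \<in> cof (dual_model M) \<Longrightarrow> f \<in> cof (dual_model M)"
      using fib_retract[OF retract_dual[OF r]] by simp
    show "g \<in> fib (dual_model M) \<Longrightarrow> f \<in> fib (dual_model M)"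
      using cof_retract[OF retract_dual[OF r]] by simp
  next
    show "weq (dual_model M) \<subseteq> Arr (dual C)" "cof (dual_model M) \<subseteq> Arr (dual C)"
      "fib (dual_model M) \<subseteq> Arr (dual C)" using weq_Arr cof_Arr fib_Arr by simp_all
    show "\<exists>e. initial (dual C) e" "\<exists>t. terminal (dual C) t"
      using ex_initial ex_terminal by simp_all
  qed (simp_all add: ex_pushout ex_pullback cof_lifts acyclic_cof_lifts)
qed

section \<open>Lifting, cylinders and path objects\<close>

lemma lifts_obtain:
  assumes "lifts C i p" "i \<in> hom C a b" "p \<in> hom C x y" "u \<in> hom C a x" "v \<in> hom C b y"
    and "p \<cdot>\<^bsub>C\<^esub> u = v \<cdot>\<^bsub>C\<^esub> i"
  obtains h where "h \<in> hom C b x" "h \<cdot>\<^bsub>C\<^esub> i = u" "p \<cdot>\<^bsub>C\<^esub> h = v"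
proof -
  have "u \<in> hom C (Dom C i) (Dom C p)" "v \<in> hom C (Cod C i) (Cod C p)"
    using assms by (simp_all add: hom_iff)
  then obtain h where "h \<in> hom C (Cod C i) (Dom C p)" "h \<cdot>\<^bsub>C\<^esub> i = u" "p \<cdot>\<^bsub>C\<^esub> h = v"
    using assms(1,6) unfolding lifts_def by blast
  then show ?thesis using that assms(2,3) by (simp add: hom_iff)
qed

lemma retract_ofI:
  assumes "f \<in> Arr C" "g \<in> Arr C"
    and "i \<in> hom C (Dom C f) (Dom C g)" "r \<in> hom C (Dom C g) (Dom C f)"
    and "j \<in> hom C (Cod C f) (Cod C g)" "s \<in> hom C (Cod C g) (Cod C f)"
    and "r \<cdot>\<^bsub>C\<^esub> i = Idn C (Dom C f)" "s \<cdot>\<^bsub>C\<^esub> j = Idn C (Cod C f)"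
    and "g \<cdot>\<^bsub>C\<^esub> i = j \<cdot>\<^bsub>C\<^esub> f" "f \<cdot>\<^bsub>C\<^esub> r = s \<cdot>\<^bsub>C\<^esub> g"
  shows "retract_of C f g"
  using assms unfolding retract_of_def by blast

text \<open>Quillen's good cylinders: the fold map of \<open>x\<close> factored as a cofibration \<open>x + x \<rightarrow> c\<close> and a weak
  equivalence \<open>w\<close>. The coproduct is hidden behind the two ends \<open>e0\<close>, \<open>e1\<close>, and its use is summed up in
  \<open>cylinder_lift\<close>.\<close>

definition cylinder ::
  "('o, 'a, 'z) cat_scheme \<Rightarrow> 'a model_structure \<Rightarrow> 'o \<Rightarrow> 'o \<Rightarrow> 'a \<Rightarrow> 'a \<Rightarrow> 'a \<Rightarrow> bool" where
  "cylinder C M x c e0 e1 w \<longleftrightarrow>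
     (\<exists>s i0 i1 j. is_coproduct C x x s i0 i1 \<and> j \<in> hom C s c \<and> j \<in> cof M \<and>
        w \<in> hom C c x \<and> w \<in> weq M \<and> e0 = j \<cdot>\<^bsub>C\<^esub> i0 \<and> e1 = j \<cdot>\<^bsub>C\<^esub> i1 \<and>
        w \<cdot>\<^bsub>C\<^esub> e0 = Idn C x \<and> w \<cdot>\<^bsub>C\<^esub> e1 = Idn C x)"

text \<open>A path object for \<open>y\<close> is a cylinder in the dual category: \<open>d0\<close>, \<open>d1 : c \<rightarrow> y\<close> are the endpoints and
  \<open>w : y \<rightarrow> c\<close> is the inclusion of the constant paths.\<close>

abbreviation path_object where
  "path_object C M y c d0 d1 w \<equiv> cylinder (dual C) (dual_model M) y c d0 d1 w"

lemma left_homotopic_iff: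
  "left_homotopic C M x y f g \<longleftrightarrow>
     (\<exists>c e0 e1 w H. cylinder C M x c e0 e1 w \<and> H \<in> hom C c y \<and>
        H \<cdot>\<^bsub>C\<^esub> e0 = f \<and> H \<cdot>\<^bsub>C\<^esub> e1 = g)"
  unfolding left_homotopic_def cylinder_def by blast

lemma right_homotopic_dual:
  "right_homotopic C M x y f g \<longleftrightarrow> left_homotopic (dual C) (dual_model M) y x f g"
  unfolding left_homotopic_def right_homotopic_def dual_simps dual_notions ..

context model_category
begin

lemma weq_in_Arr [simp]: "f \<in> weq M \<Longrightarrow> f \<in> Arr C"
  and cof_in_Arr: "f \<in> cof M \<Longrightarrow> f \<in> Arr C"
  and fib_in_Arr: "f \<in> fib M \<Longrightarrow> f \<in> Arr C"
  using weq_Arr cof_Arr fib_Arr by auto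

lemma Idn_weq:
  assumes x: "x \<in> Obj C" shows "Idn C x \<in> weq M"
proof -
  obtain z i where i: "i \<in> hom C x z" "i \<in> weq M" using factor_acyclic_cof[OF Idn_hom[OF x]] by blast
  then have "i \<cdot> Idn C x \<in> weq M" by (simp add: hom_iff)
  then show ?thesis using weq_cancel_left[OF Idn_hom[OF x] i] by blast
qed

text \<open>The retract argument: factor \<open>f\<close> as an acyclic cofibration followed by a fibration; a lift of \<open>f\<close>
  against the fibration exhibits \<open>f\<close> as a retract of the acyclic cofibration.\<close>

lemma acyclic_cof_if_lifts:
  assumes f: "f \<in> Arr C" and l: "\<And>p. p \<in> fib M \<Longrightarrow> lifts C f p"
  shows "f \<in> cof M" "f \<in> weq M"
proof -
  obtain z i p where z: "i \<in> hom C (Dom C f) z" "p \<in> hom C z (Cod C f)" "f = p \<cdot> i"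
    "i \<in> cof M" "i \<in> weq M" "p \<in> fib M"
    using factor_acyclic_cof[OF arr_hom[OF f]] by blast
  obtain h where h: "h \<in> hom C (Cod C f) z" "h \<cdot> f = i" "p \<cdot> h = Idn C (Cod C f)"
  proof (rule lifts_obtain[OF l[OF z(6)] arr_hom[OF f] z(2) z(1) Idn_hom])
    show "p \<cdot> i = Idn C (Cod C f) \<cdot> f" using f z(3) by simp
  qed (use f in simp_all)
  have "retract_of C f i"
    by (rule retract_ofI[of _ _ _ "Idn C (Dom C f)" "Idn C (Dom C f)" h p])
      (use f z(1,2) z(3)[symmetric] h in \<open>simp_all add: hom_iff\<close>)
  then show "f \<in> cof M" "f \<in> weq M" using z cof_retract weq_retract by blast+
qed

lemma cof_if_lifts:
  assumes f: "f \<in> Arr C" and l: "\<And>p. p \<in> fib M \<Longrightarrow> p \<in> weq M \<Longrightarrow> lifts C f p"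
  shows "f \<in> cof M"
proof -
  obtain z i p where z: "i \<in> hom C (Dom C f) z" "p \<in> hom C z (Cod C f)" "f = p \<cdot> i"
    "i \<in> cof M" "p \<in> fib M" "p \<in> weq M"
    using factor_cof[OF arr_hom[OF f]] by blast
  obtain h where h: "h \<in> hom C (Cod C f) z" "h \<cdot> f = i" "p \<cdot> h = Idn C (Cod C f)"
  proof (rule lifts_obtain[OF l[OF z(5,6)] arr_hom[OF f] z(2) z(1) Idn_hom])
    show "p \<cdot> i = Idn C (Cod C f) \<cdot> f" using f z(3) by simp
  qed (use f in simp_all)
  have "retract_of C f i"
    by (rule retract_ofI[of _ _ _ "Idn C (Dom C f)" "Idn C (Dom C f)" h p])
      (use f z(1,2) z(3)[symmetric] h in \<open>simp_all add: hom_iff\<close>)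
  then show "f \<in> cof M" using z cof_retract by blast
qed

lemma cofibrant_Obj: "cofibrant C M x \<Longrightarrow> x \<in> Obj C"
  and fibrant_Obj: "fibrant C M x \<Longrightarrow> x \<in> Obj C"
  by (simp_all add: cofibrant_def fibrant_def)

lemma cofibrant_lift:
  assumes "cofibrant C M x" "p \<in> hom C a b" "p \<in> fib M" "p \<in> weq M" "v \<in> hom C x b"
  obtains u where "u \<in> hom C x a" "p \<cdot> u = v"
proof -
  obtain e where e: "initial C e" using ex_initial by blast
  obtain i where i: "i \<in> hom C e x" using initial_arr[OF e cofibrant_Obj[OF assms(1)]] by blast
  obtain k where k: "k \<in> hom C e a" using initial_arr[OF e] assms(2) hom_Obj by blast
  have "i \<in> cof M" using assms(1) e i by (auto simp: cofibrant_def)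
  moreover have "p \<cdot> k = v \<cdot> i" using k i assms(2,5) by (intro initial_eq[OF e, of "p \<cdot> k" b]) (auto simp: hom_iff)
  ultimately show ?thesis using lifts_obtain[OF cof_lifts i assms(2) k assms(5)] assms that by blast
qed

lemma cofibrantI:
  assumes x: "x \<in> Obj C"
    and l: "\<And>p a b v. p \<in> hom C a b \<Longrightarrow> p \<in> fib M \<Longrightarrow> p \<in> weq M \<Longrightarrow> v \<in> hom C x b \<Longrightarrow>
      \<exists>u. u \<in> hom C x a \<and> p \<cdot> u = v"
  shows "cofibrant C M x"
  unfolding cofibrant_def
proof (intro conjI x allI impI, elim conjE)
  fix e f assume e: "initial C e" and f: "f \<in> hom C e x"
  show "f \<in> cof M"
  proof (rule cof_if_lifts)
    show "f \<in> Arr C" using f by (simp add: hom_iff)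
    fix p assume p: "p \<in> fib M" "p \<in> weq M"
    show "lifts C f p" unfolding lifts_def
    proof (intro allI impI, elim conjE)
      fix u v assume u: "u \<in> hom C (Dom C f) (Dom C p)" and v: "v \<in> hom C (Cod C f) (Cod C p)"
      obtain h where h: "h \<in> hom C x (Dom C p)" "p \<cdot> h = v"
        using l[OF arr_hom[of p], of v] p v f fib_in_Arr by (auto simp: hom_iff)
      moreover have "h \<cdot> f = u" using e f h u by (intro initial_eq[OF e, of "h \<cdot> f" _ u]) (auto simp: hom_iff)
      ultimately show "\<exists>h\<in>hom C (Cod C f) (Dom C p). h \<cdot> f = u \<and> p \<cdot> h = v"
        using f by (auto simp: hom_iff)
    qed
  qed
qed

lemma cof_from_cofibrant:
  assumes "cofibrant C M x" "i \<in> hom C x y" "i \<in> cof M"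
  shows "cofibrant C M y"
proof (rule cofibrantI)
  show "y \<in> Obj C" using assms hom_Obj by blast
  fix p a b v assume p: "p \<in> hom C a b" "p \<in> fib M" "p \<in> weq M" and v: "v \<in> hom C y b"
  have "v \<cdot> i \<in> hom C x b" using v assms Cmp_hom by blast
  then obtain u where u: "u \<in> hom C x a" "p \<cdot> u = v \<cdot> i"
    using cofibrant_lift[OF assms(1) p] by blast
  show "\<exists>u. u \<in> hom C y a \<and> p \<cdot> u = v"
    using lifts_obtain[OF cof_lifts[OF assms(3) p(2,3)] assms(2) p(1) u(1) v u(2)] by blast
qed

lemma cofibrant_replacement_ex:
  assumes "x \<in> Obj C"
  obtains Q q where "cofibrant C M Q" "q \<in> hom C Q x" "q \<in> fib M" "q \<in> weq M"
proof -
  obtain e where e: "initial C e" using ex_initial by blast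
  obtain f where f: "f \<in> hom C e x" using initial_arr[OF e assms] by blast
  obtain Q i q where Q: "i \<in> hom C e Q" "q \<in> hom C Q x" "i \<in> cof M" "q \<in> fib M" "q \<in> weq M"
    using factor_cof[OF f] by blast
  have "cofibrant C M e"
  proof (rule cofibrantI)
    show "e \<in> Obj C" using e by (simp add: initial_def)
    fix p a b v assume p: "p \<in> hom C a b" and v: "v \<in> hom C e b"
    obtain u where u: "u \<in> hom C e a" using initial_arr[OF e] p hom_Obj by blast
    have "p \<cdot> u = v" using initial_eq[OF e Cmp_hom[OF u p] v] .
    then show "\<exists>u. u \<in> hom C e a \<and> p \<cdot> u = v" using u by blast
  qed
  then show ?thesis using cof_from_cofibrant Q that by blast
qed

lemma coproduct_ex:
  assumes "x \<in> Obj C" "y \<in> Obj C"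
  obtains s i j where "is_coproduct C x y s i j"
proof -
  obtain e where e: "initial C e" using ex_initial by blast
  obtain f where f: "f \<in> hom C e x" using initial_arr[OF e assms(1)] by blast
  obtain g where g: "g \<in> hom C e y" using initial_arr[OF e assms(2)] by blast
  obtain p q where pq: "is_pushout C f g p q" using ex_pushout[of f g] f g by (auto simp: hom_iff)
  have fg: "Cod C f = x" "Cod C g = y" using f g by (simp_all add: hom_iff)
  have "\<exists>!h. h \<in> hom C (Cod C p) c \<and> h \<cdot> p = u \<and> h \<cdot> q = v"
    if "u \<in> hom C x c" "v \<in> hom C y c" for u v c
  proof -
    have "u \<cdot> f = v \<cdot> g"
      using initial_eq[OF e Cmp_hom[OF f that(1)] Cmp_hom[OF g that(2)]] .
    with pq that fg show ?thesis unfolding is_pushout_def by blast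
  qed
  moreover have "p \<in> hom C x (Cod C p)" "q \<in> hom C y (Cod C p)"
    using pq fg by (simp_all add: is_pushout_def hom_iff)
  ultimately have "is_coproduct C x y (Cod C p) p q"
    unfolding is_coproduct_def by blast
  then show ?thesis using that by blast
qed

lemma cylinderD:
  assumes "cylinder C M x c e0 e1 w"
  shows "e0 \<in> hom C x c" "e1 \<in> hom C x c" "w \<in> hom C c x" "w \<in> weq M"
    "w \<cdot> e0 = Idn C x" "w \<cdot> e1 = Idn C x"
  using assms by (auto simp: cylinder_def is_coproduct_def hom_iff)

lemma cylinder_swap:
  assumes "cylinder C M x c e0 e1 w"
  shows "cylinder C M x c e1 e0 w"
proof -
  have "is_coproduct C x x s j i" if "is_coproduct C x x s i j" for s i j
    using that unfolding is_coproduct_def by blast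
  then show ?thesis using assms unfolding cylinder_def by blast
qed

lemma cylinder_ex:
  assumes x: "x \<in> Obj C"
  obtains c e0 e1 w where "cylinder C M x c e0 e1 w"
proof -
  obtain s i j where s: "is_coproduct C x x s i j" using coproduct_ex[OF x x] by blast
  then have ij: "i \<in> hom C x s" "j \<in> hom C x s" by (simp_all add: is_coproduct_def)
  obtain k where k: "k \<in> hom C s x" "k \<cdot> i = Idn C x" "k \<cdot> j = Idn C x"
    using s Idn_hom[OF x] unfolding is_coproduct_def by blast
  obtain c l w where c: "l \<in> hom C s c" "w \<in> hom C c x" "k = w \<cdot> l" "l \<in> cof M" "w \<in> weq M"
    using factor_cof[OF k(1)] by blast
  have "w \<cdot> (l \<cdot> i) = Idn C x" "w \<cdot> (l \<cdot> j) = Idn C x"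
    using k c ij by (auto simp: hom_iff)
  then show ?thesis using that s c unfolding cylinder_def by blast
qed

text \<open>Both ends can be prescribed at once: together they are a map out of \<open>x + x\<close>, and the cofibration
  \<open>x + x \<rightarrow> c\<close> lifts against \<open>p\<close>.\<close>

lemma cylinder_lift:
  assumes c: "cylinder C M x c e0 e1 w"
    and p: "p \<in> hom C a b" "p \<in> fib M" "p \<in> weq M"
    and H: "H \<in> hom C c b" and u: "u0 \<in> hom C x a" "u1 \<in> hom C x a"
    and eq: "p \<cdot> u0 = H \<cdot> e0" "p \<cdot> u1 = H \<cdot> e1"
  obtains K where "K \<in> hom C c a" "p \<cdot> K = H" "K \<cdot> e0 = u0" "K \<cdot> e1 = u1"
proof -
  obtain s i0 i1 j where s: "is_coproduct C x x s i0 i1" and j: "j \<in> hom C s c" "j \<in> cof M"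
    "e0 = j \<cdot> i0" "e1 = j \<cdot> i1"
    using c unfolding cylinder_def by blast
  have i: "i0 \<in> hom C x s" "i1 \<in> hom C x s" using s by (simp_all add: is_coproduct_def)
  obtain t where t: "t \<in> hom C s a" "t \<cdot> i0 = u0" "t \<cdot> i1 = u1"
    using s u unfolding is_coproduct_def by blast
  have "p \<cdot> t \<in> hom C s b" "H \<cdot> j \<in> hom C s b" using t p H j Cmp_hom by blast+
  moreover have "(p \<cdot> t) \<cdot> i0 = (H \<cdot> j) \<cdot> i0" "(p \<cdot> t) \<cdot> i1 = (H \<cdot> j) \<cdot> i1"
    using t p H j i eq by (auto simp: hom_iff)
  moreover have "(H \<cdot> j) \<cdot> i0 \<in> hom C x b" "(H \<cdot> j) \<cdot> i1 \<in> hom C x b"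
    using H j i by (auto simp: hom_iff)
  ultimately have pt: "p \<cdot> t = H \<cdot> j" using s unfolding is_coproduct_def by blast
  then obtain K where K: "K \<in> hom C c a" "K \<cdot> j = t" "p \<cdot> K = H"
    using lifts_obtain[OF cof_lifts[OF j(2) p(2,3)] j(1) p(1) t(1) H pt] by blast
  have "K \<cdot> e0 = (K \<cdot> j) \<cdot> i0" "K \<cdot> e1 = (K \<cdot> j) \<cdot> i1"
    using K(1) j i by (auto simp: hom_iff)
  then show ?thesis using that K t by simp
qed

text \<open>To lift against an acyclic fibration with only the end \<open>e0\<close> prescribed, first lift the other end,
  which is possible because \<open>x\<close> is cofibrant, and then apply \<open>cylinder_lift\<close>.\<close>

lemma cylinder_acyclic:
  assumes x: "cofibrant C M x" and c: "cylinder C M x c e0 e1 w"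
  shows "e0 \<in> cof M" "e0 \<in> weq M"
proof -
  note D = cylinderD[OF c]
  show "e0 \<in> weq M"
    using weq_cancel_left[OF D(1,3,4)] D(5) Idn_weq cofibrant_Obj[OF x] by simp
  show "e0 \<in> cof M"
  proof (rule cof_if_lifts)
    show "e0 \<in> Arr C" using D by (simp add: hom_iff)
    fix p assume p: "p \<in> fib M" "p \<in> weq M"
    show "lifts C e0 p" unfolding lifts_def
    proof (intro allI impI, elim conjE)
      fix u v assume u: "u \<in> hom C (Dom C e0) (Dom C p)" and v: "v \<in> hom C (Cod C e0) (Cod C p)"
        and eq: "p \<cdot> u = v \<cdot> e0"
      have ph: "p \<in> hom C (Dom C p) (Cod C p)" using p by (simp add: hom_iff)
      have u': "u \<in> hom C x (Dom C p)" and v': "v \<in> hom C c (Cod C p)"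
        using u v D by (simp_all add: hom_iff)
      have "v \<cdot> e1 \<in> hom C x (Cod C p)" using v' D Cmp_hom by blast
      then obtain u1 where u1: "u1 \<in> hom C x (Dom C p)" "p \<cdot> u1 = v \<cdot> e1"
        using cofibrant_lift[OF x ph p] by blast
      obtain K where "K \<in> hom C c (Dom C p)" "p \<cdot> K = v" "K \<cdot> e0 = u"
        using cylinder_lift[OF c ph p v' u' u1(1) eq u1(2)] by blast
      then show "\<exists>h\<in>hom C (Cod C e0) (Dom C p). h \<cdot> e0 = u \<and> p \<cdot> h = v"
        using D by (auto simp: hom_iff)
    qed
  qed
qed

text \<open>The facts about fibrations, fibrant objects and path objects are the preceding ones, read in the
  dual category.\<close>

lemmas acyclic_fib_if_lifts = model_category.acyclic_cof_if_lifts[OF model_category_dual, simplified]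
lemmas fibrant_extend = model_category.cofibrant_lift[OF model_category_dual, simplified]
lemmas fibrantI = model_category.cofibrantI[OF model_category_dual, simplified]
lemmas fib_to_fibrant = model_category.cof_from_cofibrant[OF model_category_dual, simplified]
lemmas fibrant_replacement_ex = model_category.cofibrant_replacement_ex[OF model_category_dual, simplified]
lemmas path_objectD = model_category.cylinderD[OF model_category_dual, simplified]
lemmas path_object_swap = model_category.cylinder_swap[OF model_category_dual]
lemmas path_object_ex = model_category.cylinder_ex[OF model_category_dual, simplified]
lemmas path_object_extend = model_category.cylinder_lift[OF model_category_dual, simplified]
lemmas path_object_acyclic = model_category.cylinder_acyclic[OF model_category_dual, simplified]

end

section \<open>Zigzags\<close>

context category
begin

lemma zigzag_Obj: "zigzag C W x s y \<Longrightarrow> x \<in> Obj C \<and> y \<in> Obj C"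
proof (induction s arbitrary: x)
  case (Cons a s)
  then show ?case by (cases a) auto
qed simp

lemma zigzag_append [simp]:
  "zigzag C W x s y \<Longrightarrow> zigzag C W y t z \<Longrightarrow> zigzag C W x (s @ t) z"
  by (induction C W x s y rule: zigzag.induct) auto

lemma zigzag_equiv_zigzag:
  "zigzag_equiv C W x y s t \<Longrightarrow> zigzag C W x s y \<and> zigzag C W x t y"
  by (induction rule: zigzag_equiv.induct) (auto simp: hom_iff)

lemma zz_append_left: "zigzag_equiv C W x y s s' \<Longrightarrow> zigzag C W y t z \<Longrightarrow>
    zigzag_equiv C W x z (s @ t) (s' @ t)"
  by (blast intro: zz_append zz_refl)

lemma zz_append_right: "zigzag C W x s y \<Longrightarrow> zigzag_equiv C W y z t t' \<Longrightarrow>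
    zigzag_equiv C W x z (s @ t) (s @ t')"
  by (blast intro: zz_append zz_refl)

lemma zz_cancel_prefix:
  assumes "zigzag_equiv C W x y s []" "zigzag C W y t z"
  shows "zigzag_equiv C W x z (s @ t) t"
proof -
  have "x = y" using zigzag_equiv_zigzag[OF assms(1)] by simp
  then show ?thesis using zz_append_left[OF assms] by simp
qed

lemma zz_cancel_suffix:
  assumes "zigzag_equiv C W y z t []" "zigzag C W x s y"
  shows "zigzag_equiv C W x z (s @ t) s"
  using zz_append_right[OF assms(2,1)] by simp

lemma zz_cancel_left:
  assumes "zigzag C W y v x" "zigzag_equiv C W y y (v @ r) []"
    and "zigzag C W y s z" "zigzag C W y t z"
    and "zigzag_equiv C W x z (r @ s) (r @ t)"
  shows "zigzag_equiv C W y z s t"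
proof -
  have "zigzag_equiv C W y z (v @ r @ s) (v @ r @ t)" using zz_append_right[OF assms(1,5)] .
  moreover have "zigzag_equiv C W y z (v @ r @ s) s" "zigzag_equiv C W y z (v @ r @ t) t"
    using zz_cancel_prefix[OF assms(2,3)] zz_cancel_prefix[OF assms(2,4)] by simp_all
  ultimately show ?thesis by (blast intro: zz_trans zz_sym)
qed

end

context model_category
begin

abbreviation zz :: "'o \<Rightarrow> 'o \<Rightarrow> 'a step list \<Rightarrow> 'a step list \<Rightarrow> bool" where
  "zz \<equiv> zigzag_equiv C (weq M)"

text \<open>Equality in the homotopy category is used as the relation on arrows in place of homotopy: it is
  compatible with composition whatever the objects are, and weak equivalences cancel. Homotopies are
  recovered from it only where a lifting argument needs one.\<close>

abbreviation ho_eq :: "'o \<Rightarrow> 'o \<Rightarrow> 'a \<Rightarrow> 'a \<Rightarrow> bool" where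
  "ho_eq x y f g \<equiv> zz x y [Fwd f] [Fwd g]"

lemma zigzag_Fwd: "f \<in> hom C x y \<Longrightarrow> zigzag C (weq M) x [Fwd f] y"
  by (auto simp: hom_iff)

lemma zigzag_Bwd: "f \<in> hom C x y \<Longrightarrow> f \<in> weq M \<Longrightarrow> zigzag C (weq M) y [Bwd f] x"
  by (auto simp: hom_iff)

lemma ho_eq_refl: "f \<in> hom C x y \<Longrightarrow> ho_eq x y f f"
  by (rule zz_refl[OF zigzag_Fwd])

lemma zz_Cmp': "f \<in> hom C x y \<Longrightarrow> g \<in> hom C y z \<Longrightarrow> zz x z [Fwd (g \<cdot> f)] [Fwd f, Fwd g]"
  by (rule zz_sym[OF zz_Cmp])

lemma zz_square:
  assumes "f \<in> hom C x y" "g \<in> hom C y z" "h \<in> hom C x y'" "k \<in> hom C y' z" "g \<cdot> f = k \<cdot> h"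
  shows "zz x z [Fwd f, Fwd g] [Fwd h, Fwd k]"
  using zz_trans[OF zz_Cmp[OF assms(1,2)] zz_Cmp'[OF assms(3,4), folded assms(5)]] .

lemma zz_Fwd_cancel:
  assumes "w \<in> weq M" "w \<in> hom C x y" "zigzag C (weq M) y s z" "zigzag C (weq M) y t z"
    and "zz x z (Fwd w # s) (Fwd w # t)"
  shows "zz y z s t"
  using zz_cancel_left[OF zigzag_Bwd[OF assms(2,1)], of "[Fwd w]" s z t]
    zz_Bwd_Fwd[OF assms(1,2)] assms by simp

lemma zz_Fwd_cancel_right:
  assumes "w \<in> weq M" "w \<in> hom C y z" "zigzag C (weq M) x s y" "zigzag C (weq M) x t y"
    and "zz x z (s @ [Fwd w]) (t @ [Fwd w])"
  shows "zz x y s t"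
proof -
  have "zz x y (s @ [Fwd w] @ [Bwd w]) (t @ [Fwd w] @ [Bwd w])"
    using zz_append_left[OF assms(5) zigzag_Bwd[OF assms(2,1)]] by simp
  moreover have "zz x y (r @ [Fwd w] @ [Bwd w]) r" if "zigzag C (weq M) x r y" for r
    using zz_cancel_suffix[OF zz_Fwd_Bwd[OF assms(1,2)] that] by simp
  ultimately show ?thesis using assms(3,4) by (blast intro: zz_trans zz_sym)
qed

lemma zz_move_Bwd:
  assumes "w \<in> weq M" "w \<in> hom C x y" "zz x z s (Fwd w # t)" "zigzag C (weq M) y t z"
  shows "zz y z (Bwd w # s) t"
proof -
  have "zz y z ([Bwd w] @ s) ([Bwd w, Fwd w] @ t)"
    using zz_append_right[OF zigzag_Bwd[OF assms(2,1)] assms(3)] by simp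
  then show ?thesis
    using zz_trans[OF _ zz_cancel_prefix[OF zz_Bwd_Fwd[OF assms(1,2)] assms(4)]] by simp
qed

text \<open>Calculus of fractions along a commutative square: a forward arrow moves past the inverse of a weak
  equivalence.\<close>

lemma zz_square_Bwd:
  assumes "g \<in> hom C x y" "r \<in> hom C y y'" "r \<in> weq M" "q \<in> hom C x x'" "q \<in> weq M"
    and "k \<in> hom C x' y'" "k \<cdot> q = r \<cdot> g"
  shows "zz x' y [Bwd q, Fwd g] [Fwd k, Bwd r]"
proof (rule zz_move_Bwd[OF assms(5,4)])
  show "zigzag C (weq M) x' [Fwd k, Bwd r] y"
    using zigzag_append[OF zigzag_Fwd[OF assms(6)] zigzag_Bwd[OF assms(2,3)]] by auto
  have A: "zz x y ([Fwd g] @ [Fwd r, Bwd r]) [Fwd g]"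
    by (rule zz_cancel_suffix[OF zz_Fwd_Bwd[OF assms(3,2)] zigzag_Fwd[OF assms(1)]])
  have B: "zz x y ([Fwd g, Fwd r] @ [Bwd r]) ([Fwd q, Fwd k] @ [Bwd r])"
    by (rule zz_append_left[OF zz_square[OF assms(1,2,4,6)] zigzag_Bwd[OF assms(2,3)]])
      (simp add: assms(7))
  show "zz x y [Fwd g] (Fwd q # [Fwd k, Bwd r])" using zz_trans[OF zz_sym[OF A]] B by simp
qed

lemma zz_Bwd_Cmp:
  assumes f: "f \<in> hom C x y" "f \<in> weq M" and g: "g \<in> hom C y z" "g \<in> weq M"
  shows "zz z x [Bwd (g \<cdot> f)] [Bwd g, Bwd f]"
proof (rule zz_move_Bwd[OF weq_Cmp[OF f(1) g(1) f(2) g(2)] Cmp_hom[OF f(1) g(1)]])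
  have z: "zigzag C (weq M) z ([Bwd g] @ [Bwd f]) x"
    by (rule zigzag_append[OF zigzag_Bwd[OF g] zigzag_Bwd[OF f]])
  then show "zigzag C (weq M) z [Bwd g, Bwd f] x" by auto
  have 1: "zz x x ([Fwd (g \<cdot> f)] @ [Bwd g, Bwd f]) ([Fwd f, Fwd g] @ [Bwd g, Bwd f])"
    by (rule zz_append_left[OF zz_Cmp'[OF f(1) g(1)]]) (use z in auto)
  have 2: "zz x x ([Fwd f] @ [Fwd g, Bwd g] @ [Bwd f]) ([Fwd f] @ [Bwd f])"
    by (rule zz_append_right[OF zigzag_Fwd[OF f(1)]
          zz_cancel_prefix[OF zz_Fwd_Bwd[OF g(2,1)] zigzag_Bwd[OF f]]])
  show "zz x x [] (Fwd (g \<cdot> f) # [Bwd g, Bwd f])"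
    using zz_sym[OF zz_trans[OF 1 zz_trans[OF _ zz_Fwd_Bwd[OF f(2,1)]]]] 2 by simp
qed

lemma ho_eq_post:
  assumes "ho_eq x y f g" "f \<in> hom C x y" "g \<in> hom C x y" "k \<in> hom C y z"
  shows "ho_eq x z (k \<cdot> f) (k \<cdot> g)"
proof -
  have "zz x z [Fwd f, Fwd k] [Fwd g, Fwd k]"
    using zz_append_left[OF assms(1) zigzag_Fwd[OF assms(4)]] by simp
  then show ?thesis
    by (rule zz_trans[OF zz_Cmp'[OF assms(2,4)] zz_trans[OF _ zz_Cmp[OF assms(3,4)]]])
qed

lemma ho_eq_pre:
  assumes "ho_eq y z f g" "f \<in> hom C y z" "g \<in> hom C y z" "k \<in> hom C x y"
  shows "ho_eq x z (f \<cdot> k) (g \<cdot> k)"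
proof -
  have "zz x z [Fwd k, Fwd f] [Fwd k, Fwd g]"
    using zz_append_right[OF zigzag_Fwd[OF assms(4)] assms(1)] by simp
  then show ?thesis
    by (rule zz_trans[OF zz_Cmp'[OF assms(4,2)] zz_trans[OF _ zz_Cmp[OF assms(4,3)]]])
qed

lemma ho_eq_post_cancel:
  assumes "ho_eq x z (k \<cdot> f) (k \<cdot> g)" "f \<in> hom C x y" "g \<in> hom C x y" "k \<in> hom C y z" "k \<in> weq M"
  shows "ho_eq x y f g"
proof (rule zz_Fwd_cancel_right[OF assms(5,4)])
  show "zz x z ([Fwd f] @ [Fwd k]) ([Fwd g] @ [Fwd k])"
    using zz_trans[OF zz_Cmp[OF assms(2,4)] zz_trans[OF assms(1) zz_Cmp'[OF assms(3,4)]]] by simp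
qed (use assms zigzag_Fwd in blast)+

lemma ho_eq_pre_cancel:
  assumes "ho_eq x z (f \<cdot> k) (g \<cdot> k)" "f \<in> hom C y z" "g \<in> hom C y z" "k \<in> hom C x y" "k \<in> weq M"
  shows "ho_eq y z f g"
proof (rule zz_Fwd_cancel[OF assms(5,4)])
  show "zz x z (Fwd k # [Fwd f]) (Fwd k # [Fwd g])"
    using zz_trans[OF zz_Cmp[OF assms(4,2)] zz_trans[OF assms(1) zz_Cmp'[OF assms(4,3)]]] by simp
qed (use assms zigzag_Fwd in blast)+

text \<open>The arrow \<open>w\<close> is invertible in the homotopy category and has the same composite with both ends, so
  the two ends become equal there. Stated for any such \<open>w\<close>, this also covers the images of cylinders
  under functors that keep \<open>w\<close> a weak equivalence.\<close>

lemma ho_eq_cylinder: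
  assumes "w \<in> hom C c x" "w \<in> weq M" "e0 \<in> hom C x c" "e1 \<in> hom C x c" "w \<cdot> e0 = w \<cdot> e1"
    and "H \<in> hom C c y"
  shows "ho_eq x y (H \<cdot> e0) (H \<cdot> e1)"
proof -
  have "ho_eq x x (w \<cdot> e0) (w \<cdot> e1)" using ho_eq_refl[OF Cmp_hom[OF assms(3,1)]] assms(5) by simp
  from ho_eq_post_cancel[OF this assms(3,4,1,2)] show ?thesis by (rule ho_eq_post[OF _ assms(3,4,6)])
qed

lemma ho_eq_path:
  assumes "w \<in> hom C y c" "w \<in> weq M" "d0 \<in> hom C c y" "d1 \<in> hom C c y" "d0 \<cdot> w = d1 \<cdot> w"
    and "K \<in> hom C x c"
  shows "ho_eq x y (d0 \<cdot> K) (d1 \<cdot> K)"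
proof -
  have "ho_eq y y (d0 \<cdot> w) (d1 \<cdot> w)" using ho_eq_refl[OF Cmp_hom[OF assms(1,3)]] assms(5) by simp
  from ho_eq_pre_cancel[OF this assms(3,4,1,2)] show ?thesis by (rule ho_eq_pre[OF _ assms(3,4,6)])
qed

end

section \<open>Homotopy classes of maps out of a cofibrant object\<close>

locale cofibrant_source = model_category C M
  for C :: "('o, 'a, 'z) cat_scheme" (structure) and M +
  fixes x c e0 e1 w
  assumes cofibrant_x: "cofibrant C M x"
    and cylinder_x: "cylinder C M x c e0 e1 w"
begin

lemmas cyl = cylinderD[OF cylinder_x]

text \<open>Left homotopy through one fixed cylinder, so that composition with arrows out of \<open>y\<close> is immediate.
  For fibrant \<open>y\<close> it coincides with right homotopy through any path object, by the next lemmas, and this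
  makes it an equivalence relation.\<close>

definition homotopic :: "'o \<Rightarrow> 'a \<Rightarrow> 'a \<Rightarrow> bool" where
  "homotopic y f g \<longleftrightarrow> (\<exists>H \<in> hom C c y. H \<cdot> e0 = f \<and> H \<cdot> e1 = g)"

lemma homotopic_hom: "homotopic y f g \<Longrightarrow> f \<in> hom C x y \<and> g \<in> hom C x y"
  using cyl Cmp_hom unfolding homotopic_def by blast

lemma homotopic_refl: "f \<in> hom C x y \<Longrightarrow> homotopic y f f"
  unfolding homotopic_def using cyl by (intro bexI[of _ "f \<cdot> w"]) (simp_all add: hom_iff)

lemma homotopic_post:
  assumes "homotopic y f g" "k \<in> hom C y z" shows "homotopic z (k \<cdot> f) (k \<cdot> g)"
proof -
  obtain H where "H \<in> hom C c y" "H \<cdot> e0 = f" "H \<cdot> e1 = g" using assms(1) homotopic_def by blast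
  then show ?thesis unfolding homotopic_def using cyl assms(2)
    by (intro bexI[of _ "k \<cdot> H"]) (auto simp: hom_iff)
qed

lemma homotopic_ho_eq: "homotopic y f g \<Longrightarrow> ho_eq x y f g"
  unfolding homotopic_def using ho_eq_cylinder[OF cyl(3,4,1,2)] cyl by auto

text \<open>The constant path at \<open>f\<close>, given on the end \<open>e0\<close>, extends over the acyclic cofibration \<open>e0\<close> to a map
  \<open>c \<rightarrow> P\<close> with endpoints \<open>f w\<close> and \<open>H\<close>; on the end \<open>e1\<close> it runs from \<open>f\<close> to \<open>g\<close>.\<close>

lemma homotopic_to_path:
  assumes f: "homotopic y f g" and P: "path_object C M y P d0 d1 v"
  obtains K where "K \<in> hom C x P" "d0 \<cdot> K = f" "d1 \<cdot> K = g"
proof -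
  note D = path_objectD[OF P] and E = cylinder_acyclic[OF cofibrant_x cylinder_x]
  obtain H where H: "H \<in> hom C c y" "H \<cdot> e0 = f" "H \<cdot> e1 = g" using f homotopic_def by blast
  have fh: "f \<in> hom C x y" using homotopic_hom[OF f] by simp
  have "v \<cdot> f \<in> hom C x P" "f \<cdot> w \<in> hom C c y" using fh D cyl Cmp_hom by blast+
  moreover have "(f \<cdot> w) \<cdot> e0 = d0 \<cdot> (v \<cdot> f)" "H \<cdot> e0 = d1 \<cdot> (v \<cdot> f)"
    using fh D cyl H assoc_subst[OF D(5), of f] assoc_subst[OF D(6), of f] by (simp_all add: hom_iff)
  ultimately obtain K where K: "K \<in> hom C c P" "d0 \<cdot> K = f \<cdot> w" "d1 \<cdot> K = H"
    using path_object_extend[OF P cyl(1) E _ _ H(1), of "v \<cdot> f" "f \<cdot> w"] by blast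
  have "d0 \<cdot> (K \<cdot> e1) = f" "d1 \<cdot> (K \<cdot> e1) = g"
    using assoc_subst[OF K(2), of e1] assoc_subst[OF K(3), of e1] K(1) D cyl fh H
    by (simp_all add: hom_iff)
  then show ?thesis using that Cmp_hom[OF cyl(2) K(1)] by blast
qed

text \<open>Lift \<open>H\<close> through the acyclic fibration \<open>d0\<close>, starting with the constant path at \<open>f\<close> and ending with
  \<open>K\<close>; the other endpoint \<open>d1\<close> of the lift is a homotopy from \<open>f\<close> to \<open>h\<close>. Combining a cylinder with a
  path object in this way avoids gluing two cylinders.\<close>

lemma homotopic_path_trans:
  assumes f: "homotopic y f g" and P: "path_object C M y P d0 d1 v" and y: "fibrant C M y"
    and K: "K \<in> hom C x P" "d0 \<cdot> K = g" "d1 \<cdot> K = h"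
  shows "homotopic y f h"
proof -
  note D = path_objectD[OF P] and E = path_object_acyclic[OF y P]
  obtain H where H: "H \<in> hom C c y" "H \<cdot> e0 = f" "H \<cdot> e1 = g" using f homotopic_def by blast
  have fh: "f \<in> hom C x y" using homotopic_hom[OF f] by simp
  have vf: "v \<cdot> f \<in> hom C x P" using fh D Cmp_hom by blast
  have "d0 \<cdot> (v \<cdot> f) = H \<cdot> e0" "d1 \<cdot> (v \<cdot> f) = f"
    using fh D H assoc_subst[OF D(5), of f] assoc_subst[OF D(6), of f] by (simp_all add: hom_iff)
  moreover obtain L where L: "L \<in> hom C c P" "L \<cdot> e0 = v \<cdot> f" "L \<cdot> e1 = K"
    using cylinder_lift[OF cylinder_x D(1) E H(1) vf K(1)] calculation K H by auto
  ultimately show ?thesis unfolding homotopic_def using D K cyl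
    by (intro bexI[of _ "d1 \<cdot> L"]) (auto simp: hom_iff)
qed

lemma path_imp_homotopic:
  assumes "path_object C M y P d0 d1 v" "fibrant C M y" "K \<in> hom C x P"
  shows "homotopic y (d0 \<cdot> K) (d1 \<cdot> K)"
  using homotopic_path_trans[OF homotopic_refl assms(1,2,3)] Cmp_hom[OF assms(3) path_objectD(1)[OF assms(1)]] by blast

text \<open>Path objects and cylinders can be reversed, but reversing the cylinder changes it; a path between \<open>f\<close>
  and \<open>g\<close>, read backwards, returns to the given cylinder.\<close>

lemma homotopic_sym:
  assumes "homotopic y f g" "fibrant C M y" shows "homotopic y g f"
proof -
  obtain P d0 d1 v where P: "path_object C M y P d0 d1 v"
    using path_object_ex[OF fibrant_Obj[OF assms(2)]] by blast
  obtain K where "K \<in> hom C x P" "d0 \<cdot> K = f" "d1 \<cdot> K = g" using homotopic_to_path[OF assms(1) P] by blast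
  then show ?thesis using path_imp_homotopic[OF path_object_swap[OF P] assms(2)] by blast
qed

lemma homotopic_trans:
  assumes "homotopic y f g" "homotopic y g h" "fibrant C M y" shows "homotopic y f h"
proof -
  obtain P d0 d1 v where P: "path_object C M y P d0 d1 v"
    using path_object_ex[OF fibrant_Obj[OF assms(3)]] by blast
  obtain K where "K \<in> hom C x P" "d0 \<cdot> K = g" "d1 \<cdot> K = h" using homotopic_to_path[OF assms(2) P] by blast
  then show ?thesis using homotopic_path_trans[OF assms(1) P assms(3)] by blast
qed

lemma acyclic_fib_homotopic_inj:
  assumes p: "p \<in> hom C y z" "p \<in> fib M" "p \<in> weq M"
    and f: "f \<in> hom C x y" "g \<in> hom C x y" and l: "homotopic z (p \<cdot> f) (p \<cdot> g)"
  shows "homotopic y f g"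
proof -
  obtain H where H: "H \<in> hom C c z" "H \<cdot> e0 = p \<cdot> f" "H \<cdot> e1 = p \<cdot> g" using l homotopic_def by blast
  then show ?thesis unfolding homotopic_def
    using cylinder_lift[OF cylinder_x p H(1) f] by metis
qed

lemma acyclic_cof_retraction:
  assumes "k \<in> hom C y z" "k \<in> cof M" "k \<in> weq M" "fibrant C M y"
  obtains \<rho> where "\<rho> \<in> hom C z y" "\<rho> \<cdot> k = Idn C y"
  using fibrant_extend[OF assms(4,1,2,3) Idn_hom[OF fibrant_Obj[OF assms(4)]]] by blast

text \<open>The constant path on \<open>k r = k' r\<close> extends over the acyclic cofibration \<open>r\<close> to a path from \<open>k\<close> to
  \<open>k'\<close>.\<close>

lemma homotopic_extension_unique:
  assumes r: "r \<in> hom C y y'" "r \<in> cof M" "r \<in> weq M" and Z: "fibrant C M Z"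
    and k: "k \<in> hom C y' Z" "k' \<in> hom C y' Z" "k \<cdot> r = k' \<cdot> r" and a: "a \<in> hom C x y'"
  shows "homotopic Z (k \<cdot> a) (k' \<cdot> a)"
proof -
  obtain P d0 d1 v where P: "path_object C M Z P d0 d1 v"
    using path_object_ex[OF fibrant_Obj[OF Z]] by blast
  note D = path_objectD[OF P]
  have kr: "k \<cdot> r \<in> hom C y Z" using k r Cmp_hom by blast
  have "d0 \<cdot> (v \<cdot> (k \<cdot> r)) = k \<cdot> r" "d1 \<cdot> (v \<cdot> (k \<cdot> r)) = k \<cdot> r"
    using kr D assoc_subst[OF D(5), of "k \<cdot> r"] assoc_subst[OF D(6), of "k \<cdot> r"]
    by (simp_all add: hom_iff)
  then obtain K where K: "K \<in> hom C y' P" "d0 \<cdot> K = k" "d1 \<cdot> K = k'"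
    using path_object_extend[OF P r Cmp_hom[OF kr D(3)] k(1,2)] k(3) by metis
  have "homotopic Z (d0 \<cdot> (K \<cdot> a)) (d1 \<cdot> (K \<cdot> a))" using path_imp_homotopic[OF P Z Cmp_hom[OF a K(1)]] .
  moreover have "d0 \<cdot> (K \<cdot> a) = k \<cdot> a" "d1 \<cdot> (K \<cdot> a) = k' \<cdot> a"
    using K(2,3)[symmetric] K(1) D a by (simp_all add: hom_iff)
  ultimately show ?thesis by simp
qed

text \<open>Factor \<open>k = p i\<close> with \<open>i\<close> an acyclic cofibration and \<open>p\<close> an acyclic fibration. Through \<open>p\<close> one lifts
  maps from \<open>x\<close> and from its cylinder. The cofibration \<open>i\<close> has a retraction \<open>\<rho>\<close> because \<open>y\<close> is fibrant,
  and \<open>i \<rho>\<close> is homotopic to the identity on maps from \<open>x\<close> because both restrict to \<open>i\<close> on \<open>y\<close>.\<close>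

lemma weq_homotopic_bijective:
  assumes k: "k \<in> hom C y z" "k \<in> weq M" and y: "fibrant C M y" and z: "fibrant C M z"
  shows "f \<in> hom C x y \<Longrightarrow> g \<in> hom C x y \<Longrightarrow> homotopic z (k \<cdot> f) (k \<cdot> g) \<Longrightarrow> homotopic y f g"
    and "b \<in> hom C x z \<Longrightarrow> \<exists>a \<in> hom C x y. homotopic z (k \<cdot> a) b"
proof -
  obtain u i p where i: "i \<in> hom C y u" "i \<in> cof M" "i \<in> weq M" and p: "p \<in> hom C u z" "p \<in> fib M"
    and kp: "k = p \<cdot> i" using factor_acyclic_cof[OF k(1)] by blast
  have pw: "p \<in> weq M" using weq_cancel_right[OF i(1) p(1) i(3)] k kp by simp
  have u: "fibrant C M u" using fib_to_fibrant[OF z p] .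
  obtain \<rho> where \<rho>: "\<rho> \<in> hom C u y" "\<rho> \<cdot> i = Idn C y" using acyclic_cof_retraction[OF i y] by blast
  {
    assume f: "f \<in> hom C x y" "g \<in> hom C x y" and l: "homotopic z (k \<cdot> f) (k \<cdot> g)"
    have if_hom: "i \<cdot> f \<in> hom C x u" "i \<cdot> g \<in> hom C x u" using f i Cmp_hom by blast+
    have "k \<cdot> f = p \<cdot> (i \<cdot> f)" "k \<cdot> g = p \<cdot> (i \<cdot> g)" using kp i p f by (auto simp: hom_iff)
    then have "homotopic u (i \<cdot> f) (i \<cdot> g)" using acyclic_fib_homotopic_inj[OF p pw if_hom] l by simp
    then have "homotopic y (\<rho> \<cdot> (i \<cdot> f)) (\<rho> \<cdot> (i \<cdot> g))" using homotopic_post \<rho> by blast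
    moreover have "\<rho> \<cdot> (i \<cdot> f) = f" "\<rho> \<cdot> (i \<cdot> g) = g"
      using assoc_subst[OF \<rho>(2), of f] assoc_subst[OF \<rho>(2), of g] f \<rho> i by (simp_all add: hom_iff)
    ultimately show "homotopic y f g" by simp
  }
  {
    assume b: "b \<in> hom C x z"
    obtain d where d: "d \<in> hom C x u" "p \<cdot> d = b" using cofibrant_lift[OF cofibrant_x p pw b] by blast
    have "homotopic u ((i \<cdot> \<rho>) \<cdot> d) (Idn C u \<cdot> d)"
      by (rule homotopic_extension_unique[OF i u _ _ _ d(1)]) (use i \<rho> in \<open>auto simp: hom_iff\<close>)
    then have "homotopic z (p \<cdot> ((i \<cdot> \<rho>) \<cdot> d)) (p \<cdot> (Idn C u \<cdot> d))" using homotopic_post p by blast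
    moreover have "p \<cdot> ((i \<cdot> \<rho>) \<cdot> d) = k \<cdot> (\<rho> \<cdot> d)" "p \<cdot> (Idn C u \<cdot> d) = b"
      using kp i p \<rho> d by (auto simp: hom_iff)
    ultimately show "\<exists>a \<in> hom C x y. homotopic z (k \<cdot> a) b" using Cmp_hom[OF d(1) \<rho>(1)] by auto
  }
qed

end

section \<open>The action of zigzags on homotopy classes\<close>

context model_category
begin

definition fib_repl :: "'o \<Rightarrow> 'o \<times> 'a" where
  "fib_repl y = (SOME (z, q). fibrant C M z \<and> q \<in> hom C y z \<and> q \<in> cof M \<and> q \<in> weq M)"

definition repO :: "'o \<Rightarrow> 'o" where "repO y = fst (fib_repl y)"

definition repA :: "'o \<Rightarrow> 'a" where "repA y = snd (fib_repl y)"

lemma repOA: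
  assumes "y \<in> Obj C"
  shows "fibrant C M (repO y)" "repA y \<in> hom C y (repO y)" "repA y \<in> cof M" "repA y \<in> weq M"
proof -
  define P where "P = (\<lambda>(z, q). fibrant C M z \<and> q \<in> hom C y z \<and> q \<in> cof M \<and> q \<in> weq M)"
  obtain z q where "fibrant C M z" "q \<in> hom C y z" "q \<in> cof M" "q \<in> weq M"
    using fibrant_replacement_ex[OF assms] by blast
  then have "P (z, q)" by (simp add: P_def)
  then have "P (SOME p. P p)" by (rule someI)
  then have "P (repO y, repA y)" by (simp add: repO_def repA_def fib_repl_def P_def)
  then show "fibrant C M (repO y)" "repA y \<in> hom C y (repO y)" "repA y \<in> cof M" "repA y \<in> weq M"
    by (simp_all add: P_def)
qed

lemma repA_extend:
  assumes g: "g \<in> hom C y z"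
  obtains k where "k \<in> hom C (repO y) (repO z)" "k \<cdot> repA y = repA z \<cdot> g"
  using fibrant_extend[OF repOA(1)[of z] repOA(2,3,4)[of y], of "repA z \<cdot> g"] hom_Obj[OF g]
    Cmp_hom[OF g repOA(2)[of z]] by metis

lemma repA_extend_weq:
  assumes g: "g \<in> hom C y z" "g \<in> weq M" and k: "k \<in> hom C (repO y) (repO z)" "k \<cdot> repA y = repA z \<cdot> g"
  shows "k \<in> weq M"
proof -
  have y: "y \<in> Obj C" "z \<in> Obj C" using g hom_Obj by blast+
  have "k \<cdot> repA y \<in> weq M" using weq_Cmp[OF g(1) repOA(2)[OF y(2)] g(2) repOA(4)[OF y(2)]] k by simp
  then show ?thesis using weq_cancel_right[OF repOA(2)[OF y(1)] k(1) repOA(4)[OF y(1)]] by simp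
qed

end

context cofibrant_source
begin

definition rep_homotopic :: "'o \<Rightarrow> 'a \<Rightarrow> 'a \<Rightarrow> bool" where
  "rep_homotopic y a b \<longleftrightarrow> y \<in> Obj C \<and> homotopic (repO y) a b"

text \<open>Sending \<open>y\<close> to the homotopy classes of maps from \<open>x\<close> to a fibrant replacement of \<open>y\<close> is a functor
  that inverts weak equivalences, so zigzags act through it. The action is encoded by relations between
  representatives: \<open>arrow_rel g\<close> is the graph of the action of \<open>g\<close>, and a backward step acts by the
  converse of a graph, with no inverse to be chosen.\<close>

definition arrow_rel :: "'a \<Rightarrow> 'a \<Rightarrow> 'a \<Rightarrow> bool" where
  "arrow_rel g a b \<longleftrightarrow> a \<in> hom C x (repO (Dom C g)) \<and>
     (\<exists>k \<in> hom C (repO (Dom C g)) (repO (Cod C g)). k \<cdot> repA (Dom C g) = repA (Cod C g) \<cdot> g \<and>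
        rep_homotopic (Cod C g) (k \<cdot> a) b)"

fun zigzag_rel :: "'o \<Rightarrow> 'a step list \<Rightarrow> 'a \<Rightarrow> 'a \<Rightarrow> bool" where
  "zigzag_rel y [] a b \<longleftrightarrow> rep_homotopic y a b"
| "zigzag_rel y (Fwd g # s) a b \<longleftrightarrow> (\<exists>d. arrow_rel g a d \<and> zigzag_rel (Cod C g) s d b)"
| "zigzag_rel y (Bwd g # s) a b \<longleftrightarrow> (\<exists>d. arrow_rel g d a \<and> zigzag_rel (Dom C g) s d b)"

lemma rep_homotopic_hom: "rep_homotopic y a b \<Longrightarrow> a \<in> hom C x (repO y) \<and> b \<in> hom C x (repO y)"
  using homotopic_hom rep_homotopic_def by blast

lemma rep_homotopic_refl: "a \<in> hom C x (repO y) \<Longrightarrow> y \<in> Obj C \<Longrightarrow> rep_homotopic y a a"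
  unfolding rep_homotopic_def using homotopic_refl by blast

lemma rep_homotopic_sym: "rep_homotopic y a b \<Longrightarrow> rep_homotopic y b a"
  unfolding rep_homotopic_def using homotopic_sym repOA(1) by blast

lemma rep_homotopic_trans: "rep_homotopic y a b \<Longrightarrow> rep_homotopic y b d \<Longrightarrow> rep_homotopic y a d"
  unfolding rep_homotopic_def using homotopic_trans repOA(1) by blast

lemma rep_homotopic_idem: "(\<exists>d. rep_homotopic y a d \<and> rep_homotopic y d b) \<longleftrightarrow> rep_homotopic y a b"
  using rep_homotopic_sym rep_homotopic_trans by blast

lemma rep_homotopic_post: "rep_homotopic y a b \<Longrightarrow> z \<in> Obj C \<Longrightarrow> k \<in> hom C (repO y) (repO z) \<Longrightarrow> rep_homotopic z (k \<cdot> a) (k \<cdot> b)"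
  unfolding rep_homotopic_def using homotopic_post by blast

text \<open>All extensions \<open>k\<close> of \<open>g\<close> to the replacements act alike, by \<open>homotopic_extension_unique\<close>.\<close>

lemma arrow_rel_iff:
  assumes g: "g \<in> hom C y z" and k: "k \<in> hom C (repO y) (repO z)" "k \<cdot> repA y = repA z \<cdot> g"
  shows "arrow_rel g a b \<longleftrightarrow> a \<in> hom C x (repO y) \<and> rep_homotopic z (k \<cdot> a) b"
proof -
  have yz: "y \<in> Obj C" "z \<in> Obj C" "Dom C g = y" "Cod C g = z"
    using g hom_Obj by (auto simp: hom_iff)
  have "rep_homotopic z (k \<cdot> a) (k' \<cdot> a)"
    if "k' \<in> hom C (repO y) (repO z)" "k' \<cdot> repA y = repA z \<cdot> g" "a \<in> hom C x (repO y)" for k'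
    using homotopic_extension_unique[OF repOA(2,3,4)[OF yz(1)] repOA(1)[OF yz(2)] k(1) that(1) _ that(3)] k that yz
    by (simp add: rep_homotopic_def)
  then show ?thesis using k yz unfolding arrow_rel_def by (metis rep_homotopic_sym rep_homotopic_trans)
qed

lemma arrow_rel_rep_homotopic_left:
  assumes g: "g \<in> Arr C" and aa: "rep_homotopic (Dom C g) a a'"
  shows "arrow_rel g a b \<longleftrightarrow> arrow_rel g a' b"
proof -
  obtain k where k: "k \<in> hom C (repO (Dom C g)) (repO (Cod C g))" "k \<cdot> repA (Dom C g) = repA (Cod C g) \<cdot> g"
    using repA_extend[OF arr_hom[OF g]] by blast
  have "rep_homotopic (Cod C g) (k \<cdot> a) (k \<cdot> a')" using rep_homotopic_post[OF aa _ k(1)] g by simp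
  then show ?thesis unfolding arrow_rel_iff[OF arr_hom[OF g] k] using rep_homotopic_hom[OF aa] rep_homotopic_sym rep_homotopic_trans by blast
qed

lemma arrow_rel_rep_homotopic_right: "rep_homotopic (Cod C g) b b' \<Longrightarrow> arrow_rel g a b \<longleftrightarrow> arrow_rel g a b'"
  unfolding arrow_rel_def using rep_homotopic_sym rep_homotopic_trans by blast

lemma arrow_rel_cod: "arrow_rel g a b \<Longrightarrow> rep_homotopic (Cod C g) b b"
  unfolding arrow_rel_def using rep_homotopic_sym rep_homotopic_trans by blast

lemma arrow_rel_dom: "g \<in> Arr C \<Longrightarrow> arrow_rel g a b \<Longrightarrow> rep_homotopic (Dom C g) a a"
  unfolding arrow_rel_def using rep_homotopic_refl by simp

lemma zigzag_rel_rep_homotopic_left: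
  assumes "zigzag C (weq M) y s z" "rep_homotopic y a a'"
  shows "zigzag_rel y s a b \<longleftrightarrow> zigzag_rel y s a' b"
proof (cases s)
  case Nil
  then show ?thesis using assms rep_homotopic_sym rep_homotopic_trans by (metis zigzag_rel.simps(1))
next
  case (Cons t s')
  then show ?thesis using assms arrow_rel_rep_homotopic_left arrow_rel_rep_homotopic_right by (cases t) auto
qed

lemma zigzag_rel_dom:
  assumes "zigzag C (weq M) y s z" "zigzag_rel y s a b" shows "rep_homotopic y a a"
proof (cases s)
  case Nil
  then show ?thesis using assms rep_homotopic_sym rep_homotopic_trans by (metis zigzag_rel.simps(1))
next
  case (Cons t s')
  then show ?thesis using assms arrow_rel_dom arrow_rel_cod by (cases t) auto
qed

lemma zigzag_rel_append:
  "zigzag C (weq M) y s z \<Longrightarrow> zigzag C (weq M) z t u \<Longrightarrow>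
    zigzag_rel y (s @ t) a b \<longleftrightarrow> (\<exists>d. zigzag_rel y s a d \<and> zigzag_rel z t d b)"
proof (induction s arbitrary: y a)
  case Nil
  then have "zigzag_rel y ([] @ t) a b \<longleftrightarrow> (\<exists>d. rep_homotopic y a d \<and> zigzag_rel y t d b)"
    using zigzag_rel_rep_homotopic_left[of y t u a] zigzag_rel_dom[of y t u a b] by auto
  then show ?case using Nil by simp
next
  case (Cons q s)
  then show ?case by (cases q) auto
qed

lemma arrow_rel_Idn:
  assumes "y \<in> Obj C" shows "arrow_rel (Idn C y) a b \<longleftrightarrow> rep_homotopic y a b"
proof -
  have "arrow_rel (Idn C y) a b \<longleftrightarrow> a \<in> hom C x (repO y) \<and> rep_homotopic y (Idn C (repO y) \<cdot> a) b"
    using arrow_rel_iff[OF Idn_hom[OF assms], of "Idn C (repO y)"] repOA[OF assms] Idn_hom fibrant_Obj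
    by (auto simp: hom_iff)
  also have "\<dots> \<longleftrightarrow> a \<in> hom C x (repO y) \<and> rep_homotopic y a b" by (auto simp: hom_iff)
  finally show ?thesis using rep_homotopic_hom by blast
qed

lemma arrow_rel_Cmp:
  assumes f: "f \<in> hom C y z" and g: "g \<in> hom C z u"
  shows "arrow_rel (g \<cdot> f) a b \<longleftrightarrow> (\<exists>d. arrow_rel f a d \<and> arrow_rel g d b)"
proof -
  obtain k where k: "k \<in> hom C (repO y) (repO z)" "k \<cdot> repA y = repA z \<cdot> f" using repA_extend[OF f] by blast
  obtain l where l: "l \<in> hom C (repO z) (repO u)" "l \<cdot> repA z = repA u \<cdot> g" using repA_extend[OF g] by blast
  have O: "y \<in> Obj C" "z \<in> Obj C" "u \<in> Obj C" using f g hom_Obj by blast+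
  note rep = repOA(2)[OF O(1)] repOA(2)[OF O(2)] repOA(2)[OF O(3)]
  have "(l \<cdot> k) \<cdot> repA y = l \<cdot> (repA z \<cdot> f)" using k l rep by (auto simp: hom_iff)
  also have "\<dots> = repA u \<cdot> (g \<cdot> f)"
    using assoc_subst[OF l(2), of f] l rep f g by (simp add: hom_iff)
  finally have lk: "(l \<cdot> k) \<cdot> repA y = repA u \<cdot> (g \<cdot> f)" .
  show ?thesis
    unfolding arrow_rel_iff[OF f k] arrow_rel_iff[OF g l] arrow_rel_iff[OF Cmp_hom[OF f g] Cmp_hom[OF k(1) l(1)] lk]
  proof
    assume a: "a \<in> hom C x (repO y) \<and> rep_homotopic u ((l \<cdot> k) \<cdot> a) b"
    then have "k \<cdot> a \<in> hom C x (repO z)" "(l \<cdot> k) \<cdot> a = l \<cdot> (k \<cdot> a)"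
      using k l Cmp_hom by (auto simp: hom_iff)
    then show "\<exists>d. (a \<in> hom C x (repO y) \<and> rep_homotopic z (k \<cdot> a) d) \<and> d \<in> hom C x (repO z) \<and> rep_homotopic u (l \<cdot> d) b"
      using a rep_homotopic_refl O by (intro exI[of _ "k \<cdot> a"]) auto
  next
    assume "\<exists>d. (a \<in> hom C x (repO y) \<and> rep_homotopic z (k \<cdot> a) d) \<and> d \<in> hom C x (repO z) \<and> rep_homotopic u (l \<cdot> d) b"
    then obtain d where d: "a \<in> hom C x (repO y)" "rep_homotopic z (k \<cdot> a) d" "rep_homotopic u (l \<cdot> d) b" by blast
    have "(l \<cdot> k) \<cdot> a = l \<cdot> (k \<cdot> a)" using d k l by (auto simp: hom_iff)
    then show "a \<in> hom C x (repO y) \<and> rep_homotopic u ((l \<cdot> k) \<cdot> a) b"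
      using d rep_homotopic_trans[OF rep_homotopic_post[OF d(2) O(3) l(1)] d(3)] by simp
  qed
qed

text \<open>For a weak equivalence the graph is that of a bijection, by \<open>weq_homotopic_bijective\<close>.\<close>

lemma arrow_rel_weq:
  assumes w: "v \<in> hom C y z" "v \<in> weq M"
  shows "(\<exists>d. arrow_rel v a d \<and> arrow_rel v b d) \<longleftrightarrow> rep_homotopic y a b"
    and "(\<exists>d. arrow_rel v d a \<and> arrow_rel v d b) \<longleftrightarrow> rep_homotopic z a b"
proof -
  obtain k where k: "k \<in> hom C (repO y) (repO z)" "k \<cdot> repA y = repA z \<cdot> v" using repA_extend[OF w(1)] by blast
  have kw: "k \<in> weq M" using repA_extend_weq[OF w k] .
  have O: "y \<in> Obj C" "z \<in> Obj C" using w hom_Obj by blast+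
  note bij = weq_homotopic_bijective[OF k(1) kw repOA(1)[OF O(1)] repOA(1)[OF O(2)]]
  show "(\<exists>d. arrow_rel v a d \<and> arrow_rel v b d) \<longleftrightarrow> rep_homotopic y a b"
  proof
    assume "\<exists>d. arrow_rel v a d \<and> arrow_rel v b d"
    then show "rep_homotopic y a b" unfolding arrow_rel_iff[OF w(1) k]
      using bij(1) rep_homotopic_sym rep_homotopic_trans unfolding rep_homotopic_def using O by metis
  next
    assume ab: "rep_homotopic y a b"
    then have "rep_homotopic z (k \<cdot> b) (k \<cdot> b)" using rep_homotopic_post[OF _ O(2) k(1)] rep_homotopic_sym rep_homotopic_trans by blast
    then show "\<exists>d. arrow_rel v a d \<and> arrow_rel v b d"
      unfolding arrow_rel_iff[OF w(1) k] using rep_homotopic_post[OF ab O(2) k(1)] rep_homotopic_hom[OF ab] by blast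
  qed
  show "(\<exists>d. arrow_rel v d a \<and> arrow_rel v d b) \<longleftrightarrow> rep_homotopic z a b"
  proof
    assume "\<exists>d. arrow_rel v d a \<and> arrow_rel v d b"
    then show "rep_homotopic z a b" unfolding arrow_rel_iff[OF w(1) k] using rep_homotopic_sym rep_homotopic_trans by blast
  next
    assume ab: "rep_homotopic z a b"
    then obtain d where "d \<in> hom C x (repO y)" "rep_homotopic z (k \<cdot> d) a"
      using bij(2)[of a] rep_homotopic_hom[OF ab] O unfolding rep_homotopic_def by blast
    then show "\<exists>d. arrow_rel v d a \<and> arrow_rel v d b"
      unfolding arrow_rel_iff[OF w(1) k] using rep_homotopic_trans[OF _ ab] by blast
  qed
qed

lemma zigzag_rel_invariant: "zz y z s t \<Longrightarrow> zigzag_rel y s a b \<longleftrightarrow> zigzag_rel y t a b"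
proof (induction arbitrary: a b rule: zigzag_equiv.induct)
  case (zz_append y z s s' u t t')
  have z: "zigzag C (weq M) y s z" "zigzag C (weq M) y s' z"
      "zigzag C (weq M) z t u" "zigzag C (weq M) z t' u"
    using zz_append.hyps zigzag_equiv_zigzag by blast+
  show ?case unfolding zigzag_rel_append[OF z(1,3)] zigzag_rel_append[OF z(2,4)] zz_append.IH ..
next
  case (zz_Idn y)
  then show ?case by (simp add: arrow_rel_Idn rep_homotopic_idem)
next
  case (zz_Cmp f y z g u)
  then have c: "Cod C f = z" "Cod C g = u" "Cod C (g \<cdot> f) = u" by (auto simp: hom_iff)
  have "zigzag_rel y [Fwd f, Fwd g] a b \<longleftrightarrow> (\<exists>d. (\<exists>e. arrow_rel f a e \<and> arrow_rel g e d) \<and> rep_homotopic u d b)"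
    using c by auto
  then show ?case unfolding arrow_rel_Cmp[OF zz_Cmp, symmetric] using c by simp
next
  case (zz_Fwd_Bwd w y z)
  then have c: "Dom C w = y" "Cod C w = z" by (auto simp: hom_iff)
  have "zigzag_rel y [Fwd w, Bwd w] a b \<longleftrightarrow> (\<exists>e. (\<exists>d. arrow_rel w a d \<and> arrow_rel w e d) \<and> rep_homotopic y e b)"
    using c by auto
  then show ?case unfolding arrow_rel_weq(1)[OF zz_Fwd_Bwd(2,1)] using rep_homotopic_trans rep_homotopic_sym by (metis zigzag_rel.simps(1))
next
  case (zz_Bwd_Fwd w y z)
  then have c: "Dom C w = y" "Cod C w = z" by (auto simp: hom_iff)
  have "zigzag_rel z [Bwd w, Fwd w] a b \<longleftrightarrow> (\<exists>e. (\<exists>d. arrow_rel w d a \<and> arrow_rel w d e) \<and> rep_homotopic z e b)"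
    using c by auto
  then show ?case unfolding arrow_rel_weq(2)[OF zz_Bwd_Fwd(2,1)] using rep_homotopic_trans rep_homotopic_sym by (metis zigzag_rel.simps(1))
qed auto

text \<open>Let the zigzags \<open>f\<close> and \<open>g\<close> act on the class of the replacement map of \<open>x\<close>. The results are \<open>f\<close> and
  \<open>g\<close> followed by the replacement map of \<open>y\<close>, which is a weak equivalence of fibrant objects and
  therefore reflects homotopy.\<close>

theorem ho_eq_imp_homotopic:
  assumes f: "f \<in> hom C x y" "g \<in> hom C x y" and y: "fibrant C M y" and e: "ho_eq x y f g"
  shows "homotopic y f g"
proof -
  have O: "x \<in> Obj C" "y \<in> Obj C" using f hom_Obj by blast+
  have c: "Cod C f = y" "Cod C g = y" using f by (auto simp: hom_iff)
  have Lr: "zigzag_rel x [Fwd h] (repA x) b \<longleftrightarrow> rep_homotopic y (repA y \<cdot> h) b" if h: "h \<in> hom C x y" for h b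
  proof -
    obtain k where k: "k \<in> hom C (repO x) (repO y)" "k \<cdot> repA x = repA y \<cdot> h" using repA_extend[OF h] by blast
    have "Cod C h = y" using h by (simp add: hom_iff)
    moreover have "arrow_rel h (repA x) b \<longleftrightarrow> rep_homotopic y (repA y \<cdot> h) b" for b
      unfolding arrow_rel_iff[OF h k] using k repOA(2)[OF O(1)] by simp
    ultimately show ?thesis by (simp add: rep_homotopic_idem)
  qed
  have "rep_homotopic y (repA y \<cdot> g) (repA y \<cdot> g)" using rep_homotopic_refl[OF Cmp_hom[OF f(2) repOA(2)[OF O(2)]] O(2)] .
  then have "rep_homotopic y (repA y \<cdot> f) (repA y \<cdot> g)"
    using Lr[OF f(1)] Lr[OF f(2)] zigzag_rel_invariant[OF e] by simp
  then show ?thesis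
    using weq_homotopic_bijective(1)[OF repOA(2,4)[OF O(2)] y repOA(1)[OF O(2)] f] by (simp add: rep_homotopic_def)
qed

text \<open>A zigzag is absorbed into \<open>a\<close> one step at a time. A forward step \<open>g\<close> moves past the inverse of the
  replacement map by means of an extension \<open>k\<close> of \<open>g\<close>, and \<open>k a\<close> takes the place of \<open>a\<close>. For a backward
  step \<open>v\<close> the extension \<open>k\<close> is a weak equivalence, so \<open>a\<close> is homotopic to some \<open>k d\<close>, and \<open>d\<close> takes the
  place of \<open>a\<close>.\<close>

lemma zigzag_fill:
  "zigzag C (weq M) y s z \<Longrightarrow> a \<in> hom C x (repO y) \<Longrightarrow>
    \<exists>b \<in> hom C x (repO z). zz x z ([Fwd a, Bwd (repA y)] @ s) [Fwd b, Bwd (repA z)]"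
proof (induction s arbitrary: y a)
  case Nil
  then have y: "z = y" "y \<in> Obj C" by auto
  have "zigzag C (weq M) x [Fwd a, Bwd (repA y)] y"
    using Nil(2) y repOA[of y] by (auto simp: hom_iff)
  from zz_refl[OF this] show ?case using Nil(2) y(1) by (intro bexI[of _ a]) simp_all
next
  case (Cons q s)
  show ?case
  proof (cases q)
    case (Fwd g)
    let ?u = "Cod C g"
    have g: "g \<in> hom C y ?u" and s: "zigzag C (weq M) ?u s z"
      using Cons.prems Fwd by (auto simp: hom_iff)
    have O: "y \<in> Obj C" "?u \<in> Obj C" using hom_Obj[OF g] by blast+
    obtain k where k: "k \<in> hom C (repO y) (repO ?u)" "k \<cdot> repA y = repA ?u \<cdot> g" using repA_extend[OF g] by blast
    note ry = repOA[OF O(1)] and ru = repOA[OF O(2)]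
    obtain b where b: "b \<in> hom C x (repO z)"
      "zz x z ([Fwd (k \<cdot> a), Bwd (repA ?u)] @ s) [Fwd b, Bwd (repA z)]"
      using Cons.IH[OF s Cmp_hom[OF Cons.prems(2) k(1)]] by blast
    have "zz (repO y) ?u [Bwd (repA y), Fwd g] [Fwd k, Bwd (repA ?u)]"
      by (rule zz_square_Bwd[OF g ru(2,4) ry(2,4) k])
    then have A: "zz x ?u ([Fwd a] @ [Bwd (repA y), Fwd g]) ([Fwd a] @ [Fwd k, Bwd (repA ?u)])"
      by (rule zz_append_right[OF zigzag_Fwd[OF Cons.prems(2)]])
    have B: "zz x ?u ([Fwd a, Fwd k] @ [Bwd (repA ?u)]) ([Fwd (k \<cdot> a)] @ [Bwd (repA ?u)])"
      by (rule zz_append_left[OF zz_Cmp[OF Cons.prems(2) k(1)] zigzag_Bwd[OF ru(2,4)]])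
    have "zz x ?u [Fwd a, Bwd (repA y), Fwd g] [Fwd (k \<cdot> a), Bwd (repA ?u)]"
      using zz_trans[OF A] B by simp
    then have "zz x z ([Fwd a, Bwd (repA y), Fwd g] @ s) ([Fwd (k \<cdot> a), Bwd (repA ?u)] @ s)"
      by (rule zz_append_left[OF _ s])
    then show ?thesis using zz_trans[OF _ b(2)] b(1) Fwd by auto
  next
    case (Bwd v)
    let ?u = "Dom C v"
    have v: "v \<in> hom C ?u y" "v \<in> weq M" and s: "zigzag C (weq M) ?u s z"
      using Cons.prems Bwd by (auto simp: hom_iff)
    have O: "y \<in> Obj C" "?u \<in> Obj C" using hom_Obj[OF v(1)] by blast+
    obtain k where k: "k \<in> hom C (repO ?u) (repO y)" "k \<cdot> repA ?u = repA y \<cdot> v" using repA_extend[OF v(1)] by blast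
    note ry = repOA[OF O(1)] and ru = repOA[OF O(2)]
    have kw: "k \<in> weq M" using repA_extend_weq[OF v k] .
    obtain d where d: "d \<in> hom C x (repO ?u)" "homotopic (repO y) (k \<cdot> d) a"
      using weq_homotopic_bijective(2)[OF k(1) kw ru(1) ry(1) Cons.prems(2)] by blast
    obtain b where b: "b \<in> hom C x (repO z)" "zz x z ([Fwd d, Bwd (repA ?u)] @ s) [Fwd b, Bwd (repA z)]"
      using Cons.IH[OF s d(1)] by blast
    have da: "zz x (repO y) [Fwd a] [Fwd d, Fwd k]"
      using zz_trans[OF zz_sym[OF homotopic_ho_eq[OF d(2)]] zz_Cmp'[OF d(1) k(1)]] .
    have "zz (repO y) ?u [Bwd (repA y), Bwd v] [Bwd k, Bwd (repA ?u)]"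
      using zz_trans[OF zz_sym[OF zz_Bwd_Cmp[OF v ry(2,4)]]] zz_Bwd_Cmp[OF ru(2,4) k(1) kw] k(2) by simp
    then have 1: "zz x ?u ([Fwd a] @ [Bwd (repA y), Bwd v]) ([Fwd a] @ [Bwd k, Bwd (repA ?u)])"
      by (rule zz_append_right[OF zigzag_Fwd[OF Cons.prems(2)]])
    have 2: "zz x ?u ([Fwd a] @ [Bwd k, Bwd (repA ?u)]) ([Fwd d, Fwd k] @ [Bwd k, Bwd (repA ?u)])"
      by (rule zz_append_left[OF da]) (use k kw ru O in \<open>auto simp: hom_iff\<close>)
    have 3: "zz x ?u ([Fwd d] @ ([Fwd k, Bwd k] @ [Bwd (repA ?u)])) ([Fwd d] @ [Bwd (repA ?u)])"
      by (rule zz_append_right[OF zigzag_Fwd[OF d(1)]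
            zz_cancel_prefix[OF zz_Fwd_Bwd[OF kw k(1)] zigzag_Bwd[OF ru(2,4)]]])
    have "zz x ?u [Fwd a, Bwd (repA y), Bwd v] [Fwd d, Bwd (repA ?u)]"
      using zz_trans[OF 1 zz_trans[OF 2]] 3 by simp
    then have "zz x z ([Fwd a, Bwd (repA y), Bwd v] @ s) ([Fwd d, Bwd (repA ?u)] @ s)"
      by (rule zz_append_left[OF _ s])
    then show ?thesis using zz_trans[OF _ b(2)] b(1) Bwd by auto
  qed
qed

theorem zigzag_representable:
  assumes s: "zigzag C (weq M) x s y" and y: "fibrant C M y"
  obtains f where "f \<in> hom C x y" "zz x y s [Fwd f]"
proof -
  have O: "x \<in> Obj C" "y \<in> Obj C" using zigzag_Obj[OF s] by blast+
  note rx = repOA[OF O(1)] and ry = repOA[OF O(2)]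
  obtain b where b: "b \<in> hom C x (repO y)" "zz x y ([Fwd (repA x), Bwd (repA x)] @ s) [Fwd b, Bwd (repA y)]"
    using zigzag_fill[OF s rx(2)] by blast
  obtain f where f: "f \<in> hom C x y" "homotopic (repO y) (repA y \<cdot> f) b"
    using weq_homotopic_bijective(2)[OF ry(2,4) y ry(1) b(1)] by blast
  have 1: "zz x y ([Fwd b] @ [Bwd (repA y)]) ([Fwd f, Fwd (repA y)] @ [Bwd (repA y)])"
    by (rule zz_append_left[OF _ zigzag_Bwd[OF ry(2,4)]])
      (rule zz_trans[OF zz_sym[OF homotopic_ho_eq[OF f(2)]] zz_Cmp'[OF f(1) ry(2)]])
  have 2: "zz x y ([Fwd f] @ [Fwd (repA y), Bwd (repA y)]) [Fwd f]"
    by (rule zz_cancel_suffix[OF zz_Fwd_Bwd[OF ry(4,2)] zigzag_Fwd[OF f(1)]])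
  have "zz x y [Fwd b, Bwd (repA y)] [Fwd f]" using zz_trans[OF 1] 2 by simp
  then have "zz x y s [Fwd f]"
    using zz_trans[OF zz_sym[OF zz_cancel_prefix[OF zz_Fwd_Bwd[OF rx(4,2)] s]]] zz_trans[OF b(2)] by blast
  then show ?thesis using that f by blast
qed

end

section \<open>Maps in the homotopy category\<close>

context model_category
begin

lemma cofibrant_zigzag_representable:
  assumes "zigzag C (weq M) x s y" "cofibrant C M x" "fibrant C M y"
  obtains f where "f \<in> hom C x y" "zz x y s [Fwd f]"
proof -
  obtain c e0 e1 w where "cylinder C M x c e0 e1 w"
    using cylinder_ex[OF cofibrant_Obj[OF assms(2)]] by blast
  then interpret cofibrant_source C M x c e0 e1 w
    using assms(2) by unfold_locales
  show ?thesis using zigzag_representable[OF assms(1,3)] that by blast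
qed

lemma ho_eq_cylinder_homotopy:
  assumes "ho_eq x y f g" "f \<in> hom C x y" "g \<in> hom C x y" "cofibrant C M x" "fibrant C M y"
    and c: "cylinder C M x c e0 e1 w"
  obtains H where "H \<in> hom C c y" "H \<cdot> e0 = f" "H \<cdot> e1 = g"
proof -
  interpret cofibrant_source C M x c e0 e1 w using assms by unfold_locales
  show ?thesis using ho_eq_imp_homotopic[OF assms(2,3,5,1)] that unfolding homotopic_def by blast
qed

lemma ho_eq_path_homotopy:
  assumes "ho_eq x y f g" "f \<in> hom C x y" "g \<in> hom C x y" "cofibrant C M x" "fibrant C M y"
    and P: "path_object C M y P d0 d1 v"
  obtains K where "K \<in> hom C x P" "d0 \<cdot> K = f" "d1 \<cdot> K = g"
proof -
  obtain c e0 e1 w where "cylinder C M x c e0 e1 w"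
    using cylinder_ex[OF cofibrant_Obj[OF assms(4)]] by blast
  then interpret cofibrant_source C M x c e0 e1 w
    using assms(4) by unfold_locales
  show ?thesis using homotopic_to_path[OF ho_eq_imp_homotopic[OF assms(2,3,5,1)] P] that by blast
qed

text \<open>This makes the classes of \<open>homotopy_rel\<close> the fibres of the localization on arrows.\<close>

lemma homotopy_rel_iff_ho_eq:
  assumes x: "cofibrant C M x" and y: "fibrant C M y"
  shows "(f, g) \<in> homotopy_rel C M x y \<longleftrightarrow> f \<in> hom C x y \<and> g \<in> hom C x y \<and> ho_eq x y f g"
proof
  assume "(f, g) \<in> homotopy_rel C M x y"
  then obtain c e0 e1 w H where fg: "f \<in> hom C x y" "g \<in> hom C x y"
    and c: "cylinder C M x c e0 e1 w" and H: "H \<in> hom C c y" "H \<cdot> e0 = f" "H \<cdot> e1 = g"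
    unfolding homotopy_rel_def left_homotopic_iff by blast
  note D = cylinderD[OF c]
  have "w \<cdot> e0 = w \<cdot> e1" using D by simp
  from ho_eq_cylinder[OF D(3,4,1,2) this H(1)]
  show "f \<in> hom C x y \<and> g \<in> hom C x y \<and> ho_eq x y f g" using fg H by simp
next
  assume fg: "f \<in> hom C x y \<and> g \<in> hom C x y \<and> ho_eq x y f g"
  obtain c e0 e1 w where c: "cylinder C M x c e0 e1 w"
    using cylinder_ex[OF cofibrant_Obj[OF x]] by blast
  obtain P d0 d1 v where P: "path_object C M y P d0 d1 v"
    using path_object_ex[OF fibrant_Obj[OF y]] by blast
  have "left_homotopic C M x y f g"
    unfolding left_homotopic_iff using ho_eq_cylinder_homotopy[OF _ _ _ x y c] c fg by metis
  moreover have "right_homotopic C M x y f g"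
    unfolding right_homotopic_dual left_homotopic_iff
    using ho_eq_path_homotopy[OF _ _ _ x y P] P fg by simp metis
  ultimately show "(f, g) \<in> homotopy_rel C M x y" using fg by (simp add: homotopy_rel_def)
qed

end

section \<open>Saturation of the weak equivalences\<close>

context model_category
begin

definition ho_iso :: "'o \<Rightarrow> 'o \<Rightarrow> 'a \<Rightarrow> bool" where
  "ho_iso x y f \<longleftrightarrow> (\<exists>s. zigzag C (weq M) y s x \<and> zz x x (Fwd f # s) [] \<and> zz y y (s @ [Fwd f]) [])"

lemma ho_isoI:
  "zigzag C (weq M) y s x \<Longrightarrow> zz x x (Fwd f # s) [] \<Longrightarrow> zz y y (s @ [Fwd f]) [] \<Longrightarrow> ho_iso x y f"
  unfolding ho_iso_def by blast

text \<open>This transports the question whether \<open>f\<close> is a weak equivalence to a map between weakly equivalent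
  objects.\<close>

lemma ho_iso_square:
  assumes f: "f \<in> hom C x y" "f' \<in> hom C x' y'" and u: "u \<in> hom C x x'" "u \<in> weq M"
    and v: "v \<in> hom C y y'" "v \<in> weq M" and eq: "f' \<cdot> u = v \<cdot> f"
  shows "ho_iso x y f \<longleftrightarrow> ho_iso x' y' f'" and "f \<in> weq M \<longleftrightarrow> f' \<in> weq M"
proof -
  have O: "x \<in> Obj C" "y \<in> Obj C" "x' \<in> Obj C" "y' \<in> Obj C"
    using f hom_Obj by blast+
  note zf = zigzag_Fwd[OF f(1)] and zf' = zigzag_Fwd[OF f(2)] and zu = zigzag_Fwd[OF u(1)]
    and zv = zigzag_Fwd[OF v(1)] and zu' = zigzag_Bwd[OF u] and zv' = zigzag_Bwd[OF v]
  have sq: "zz x y' [Fwd u, Fwd f'] [Fwd f, Fwd v]" by (rule zz_square[OF u(1) f(2) f(1) v(1) eq])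
  show "ho_iso x y f \<longleftrightarrow> ho_iso x' y' f'"
  proof
    assume "ho_iso x y f"
    then obtain s where s: "zigzag C (weq M) y s x" "zz x x (Fwd f # s) []" "zz y y (s @ [Fwd f]) []"
      unfolding ho_iso_def by blast
    let ?s = "[Bwd v] @ s @ [Fwd u]"
    have zs: "zigzag C (weq M) y' ?s x'" by (rule zigzag_append[OF zv' zigzag_append[OF s(1) zu]])
    have 1: "zz x x' ([Fwd u, Fwd f'] @ ?s) ([Fwd f, Fwd v] @ ?s)" by (rule zz_append_left[OF sq zs])
    have 2: "zz x x' ([Fwd f] @ [Fwd v, Bwd v] @ s @ [Fwd u]) ([Fwd f] @ s @ [Fwd u])"
      by (rule zz_append_right[OF zf zz_cancel_prefix[OF zz_Fwd_Bwd[OF v(2,1)] zigzag_append[OF s(1) zu]]])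
    have 3: "zz x x' ((Fwd f # s) @ [Fwd u]) [Fwd u]" by (rule zz_cancel_prefix[OF s(2) zu])
    have "zz x x' (Fwd u # ([Fwd f'] @ ?s)) (Fwd u # [])"
      using zz_trans[OF 1] zz_trans[OF 2] 3 by simp
    from zz_Fwd_cancel[OF u(2,1) zigzag_append[OF zf' zs] _ this]
    have "zz x' x' ([Fwd f'] @ ?s) []" by (simp add: O)
    moreover have "zz y' y' (?s @ [Fwd f']) []"
    proof -
      have 1: "zz y' y' (([Bwd v] @ s) @ [Fwd u, Fwd f']) (([Bwd v] @ s) @ [Fwd f, Fwd v])"
        by (rule zz_append_right[OF zigzag_append[OF zv' s(1)] sq])
      have 2: "zz y' y' ([Bwd v] @ (s @ [Fwd f]) @ [Fwd v]) ([Bwd v] @ [Fwd v])"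
        by (rule zz_append_right[OF zv' zz_cancel_prefix[OF s(3) zv]])
      show ?thesis using zz_trans[OF 1] zz_trans[OF 2] zz_Bwd_Fwd[OF v(2,1)] by simp
    qed
    ultimately show "ho_iso x' y' f'" using ho_isoI[OF zs] by simp
  next
    assume "ho_iso x' y' f'"
    then obtain s where s: "zigzag C (weq M) y' s x'" "zz x' x' (Fwd f' # s) []"
      "zz y' y' (s @ [Fwd f']) []"
      unfolding ho_iso_def by blast
    let ?s = "[Fwd v] @ s @ [Bwd u]"
    have zs: "zigzag C (weq M) y ?s x" by (rule zigzag_append[OF zv zigzag_append[OF s(1) zu']])
    have "zz x x ([Fwd f] @ ?s) []"
    proof -
      have 1: "zz x x ([Fwd f, Fwd v] @ s @ [Bwd u]) ([Fwd u, Fwd f'] @ s @ [Bwd u])"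
        by (rule zz_append_left[OF zz_sym[OF sq] zigzag_append[OF s(1) zu']])
      have 2: "zz x x ([Fwd u] @ (Fwd f' # s) @ [Bwd u]) ([Fwd u] @ [Bwd u])"
        by (rule zz_append_right[OF zu zz_cancel_prefix[OF s(2) zu']])
      show ?thesis using zz_trans[OF 1] zz_trans[OF 2] zz_Fwd_Bwd[OF u(2,1)] by simp
    qed
    moreover have "zz y y (?s @ [Fwd f]) []"
    proof (rule zz_Fwd_cancel_right[OF v(2,1) zigzag_append[OF zs zf]])
      show "zigzag C (weq M) y [] y" using O by simp
      have 1: "zz y y' (?s @ [Fwd f, Fwd v]) (?s @ [Fwd u, Fwd f'])"
        by (rule zz_append_right[OF zs zz_sym[OF sq]])
      have 2: "zz y y' (([Fwd v] @ s) @ [Bwd u, Fwd u] @ [Fwd f']) (([Fwd v] @ s) @ [Fwd f'])"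
        by (rule zz_append_right[OF zigzag_append[OF zv s(1)]
              zz_cancel_prefix[OF zz_Bwd_Fwd[OF u(2,1)] zf']])
      have 3: "zz y y' ([Fwd v] @ (s @ [Fwd f'])) [Fwd v]" by (rule zz_cancel_suffix[OF s(3) zv])
      show "zz y y' ((?s @ [Fwd f]) @ [Fwd v]) ([] @ [Fwd v])"
        using zz_trans[OF 1] zz_trans[OF 2] 3 by simp
    qed
    ultimately show "ho_iso x y f" using ho_isoI[OF zs] by simp
  qed
  show "f \<in> weq M \<longleftrightarrow> f' \<in> weq M"
  proof
    assume "f \<in> weq M"
    then have "f' \<cdot> u \<in> weq M" unfolding eq using weq_Cmp[OF f(1) v(1) _ v(2)] by blast
    then show "f' \<in> weq M" using weq_cancel_right[OF u(1) f(2) u(2)] by blast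
  next
    assume "f' \<in> weq M"
    then have "v \<cdot> f \<in> weq M" unfolding eq[symmetric] using weq_Cmp[OF u(1) f(2) u(2)] by blast
    then show "f \<in> weq M" using weq_cancel_left[OF f(1) v(1,2)] by blast
  qed
qed

text \<open>A homotopy \<open>K\<close> from \<open>f\<close> to the identity is a weak equivalence because \<open>e1\<close> and \<open>K e1\<close> are, and then
  so is \<open>f = K e0\<close>.\<close>

lemma weq_if_ho_eq_Idn:
  assumes z: "cofibrant C M z" "fibrant C M z" and f: "f \<in> hom C z z" and e: "ho_eq z z f (Idn C z)"
  shows "f \<in> weq M"
proof -
  obtain c e0 e1 w where c: "cylinder C M z c e0 e1 w"
    using cylinder_ex[OF cofibrant_Obj[OF z(1)]] by blast
  obtain K where K: "K \<in> hom C c z" "K \<cdot> e0 = f" "K \<cdot> e1 = Idn C z"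
    using ho_eq_cylinder_homotopy[OF e f Idn_hom[OF cofibrant_Obj[OF z(1)]] z c] by blast
  note D = cylinderD[OF c]
  note E0 = cylinder_acyclic(2)[OF z(1) c]
    and E1 = cylinder_acyclic(2)[OF z(1) cylinder_swap[OF c]]
  have "K \<in> weq M" using weq_cancel_right[OF D(2) K(1) E1] K(3) Idn_weq cofibrant_Obj[OF z(1)] by simp
  then show ?thesis using weq_Cmp[OF D(1) K(1) E0] K(2) by simp
qed

text \<open>The inverse of \<open>p\<close> in the homotopy category is an arrow \<open>g\<close> with \<open>p g\<close> homotopic to the identity.
  Lifting this homotopy through \<open>p\<close>, with \<open>g\<close> at the start, gives a strict section \<open>q\<close> at the end. As \<open>q\<close> is
  still inverse to \<open>p\<close> in the homotopy category, \<open>q p\<close> is a weak equivalence, and \<open>p\<close> is a retract of it.\<close>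

lemma bifibrant_fibration_saturation:
  assumes z: "cofibrant C M z" "fibrant C M z" and y: "cofibrant C M y" "fibrant C M y"
    and p: "p \<in> hom C z y" "p \<in> fib M" and i: "ho_iso z y p"
  shows "p \<in> weq M"
proof -
  obtain s where s: "zigzag C (weq M) y s z" "zz z z (Fwd p # s) []" "zz y y (s @ [Fwd p]) []"
    using i unfolding ho_iso_def by blast
  obtain g where g: "g \<in> hom C y z" "zz y z s [Fwd g]"
    using cofibrant_zigzag_representable[OF s(1) y(1) z(2)] by blast
  note yO = cofibrant_Obj[OF y(1)] and zO = cofibrant_Obj[OF z(1)]
  obtain c e0 e1 w where c: "cylinder C M y c e0 e1 w" using cylinder_ex[OF yO] by blast
  note D = cylinderD[OF c] and E = cylinder_acyclic[OF y(1) c]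
  have "zz y y [Fwd g, Fwd p] (s @ [Fwd p])"
    using zz_append_left[OF zz_sym[OF g(2)] zigzag_Fwd[OF p(1)]] by simp
  then have "ho_eq y y (p \<cdot> g) (Idn C y)"
    using zz_trans[OF zz_Cmp'[OF g(1) p(1)]] zz_trans[OF _ zz_sym[OF zz_Idn[OF yO]]] s(3) zz_trans
    by metis
  then obtain H where H: "H \<in> hom C c y" "H \<cdot> e0 = p \<cdot> g" "H \<cdot> e1 = Idn C y"
    using ho_eq_cylinder_homotopy[OF _ Cmp_hom[OF g(1) p(1)] Idn_hom[OF yO] y c] by blast
  \<comment> \<open>\<open>G\<close> lifts the homotopy \<open>H\<close> and starts at \<open>g\<close>; its end is the section\<close>
  obtain G where G: "G \<in> hom C c z" "G \<cdot> e0 = g" "p \<cdot> G = H"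
    using lifts_obtain[OF acyclic_cof_lifts[OF E p(2)] D(1) p(1) g(1) H(1) H(2)[symmetric]] by blast
  define q where "q = G \<cdot> e1"
  have q: "q \<in> hom C y z" using Cmp_hom[OF D(2) G(1)] by (simp add: q_def)
  have pq: "p \<cdot> q = Idn C y"
    using assoc_subst[OF G(3), of e1] G(1) D p H by (simp add: q_def hom_iff)
  have "ho_eq y z q g" using zz_sym[OF ho_eq_cylinder[OF D(3,4,1,2) _ G(1)]] D G by (simp add: q_def)
  from zz_trans[OF this zz_sym[OF g(2)]] have "zz y z [Fwd q] s" .
  then have "zz z z [Fwd p, Fwd q] (Fwd p # s)"
    using zz_append_right[OF zigzag_Fwd[OF p(1)]] by fastforce
  from zz_trans[OF this zz_trans[OF s(2) zz_sym[OF zz_Idn[OF zO]]]]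
  have "zz z z [Fwd p, Fwd q] [Fwd (Idn C z)]" .
  then have "q \<cdot> p \<in> weq M"
    using weq_if_ho_eq_Idn[OF z Cmp_hom[OF p(1) q]] zz_trans[OF zz_Cmp'[OF p(1) q]] by blast
  moreover have "retract_of C p (q \<cdot> p)"
    by (rule retract_ofI[of _ _ _ "Idn C z" "Idn C z" q p])
      (use p q zO yO pq assoc_subst[OF pq, of p] in \<open>simp_all add: hom_iff\<close>)
  ultimately show ?thesis using weq_retract by blast
qed

text \<open>Three squares reduce to a fibration of bifibrant objects: fibrant replacement, cofibrant replacement,
  and a factorization into an acyclic cofibration and a fibration.\<close>

theorem saturation:
  assumes f: "f \<in> hom C x y" and i: "ho_iso x y f"
  shows "f \<in> weq M"
proof -
  have O: "x \<in> Obj C" "y \<in> Obj C" using hom_Obj[OF f] by blast+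
  note rx = repOA[OF O(1)] and ry = repOA[OF O(2)]
  obtain g where g: "g \<in> hom C (repO x) (repO y)" "g \<cdot> repA x = repA y \<cdot> f" using repA_extend[OF f] by blast
  note sq1 = ho_iso_square[OF f g(1) rx(2,4) ry(2,4) g(2)]
  obtain a m where a: "cofibrant C M a" "m \<in> hom C a (repO x)" "m \<in> fib M" "m \<in> weq M"
    using cofibrant_replacement_ex[OF fibrant_Obj[OF rx(1)]] by blast
  obtain b t where b: "cofibrant C M b" "t \<in> hom C b (repO y)" "t \<in> fib M" "t \<in> weq M"
    using cofibrant_replacement_ex[OF fibrant_Obj[OF ry(1)]] by blast
  obtain h where h: "h \<in> hom C a b" "t \<cdot> h = g \<cdot> m"
    using cofibrant_lift[OF a(1) b(2,3,4) Cmp_hom[OF a(2) g(1)]] by blast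
  note sq2 = ho_iso_square[OF h(1) g(1) a(2,4) b(2,4) h(2)[symmetric]]
  obtain e j p where e: "j \<in> hom C a e" "p \<in> hom C e b" "h = p \<cdot> j" "j \<in> cof M" "j \<in> weq M" "p \<in> fib M"
    using factor_acyclic_cof[OF h(1)] by blast
  note bO = cofibrant_Obj[OF b(1)]
  have bf: "fibrant C M b" using fib_to_fibrant[OF ry(1) b(2,3)] .
  have "p \<cdot> j = Idn C b \<cdot> h" using e h by (simp add: hom_iff)
  note sq3 = ho_iso_square[OF h(1) e(2) e(1,5) Idn_hom[OF bO] Idn_weq[OF bO] this]
  have "p \<in> weq M"
    using bifibrant_fibration_saturation[OF cof_from_cofibrant[OF a(1) e(1,4)]
        fib_to_fibrant[OF bf e(2,6)] b(1) bf e(2,6)] sq1(1) sq2(1) sq3(1) i by blast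
  then show ?thesis using sq1(2) sq2(2) sq3(2) by blast
qed

text \<open>The Yoneda lemma in the homotopy category, tested on cofibrant \<open>a\<close> only, whose maps to fibrant
  objects are arrows. Surjectivity at a cofibrant replacement \<open>t : b \<rightarrow> y\<close> gives a right inverse of \<open>f\<close>;
  injectivity at a cofibrant replacement \<open>d : a \<rightarrow> x\<close> shows that it is a left inverse.\<close>

lemma weq_if_post_bijective:
  assumes f: "f \<in> hom C x y" and fibrant: "fibrant C M x" "fibrant C M y"
    and inj: "\<And>a u u'. cofibrant C M a \<Longrightarrow> u \<in> hom C a x \<Longrightarrow> u' \<in> hom C a x \<Longrightarrow>
      ho_eq a y (f \<cdot> u) (f \<cdot> u') \<Longrightarrow> ho_eq a x u u'"
    and surj: "\<And>a k. cofibrant C M a \<Longrightarrow> k \<in> hom C a y \<Longrightarrow> \<exists>u \<in> hom C a x. ho_eq a y (f \<cdot> u) k"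
  shows "f \<in> weq M"
proof -
  note O = fibrant_Obj[OF fibrant(1)] fibrant_Obj[OF fibrant(2)] and zf = zigzag_Fwd[OF f]
  obtain b t where b: "cofibrant C M b" "t \<in> hom C b y" "t \<in> fib M" "t \<in> weq M"
    using cofibrant_replacement_ex[OF O(2)] by blast
  obtain a d where a: "cofibrant C M a" "d \<in> hom C a x" "d \<in> fib M" "d \<in> weq M"
    using cofibrant_replacement_ex[OF O(1)] by blast
  obtain u where u: "u \<in> hom C b x" "ho_eq b y (f \<cdot> u) t" using surj[OF b(1,2)] by blast
  let ?s = "[Bwd t, Fwd u]"
  have zs: "zigzag C (weq M) y ?s x"
    using zigzag_append[OF zigzag_Bwd[OF b(2,4)] zigzag_Fwd[OF u(1)]] by auto
  have "zz b y [Fwd u, Fwd f] (Fwd t # [])" using zz_trans[OF zz_Cmp[OF u(1) f] u(2)] .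
  then have sf: "zz y y (?s @ [Fwd f]) []"
    using zz_move_Bwd[OF b(4,2), of y "[Fwd u, Fwd f]" "[]"] O by simp
  have zd: "zigzag C (weq M) a (Fwd d # Fwd f # ?s) x"
    using zigzag_append[OF zigzag_Fwd[OF a(2)] zigzag_append[OF zf zs]] by auto
  \<comment> \<open>\<open>?s\<close> is right inverse to \<open>f\<close>, so \<open>f v\<close> and \<open>f d\<close> agree in the homotopy category\<close>
  obtain v where v: "v \<in> hom C a x" "zz a x (Fwd d # Fwd f # ?s) [Fwd v]"
    using cofibrant_zigzag_representable[OF zd a(1) fibrant(1)] by blast
  have 1: "zz a y ([Fwd v] @ [Fwd f]) ((Fwd d # Fwd f # ?s) @ [Fwd f])"
    by (rule zz_append_left[OF zz_sym[OF v(2)] zf])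
  have 2: "zz a y ([Fwd d, Fwd f] @ (?s @ [Fwd f])) [Fwd d, Fwd f]"
    by (rule zz_cancel_suffix[OF sf]) (use zigzag_append[OF zigzag_Fwd[OF a(2)] zf] in auto)
  have "zz a y [Fwd v, Fwd f] [Fwd d, Fwd f]" using zz_trans[OF 1] 2 by simp
  then have "ho_eq a y (f \<cdot> v) (f \<cdot> d)"
    using zz_trans[OF zz_Cmp'[OF v(1) f] zz_trans[OF _ zz_Cmp[OF a(2) f]]] by blast
  then have "ho_eq a x v d" using inj[OF a(1) v(1) a(2)] by blast
  then have "zz a x (Fwd d # (Fwd f # ?s)) (Fwd d # [])" using zz_trans[OF v(2)] by blast
  from zz_Fwd_cancel[OF a(4,2) _ _ this] have "zz x x (Fwd f # ?s) []"
    using zigzag_append[OF zf zs] O by simp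
  then show ?thesis using saturation[OF f] zs sf unfolding ho_iso_def by blast
qed

text \<open>The same for maps out of \<open>x\<close> and \<open>y\<close>: surjectivity at a fibrant replacement of \<open>x\<close> gives a left inverse
  and injectivity at a fibrant replacement of \<open>y\<close> shows that it is a right inverse.\<close>

lemma weq_if_pre_bijective:
  assumes f: "f \<in> hom C x y" and cofibrant: "cofibrant C M x" "cofibrant C M y"
    and inj: "\<And>z u u'. fibrant C M z \<Longrightarrow> u \<in> hom C y z \<Longrightarrow> u' \<in> hom C y z \<Longrightarrow>
      ho_eq x z (u \<cdot> f) (u' \<cdot> f) \<Longrightarrow> ho_eq y z u u'"
    and surj: "\<And>z k. fibrant C M z \<Longrightarrow> k \<in> hom C x z \<Longrightarrow> \<exists>u \<in> hom C y z. ho_eq x z (u \<cdot> f) k"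
  shows "f \<in> weq M"
proof -
  note O = cofibrant_Obj[OF cofibrant(1)] cofibrant_Obj[OF cofibrant(2)] and zf = zigzag_Fwd[OF f]
  note rx = repOA[OF O(1)] and ry = repOA[OF O(2)]
  obtain u where u: "u \<in> hom C y (repO x)" "ho_eq x (repO x) (u \<cdot> f) (repA x)" using surj[OF rx(1,2)] by blast
  let ?s = "[Fwd u, Bwd (repA x)]"
  have zs: "zigzag C (weq M) y ?s x"
    using zigzag_append[OF zigzag_Fwd[OF u(1)] zigzag_Bwd[OF rx(2,4)]] by auto
  have "zz x (repO x) [Fwd f, Fwd u] [Fwd (repA x)]" using zz_trans[OF zz_Cmp[OF f u(1)] u(2)] .
  from zz_append_left[OF this zigzag_Bwd[OF rx(2,4)]]
  have fs: "zz x x (Fwd f # ?s) []" using zz_trans[OF _ zz_Fwd_Bwd[OF rx(4,2)]] by simp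
  have zr: "zigzag C (weq M) y (?s @ [Fwd f, Fwd (repA y)]) (repO y)"
    using zigzag_append[OF zs zigzag_append[OF zf zigzag_Fwd[OF ry(2)]]] by auto
  \<comment> \<open>\<open>?s\<close> is left inverse to \<open>f\<close>, so \<open>v f\<close> and \<open>repA y f\<close> agree in the homotopy category\<close>
  obtain v where v: "v \<in> hom C y (repO y)" "zz y (repO y) (?s @ [Fwd f, Fwd (repA y)]) [Fwd v]"
    using cofibrant_zigzag_representable[OF zr cofibrant(2) ry(1)] by blast
  have 1: "zz x (repO y) ([Fwd f] @ [Fwd v]) ([Fwd f] @ (?s @ [Fwd f, Fwd (repA y)]))"
    by (rule zz_append_right[OF zf zz_sym[OF v(2)]])
  have 2: "zz x (repO y) ((Fwd f # ?s) @ [Fwd f, Fwd (repA y)]) [Fwd f, Fwd (repA y)]"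
    by (rule zz_cancel_prefix[OF fs]) (use zigzag_append[OF zf zigzag_Fwd[OF ry(2)]] in auto)
  have "zz x (repO y) [Fwd f, Fwd v] [Fwd f, Fwd (repA y)]" using zz_trans[OF 1] 2 by simp
  then have "ho_eq x (repO y) (v \<cdot> f) (repA y \<cdot> f)"
    using zz_trans[OF zz_Cmp'[OF f v(1)] zz_trans[OF _ zz_Cmp[OF f ry(2)]]] by blast
  then have "ho_eq y (repO y) v (repA y)" using inj[OF ry(1) v(1) ry(2)] by blast
  then have "zz y (repO y) ((?s @ [Fwd f]) @ [Fwd (repA y)]) ([] @ [Fwd (repA y)])"
    using zz_trans[OF v(2)] by simp
  from zz_Fwd_cancel_right[OF ry(4,2) zigzag_append[OF zs zf] _ this]
  have "zz y y (?s @ [Fwd f]) []" by (simp add: O)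
  then show ?thesis using saturation[OF f] zs fs unfolding ho_iso_def by blast
qed

end

section \<open>Adjunctions\<close>

text \<open>A Quillen adjunction in terms of its bijection on hom-sets. What is used of the functoriality of \<open>LA\<close>
  and \<open>GA\<close> comes from the naturality of this bijection: \<open>LA_retraction\<close> and \<open>GA_retraction\<close>.\<close>

locale quillen_adjunction = A: model_category A MA + B: model_category B MB
  for A :: "('o1, 'a1, 'z1) cat_scheme" and MA and B :: "('o2, 'a2, 'z2) cat_scheme" and MB +
  fixes LO :: "'o1 \<Rightarrow> 'o2" and LA :: "'a1 \<Rightarrow> 'a2" and GO :: "'o2 \<Rightarrow> 'o1" and GA :: "'a2 \<Rightarrow> 'a1"
    and adj :: "'o1 \<Rightarrow> 'o2 \<Rightarrow> 'a2 \<Rightarrow> 'a1"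
  assumes LO_Obj: "v \<in> Obj A \<Longrightarrow> LO v \<in> Obj B"
    and GO_Obj: "y \<in> Obj B \<Longrightarrow> GO y \<in> Obj A"
    and LA_hom: "k \<in> hom A v v' \<Longrightarrow> LA k \<in> hom B (LO v) (LO v')"
    and GA_hom: "p \<in> hom B y y' \<Longrightarrow> GA p \<in> hom A (GO y) (GO y')"
    and adj_bij: "v \<in> Obj A \<Longrightarrow> y \<in> Obj B \<Longrightarrow> bij_betw (adj v y) (hom B (LO v) y) (hom A v (GO y))"
    and adj_pre: "k \<in> hom A v' v \<Longrightarrow> h \<in> hom B (LO v) y \<Longrightarrow>
      adj v' y (h \<cdot>\<^bsub>B\<^esub> LA k) = adj v y h \<cdot>\<^bsub>A\<^esub> k"
    and adj_post: "v \<in> Obj A \<Longrightarrow> h \<in> hom B (LO v) y \<Longrightarrow> p \<in> hom B y y' \<Longrightarrow>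
      adj v y' (p \<cdot>\<^bsub>B\<^esub> h) = GA p \<cdot>\<^bsub>A\<^esub> adj v y h"
    and LA_cof: "k \<in> cof MA \<Longrightarrow> LA k \<in> cof MB"
    and LA_acyclic_cof: "k \<in> cof MA \<Longrightarrow> k \<in> weq MA \<Longrightarrow> LA k \<in> weq MB"
begin

lemma adj_hom: "v \<in> Obj A \<Longrightarrow> h \<in> hom B (LO v) y \<Longrightarrow> adj v y h \<in> hom A v (GO y)"
  using adj_bij[of v y] B.hom_Obj(2) by (auto simp: bij_betw_def)

lemma adj_inj:
  "v \<in> Obj A \<Longrightarrow> h \<in> hom B (LO v) y \<Longrightarrow> h' \<in> hom B (LO v) y \<Longrightarrow> adj v y h = adj v y h' \<Longrightarrow> h = h'"
  using adj_bij[of v y] B.hom_Obj(2)[of h] by (auto simp: bij_betw_def dest: inj_onD)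

lemma adj_surj:
  assumes "y \<in> Obj B" "u \<in> hom A v (GO y)"
  obtains h where "h \<in> hom B (LO v) y" "adj v y h = u"
proof -
  have "u \<in> adj v y ` hom B (LO v) y"
    using adj_bij[of v y] assms A.hom_Obj(1)[OF assms(2)] by (simp add: bij_betw_def)
  then show ?thesis using that by blast
qed

lemma LA_retraction:
  assumes "e \<in> hom A v c" "w \<in> hom A c v" "w \<cdot>\<^bsub>A\<^esub> e = Idn A v"
  shows "LA w \<cdot>\<^bsub>B\<^esub> LA e = Idn B (LO v)"
proof -
  have v: "v \<in> Obj A" "c \<in> Obj A" using assms A.hom_Obj by blast+
  note L = LA_hom[OF assms(1)] LA_hom[OF assms(2)]
  have I: "Idn B (LO v) \<in> hom B (LO v) (LO v)" using LO_Obj[OF v(1)] B.Idn_hom by blast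
  have "adj v (LO v) (LA w \<cdot>\<^bsub>B\<^esub> LA e) = adj c (LO v) (LA w) \<cdot>\<^bsub>A\<^esub> e" by (rule adj_pre[OF assms(1) L(2)])
  also have "adj c (LO v) (LA w) = adj c (LO v) (Idn B (LO v) \<cdot>\<^bsub>B\<^esub> LA w)" using L by (simp add: hom_iff)
  also have "\<dots> = adj v (LO v) (Idn B (LO v)) \<cdot>\<^bsub>A\<^esub> w" by (rule adj_pre[OF assms(2) I])
  also have "\<dots> \<cdot>\<^bsub>A\<^esub> e = adj v (LO v) (Idn B (LO v))"
    using adj_hom[OF v(1) I] assms by (simp add: hom_iff)
  finally show ?thesis using adj_inj[OF v(1) B.Cmp_hom[OF L] I] by blast
qed

lemma GA_retraction:
  assumes "d \<in> hom B P y" "v \<in> hom B y P" "d \<cdot>\<^bsub>B\<^esub> v = Idn B y"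
  shows "GA d \<cdot>\<^bsub>A\<^esub> GA v = Idn A (GO y)"
proof -
  have y: "y \<in> Obj B" using assms B.hom_Obj by blast
  note G = GA_hom[OF assms(1)] GA_hom[OF assms(2)] and O = GO_Obj[OF y]
  obtain h where h: "h \<in> hom B (LO (GO y)) y" "adj (GO y) y h = Idn A (GO y)"
    using adj_surj[OF y A.Idn_hom[OF O]] by blast
  have "GA d \<cdot>\<^bsub>A\<^esub> GA v = GA d \<cdot>\<^bsub>A\<^esub> (GA v \<cdot>\<^bsub>A\<^esub> adj (GO y) y h)" using G h by (simp add: hom_iff)
  also have "\<dots> = adj (GO y) y (d \<cdot>\<^bsub>B\<^esub> (v \<cdot>\<^bsub>B\<^esub> h))"
    using adj_post[OF O h(1) assms(2)] adj_post[OF O B.Cmp_hom[OF h(1) assms(2)] assms(1)] by simp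
  also have "d \<cdot>\<^bsub>B\<^esub> (v \<cdot>\<^bsub>B\<^esub> h) = h"
    using B.assoc_subst[OF assms(3), of h] assms h by (simp add: hom_iff)
  finally show ?thesis using h by simp
qed

lemma GA_lifts:
  assumes i: "i \<in> hom A a b" and p: "p \<in> hom B x y" and l: "lifts B (LA i) p"
  shows "lifts A i (GA p)"
  unfolding lifts_def
proof (intro allI impI, elim conjE)
  have O: "a \<in> Obj A" "b \<in> Obj A" "x \<in> Obj B" "y \<in> Obj B" using i p A.hom_Obj B.hom_Obj by blast+
  have dc: "Dom A i = a" "Cod A i = b" "Dom A (GA p) = GO x" "Cod A (GA p) = GO y"
    using i GA_hom[OF p] by (simp_all add: hom_iff)
  note Li = LA_hom[OF i]
  fix u v assume "u \<in> hom A (Dom A i) (Dom A (GA p))" "v \<in> hom A (Cod A i) (Cod A (GA p))"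
    and eq: "GA p \<cdot>\<^bsub>A\<^esub> u = v \<cdot>\<^bsub>A\<^esub> i"
  then have uv: "u \<in> hom A a (GO x)" "v \<in> hom A b (GO y)" using dc by auto
  obtain u' where u': "u' \<in> hom B (LO a) x" "adj a x u' = u" using adj_surj[OF O(3) uv(1)] by blast
  obtain v' where v': "v' \<in> hom B (LO b) y" "adj b y v' = v" using adj_surj[OF O(4) uv(2)] by blast
  have "adj a y (p \<cdot>\<^bsub>B\<^esub> u') = adj a y (v' \<cdot>\<^bsub>B\<^esub> LA i)"
    using adj_post[OF O(1) u'(1) p] adj_pre[OF i v'(1)] u' v' eq by simp
  then have "p \<cdot>\<^bsub>B\<^esub> u' = v' \<cdot>\<^bsub>B\<^esub> LA i"
    using adj_inj[OF O(1) B.Cmp_hom[OF u'(1) p] B.Cmp_hom[OF Li v'(1)]] by blast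
  then obtain h where h: "h \<in> hom B (LO b) x" "h \<cdot>\<^bsub>B\<^esub> LA i = u'" "p \<cdot>\<^bsub>B\<^esub> h = v'"
    using lifts_obtain[OF l Li p u'(1) v'(1)] by blast
  have "adj b x h \<cdot>\<^bsub>A\<^esub> i = u" "GA p \<cdot>\<^bsub>A\<^esub> adj b x h = v"
    using adj_pre[OF i h(1)] adj_post[OF O(2) h(1) p] h u' v' by auto
  then show "\<exists>h\<in>hom A (Cod A i) (Dom A (GA p)). h \<cdot>\<^bsub>A\<^esub> i = u \<and> GA p \<cdot>\<^bsub>A\<^esub> h = v"
    using adj_hom[OF O(2) h(1)] dc by auto
qed

lemma GA_acyclic_fib:
  assumes p: "p \<in> fib MB" "p \<in> weq MB"
  shows "GA p \<in> fib MA" "GA p \<in> weq MA"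
proof -
  have ph: "p \<in> hom B (Dom B p) (Cod B p)" using p by (simp add: hom_iff)
  have "lifts A i (GA p)" if i: "i \<in> cof MA" for i
    using GA_lifts[OF A.arr_hom[OF A.cof_in_Arr[OF i]] ph] B.cof_lifts[OF LA_cof[OF i] p] by blast
  moreover have "GA p \<in> Arr A" using GA_hom[OF ph] by (simp add: hom_iff)
  ultimately show "GA p \<in> fib MA" "GA p \<in> weq MA" using A.acyclic_fib_if_lifts by blast+
qed

lemma GO_fibrant:
  assumes y: "fibrant B MB y" shows "fibrant A MA (GO y)"
proof (rule A.fibrantI)
  note O = B.fibrant_Obj[OF y]
  show "GO y \<in> Obj A" using GO_Obj[OF O] .
  fix i a b u assume i: "i \<in> hom A b a" "i \<in> cof MA" "i \<in> weq MA" and u: "u \<in> hom A b (GO y)"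
  obtain u' where u': "u' \<in> hom B (LO b) y" "adj b y u' = u" using adj_surj[OF O u] by blast
  obtain v where v: "v \<in> hom B (LO a) y" "v \<cdot>\<^bsub>B\<^esub> LA i = u'"
    using B.fibrant_extend[OF y LA_hom[OF i(1)] LA_cof[OF i(2)] LA_acyclic_cof[OF i(2,3)] u'(1)] by blast
  have "adj a y v \<cdot>\<^bsub>A\<^esub> i = u" using adj_pre[OF i(1) v(1)] v u' by simp
  then show "\<exists>u'. u' \<in> hom A a (GO y) \<and> u' \<cdot>\<^bsub>A\<^esub> i = u"
    using adj_hom[OF _ v(1)] A.hom_Obj[OF i(1)] by blast
qed

lemma LO_cofibrant:
  assumes v: "cofibrant A MA v" shows "cofibrant B MB (LO v)"
proof (rule B.cofibrantI)
  note O = A.cofibrant_Obj[OF v]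
  show "LO v \<in> Obj B" using LO_Obj[OF O] .
  fix p a b f assume p: "p \<in> hom B a b" "p \<in> fib MB" "p \<in> weq MB" and f: "f \<in> hom B (LO v) b"
  obtain u where u: "u \<in> hom A v (GO a)" "GA p \<cdot>\<^bsub>A\<^esub> u = adj v b f"
    using A.cofibrant_lift[OF v GA_hom[OF p(1)] GA_acyclic_fib[OF p(2,3)] adj_hom[OF O f]] by blast
  obtain h where h: "h \<in> hom B (LO v) a" "adj v a h = u"
    using adj_surj[OF _ u(1)] B.hom_Obj[OF p(1)] by blast
  have "p \<cdot>\<^bsub>B\<^esub> h = f"
    using adj_inj[OF O B.Cmp_hom[OF h(1) p(1)] f] adj_post[OF O h(1) p(1)] h u by simp
  then show "\<exists>u. u \<in> hom B (LO v) a \<and> p \<cdot>\<^bsub>B\<^esub> u = f" using h by blast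
qed

text \<open>The derived adjunction on hom-sets. The functor \<open>G\<close> takes a path object \<open>P\<close> of \<open>y\<close> to an object whose
  endpoint maps have a weak equivalence as common section, because the endpoint maps of \<open>P\<close> are acyclic
  fibrations; so homotopies transpose to \<open>A\<close>. In the other direction, the ends of a cylinder on \<open>v\<close> are
  acyclic cofibrations, so \<open>L\<close> takes the collapse map of the cylinder to a weak equivalence.\<close>

theorem adj_ho_eq:
  assumes v: "cofibrant A MA v" and y: "fibrant B MB y"
    and h: "h \<in> hom B (LO v) y" "h' \<in> hom B (LO v) y"
  shows "A.ho_eq v (GO y) (adj v y h) (adj v y h') \<longleftrightarrow> B.ho_eq (LO v) y h h'"
proof
  note O = A.cofibrant_Obj[OF v] B.fibrant_Obj[OF y]
  {
    assume e: "B.ho_eq (LO v) y h h'"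
    obtain P d0 d1 w where P: "path_object B MB y P d0 d1 w" using B.path_object_ex[OF O(2)] by blast
    obtain K where K: "K \<in> hom B (LO v) P" "d0 \<cdot>\<^bsub>B\<^esub> K = h" "d1 \<cdot>\<^bsub>B\<^esub> K = h'"
      using B.ho_eq_path_homotopy[OF e h LO_cofibrant[OF v] y P] by blast
    note D = B.path_objectD[OF P]
    note G = GA_hom[OF D(1)] GA_hom[OF D(2)] GA_hom[OF D(3)]
    have eq: "GA d0 \<cdot>\<^bsub>A\<^esub> GA w = Idn A (GO y)" "GA d1 \<cdot>\<^bsub>A\<^esub> GA w = Idn A (GO y)"
      using GA_retraction[OF D(1,3,5)] GA_retraction[OF D(2,3,6)] by blast+
    have "GA w \<in> weq MA"
      using A.weq_cancel_left[OF G(3,1) GA_acyclic_fib(2)[OF B.path_object_acyclic[OF y P]]]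
        eq A.Idn_weq[OF GO_Obj[OF O(2)]] by simp
    from A.ho_eq_path[OF G(3) this G(1,2) _ adj_hom[OF O(1) K(1)]]
    show "A.ho_eq v (GO y) (adj v y h) (adj v y h')"
      using eq adj_post[OF O(1) K(1) D(1)] adj_post[OF O(1) K(1) D(2)] K by simp
  }
  {
    assume e: "A.ho_eq v (GO y) (adj v y h) (adj v y h')"
    obtain c e0 e1 w where c: "cylinder A MA v c e0 e1 w" using A.cylinder_ex[OF O(1)] by blast
    obtain H where H: "H \<in> hom A c (GO y)" "H \<cdot>\<^bsub>A\<^esub> e0 = adj v y h" "H \<cdot>\<^bsub>A\<^esub> e1 = adj v y h'"
      using A.ho_eq_cylinder_homotopy[OF e adj_hom[OF O(1) h(1)] adj_hom[OF O(1) h(2)] v GO_fibrant[OF y] c]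
      by blast
    obtain K where K: "K \<in> hom B (LO c) y" "adj c y K = H" using adj_surj[OF O(2) H(1)] by blast
    note D = A.cylinderD[OF c]
    note L = LA_hom[OF D(1)] LA_hom[OF D(2)] LA_hom[OF D(3)]
    have eq: "LA w \<cdot>\<^bsub>B\<^esub> LA e0 = Idn B (LO v)" "LA w \<cdot>\<^bsub>B\<^esub> LA e1 = Idn B (LO v)"
      using LA_retraction[OF D(1,3,5)] LA_retraction[OF D(2,3,6)] by blast+
    have "LA w \<in> weq MB"
      using B.weq_cancel_right[OF L(1,3) LA_acyclic_cof[OF A.cylinder_acyclic[OF v c]]]
        eq B.Idn_weq[OF LO_Obj[OF O(1)]] by simp
    from B.ho_eq_cylinder[OF L(3) this L(1,2) _ K(1)]
    have "B.ho_eq (LO v) y (K \<cdot>\<^bsub>B\<^esub> LA e0) (K \<cdot>\<^bsub>B\<^esub> LA e1)" using eq by simp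
    moreover have "K \<cdot>\<^bsub>B\<^esub> LA e0 = h" "K \<cdot>\<^bsub>B\<^esub> LA e1 = h'"
      using adj_inj[OF O(1) B.Cmp_hom[OF L(1) K(1)] h(1)] adj_inj[OF O(1) B.Cmp_hom[OF L(2) K(1)] h(2)]
        adj_pre[OF D(1) K(1)] adj_pre[OF D(2) K(1)] K H by auto
    ultimately show "B.ho_eq (LO v) y h h'" by simp
  }
qed

end

section \<open>Unit coherence in a monoidal category\<close>

context closed_symmetric_monoidal_category
begin

lemma TenO_Obj [simp]: "x \<in> Obj V \<Longrightarrow> y \<in> Obj V \<Longrightarrow> x \<otimes> y \<in> Obj V"
  by (rule bif_Obj)

lemma TenA_simps [simp]:
  assumes "f \<in> Arr V" "g \<in> Arr V"
  shows "f \<boxtimes> g \<in> Arr V" "Dom V (f \<boxtimes> g) = Dom V f \<otimes> Dom V g" "Cod V (f \<boxtimes> g) = Cod V f \<otimes> Cod V g"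
  using bif_hom[OF arr_hom[OF assms(1)] arr_hom[OF assms(2)]] by (simp_all add: hom_iff)

lemma TenA_Idn [simp]: "x \<in> Obj V \<Longrightarrow> y \<in> Obj V \<Longrightarrow> Idn V x \<boxtimes> Idn V y = Idn V (x \<otimes> y)"
  by (rule bif_Idn)

lemma interchange [simp]:
  assumes "f \<in> Arr V" "g \<in> Arr V" "h \<in> Arr V" "k \<in> Arr V" "Dom V g = Cod V f" "Dom V k = Cod V h"
  shows "(g \<boxtimes> k) \<cdot> (f \<boxtimes> h) = (g \<cdot> f) \<boxtimes> (k \<cdot> h)"
  using bif_Cmp[of f "Dom V f" "Cod V f" g "Cod V g" h "Dom V h" "Cod V h" k "Cod V k"] assms
  by (simp add: hom_iff)

lemma interchange_comp [simp]:
  assumes "f \<in> Arr V" "g \<in> Arr V" "h \<in> Arr V" "k \<in> Arr V" "Dom V g = Cod V f" "Dom V k = Cod V h"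
    and "r \<in> Arr V" "Cod V r = Dom V f \<otimes> Dom V h"
  shows "(g \<boxtimes> k) \<cdot> ((f \<boxtimes> h) \<cdot> r) = ((g \<cdot> f) \<boxtimes> (k \<cdot> h)) \<cdot> r"
  using assms by (subst assoc[symmetric]) simp_all

declare Unit_Obj [simp] Ihom_Obj [simp]

lemma Assoc_simps [simp]:
  assumes "x \<in> Obj V" "y \<in> Obj V" "z \<in> Obj V"
  shows "Assoc V x y z \<in> Arr V" "Dom V (Assoc V x y z) = (x \<otimes> y) \<otimes> z"
    "Cod V (Assoc V x y z) = x \<otimes> (y \<otimes> z)"
  using Assoc_hom[OF assms] by (simp_all add: hom_iff)

lemma Lunit_simps [simp]:
  assumes "x \<in> Obj V"
  shows "Lunit V x \<in> Arr V" "Dom V (Lunit V x) = Unit V \<otimes> x" "Cod V (Lunit V x) = x"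
  using Lunit_hom[OF assms] by (simp_all add: hom_iff)

lemma Runit_simps [simp]:
  assumes "x \<in> Obj V"
  shows "Runit V x \<in> Arr V" "Dom V (Runit V x) = x \<otimes> Unit V" "Cod V (Runit V x) = x"
  using Runit_hom[OF assms] by (simp_all add: hom_iff)

lemma Ev_simps [simp]:
  assumes "x \<in> Obj V" "y \<in> Obj V"
  shows "Ev V x y \<in> Arr V" "Dom V (Ev V x y) = Ihom V x y \<otimes> x" "Cod V (Ev V x y) = y"
  using Ev_hom[OF assms] by (simp_all add: hom_iff)

abbreviation linv where "linv x \<equiv> inv_arr V (Lunit V x)"

abbreviation rinv where "rinv x \<equiv> inv_arr V (Runit V x)"

lemma Linv_simps [simp]:
  assumes "x \<in> Obj V"
  shows "linv x \<in> Arr V" "Dom V (linv x) = x"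
    "Cod V (linv x) = Unit V \<otimes> x"
    "Lunit V x \<cdot> linv x = Idn V x"
    "linv x \<cdot> Lunit V x = Idn V (Unit V \<otimes> x)"
  using inv_arr_simps[OF Lunit_iso[OF assms]] assms by simp_all

lemma Rinv_simps [simp]:
  assumes "x \<in> Obj V"
  shows "rinv x \<in> Arr V" "Dom V (rinv x) = x"
    "Cod V (rinv x) = x \<otimes> Unit V"
    "Runit V x \<cdot> rinv x = Idn V x"
    "rinv x \<cdot> Runit V x = Idn V (x \<otimes> Unit V)"
  using inv_arr_simps[OF Runit_iso[OF assms]] assms by simp_all

lemma conjugate_naturality:
  assumes "inverses V a a'" "inverses V b b'" "f \<in> Arr V" "g \<in> Arr V" "b \<cdot> g = f \<cdot> a"
    and "Dom V f = Cod V a" "Cod V g = Dom V b" "Dom V g = Dom V a" "Cod V f = Cod V b"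
  shows "b' \<cdot> f = g \<cdot> a'"
proof -
  have A: "a \<in> Arr V" "a' \<in> Arr V" "Dom V a' = Cod V a" "Cod V a' = Dom V a" "a \<cdot> a' = Idn V (Cod V a)"
    using assms(1) by (simp_all add: inverses_def hom_iff)
  have B: "b \<in> Arr V" "b' \<in> Arr V" "Dom V b' = Cod V b" "Cod V b' = Dom V b" "b' \<cdot> b = Idn V (Dom V b)"
    using assms(2) by (simp_all add: inverses_def hom_iff)
  have "b' \<cdot> f = b' \<cdot> ((f \<cdot> a) \<cdot> a')" using A B assms(3,6,9) by simp
  also have "\<dots> = (b' \<cdot> b) \<cdot> (g \<cdot> a')" unfolding assms(5)[symmetric]
    using A B(1-4) assms(4,7,8) by simp
  also have "\<dots> = g \<cdot> a'" unfolding B(5) using A B assms(4,7,8) by simp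
  finally show ?thesis .
qed

lemma Linv_natural:
  assumes "f \<in> Arr V"
  shows "linv (Cod V f) \<cdot> f = (Idn V (Unit V) \<boxtimes> f) \<cdot> linv (Dom V f)"
  by (rule conjugate_naturality[OF inv_arr_inverses[OF Lunit_iso] inv_arr_inverses[OF Lunit_iso]])
    (use assms Lunit_natural[OF arr_hom[OF assms]] in simp_all)

lemma Rinv_natural:
  assumes "f \<in> Arr V"
  shows "rinv (Cod V f) \<cdot> f = (f \<boxtimes> Idn V (Unit V)) \<cdot> rinv (Dom V f)"
  by (rule conjugate_naturality[OF inv_arr_inverses[OF Runit_iso] inv_arr_inverses[OF Runit_iso]])
    (use assms Runit_natural[OF arr_hom[OF assms]] in simp_all)

lemma Unit_TenA_cancel:
  assumes "f \<in> hom V x y" "g \<in> hom V x y" "Idn V (Unit V) \<boxtimes> f = Idn V (Unit V) \<boxtimes> g"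
  shows "f = g"
proof (rule iso_cancel_right[OF Lunit_iso])
  show "f \<cdot> Lunit V x = g \<cdot> Lunit V x"
    using Lunit_natural[OF assms(1)] Lunit_natural[OF assms(2)] assms(3) by simp
qed (use assms hom_Obj[OF assms(1)] in \<open>simp_all add: hom_iff\<close>)

lemma TenA_Unit_cancel:
  assumes "f \<in> hom V x y" "g \<in> hom V x y" "f \<boxtimes> Idn V (Unit V) = g \<boxtimes> Idn V (Unit V)"
  shows "f = g"
proof (rule iso_cancel_right[OF Runit_iso])
  show "f \<cdot> Runit V x = g \<cdot> Runit V x"
    using Runit_natural[OF assms(1)] Runit_natural[OF assms(2)] assms(3) by simp
qed (use assms hom_Obj[OF assms(1)] in \<open>simp_all add: hom_iff\<close>)

lemma iso_TenA_Idn: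
  assumes "iso V f" "x \<in> Obj V" shows "iso V (f \<boxtimes> Idn V x)"
  unfolding iso_def inverses_def
  by (rule exI[of _ "inv_arr V f \<boxtimes> Idn V x"])
    (use inv_arr_simps[OF assms(1)] assms(2) in \<open>simp add: hom_iff\<close>)

text \<open>After tensoring with the unit on the left, which is faithful, the claim follows from the pentagon for
  \<open>1, 1, a, b\<close>, the triangle and the naturality of the associator.\<close>

lemma Lunit_TenO:
  assumes a: "a \<in> Obj V" and b: "b \<in> Obj V"
  shows "Lunit V (a \<otimes> b) \<cdot> Assoc V (Unit V) a b = Lunit V a \<boxtimes> Idn V b"
proof -
  let ?I = "Unit V"
  let ?X = "Idn V ?I \<boxtimes> (Lunit V (a \<otimes> b) \<cdot> Assoc V ?I a b)" and ?Y = "Idn V ?I \<boxtimes> (Lunit V a \<boxtimes> Idn V b)"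
  let ?c = "Assoc V ?I (?I \<otimes> a) b" and ?d = "Assoc V ?I ?I a \<boxtimes> Idn V b"
  have "?X \<cdot> (?c \<cdot> ?d) = (Idn V ?I \<boxtimes> Lunit V (a \<otimes> b)) \<cdot> ((Idn V ?I \<boxtimes> Assoc V ?I a b) \<cdot> (?c \<cdot> ?d))"
    using a b by simp
  also have "\<dots> = (Idn V ?I \<boxtimes> Lunit V (a \<otimes> b)) \<cdot> (Assoc V ?I ?I (a \<otimes> b) \<cdot> Assoc V (?I \<otimes> ?I) a b)"
    using pentagon[of ?I ?I a b] a b by simp
  also have "\<dots> = (Runit V ?I \<boxtimes> Idn V (a \<otimes> b)) \<cdot> Assoc V (?I \<otimes> ?I) a b"
    by (rule assoc_subst[OF triangle]) (use a b in simp_all)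
  also have "\<dots> = Assoc V ?I a b \<cdot> ((Runit V ?I \<boxtimes> Idn V a) \<boxtimes> Idn V b)"
    using Assoc_natural[OF Runit_hom Idn_hom Idn_hom, of ?I a b] a b by simp
  also have "\<dots> = Assoc V ?I a b \<cdot> (((Idn V ?I \<boxtimes> Lunit V a) \<boxtimes> Idn V b) \<cdot> ?d)"
    using triangle[of ?I a] a b by simp
  also have "\<dots> = (Assoc V ?I a b \<cdot> ((Idn V ?I \<boxtimes> Lunit V a) \<boxtimes> Idn V b)) \<cdot> ?d"
    using a b by (simp del: interchange interchange_comp)
  also have "\<dots> = (?Y \<cdot> ?c) \<cdot> ?d"
    using Assoc_natural[OF Idn_hom Lunit_hom Idn_hom, of ?I a b] a b by simp
  also have "\<dots> = ?Y \<cdot> (?c \<cdot> ?d)" using a b by (simp del: interchange interchange_comp)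
  finally have "(?X \<cdot> ?c) \<cdot> ?d = (?Y \<cdot> ?c) \<cdot> ?d"
    using a b by (simp del: interchange interchange_comp)
  then have "?X \<cdot> ?c = ?Y \<cdot> ?c"
    by (rule iso_cancel_right[OF iso_TenA_Idn[OF Assoc_iso], rotated -1]) (use a b in simp_all)
  then have "?X = ?Y"
    by (rule iso_cancel_right[OF Assoc_iso, rotated -1]) (use a b in simp_all)
  then show ?thesis
    by (rule Unit_TenA_cancel[rotated 2]) (use a b in \<open>simp_all add: hom_iff\<close>)
qed

text \<open>This coherence is not among the axioms. It is needed because the composition of the underlying
  category is normalised by \<open>Lunit\<close> at the unit, whereas restriction along an arrow uses \<open>Runit\<close>.\<close>

lemma Lunit_Unit: "Lunit V (Unit V) = Runit V (Unit V)"
proof -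
  let ?I = "Unit V"
  have "Lunit V ?I \<cdot> (Idn V ?I \<boxtimes> Lunit V ?I) = Lunit V ?I \<cdot> Lunit V (?I \<otimes> ?I)"
    using Lunit_natural[OF Lunit_hom[of ?I]] by simp
  then have 1: "Idn V ?I \<boxtimes> Lunit V ?I = Lunit V (?I \<otimes> ?I)"
    by (rule iso_cancel_left[OF Lunit_iso, rotated -1]) simp_all
  have "Lunit V ?I \<boxtimes> Idn V ?I = (Idn V ?I \<boxtimes> Lunit V ?I) \<cdot> Assoc V ?I ?I ?I"
    using Lunit_TenO[of ?I ?I] 1 by simp
  also have "\<dots> = Runit V ?I \<boxtimes> Idn V ?I" using triangle[of ?I ?I] by simp
  finally show ?thesis
    by (rule TenA_Unit_cancel[rotated 2]) (simp_all add: hom_iff)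
qed

text \<open>The form in which coherence enters the functoriality of \<open>post\<close>; \<open>Rinv_TenO\<close> below does the same for
  \<open>pre\<close>.\<close>

lemma Linv_TenO:
  assumes "a \<in> Obj V"
  shows "Assoc V (Unit V) (Unit V) a \<cdot> ((linv (Unit V) \<boxtimes> Idn V a) \<cdot> linv a) =
    (Idn V (Unit V) \<boxtimes> linv a) \<cdot> linv a" (is "?l = ?r")
proof -
  let ?I = "Unit V"
  have "(Idn V ?I \<boxtimes> Lunit V a) \<cdot> ?l =
      (Runit V ?I \<boxtimes> Idn V a) \<cdot> ((linv ?I \<boxtimes> Idn V a) \<cdot> linv a)"
    by (rule assoc_subst[OF triangle]) (use assms in simp_all)
  also have "\<dots> = (Idn V ?I \<boxtimes> Lunit V a) \<cdot> ?r" using assms by (simp flip: Lunit_Unit)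
  finally have e: "(Idn V ?I \<boxtimes> Lunit V a) \<cdot> ?l = (Idn V ?I \<boxtimes> Lunit V a) \<cdot> ?r" .
  have i: "iso V (Idn V ?I \<boxtimes> Lunit V a)"
    unfolding iso_def inverses_def
    by (rule exI[of _ "Idn V ?I \<boxtimes> linv a"]) (use assms in \<open>simp add: hom_iff\<close>)
  show ?thesis by (rule iso_cancel_left[OF i _ _ _ _ e]) (use assms in simp_all)
qed

lemma Rinv_TenO:
  assumes "a \<in> Obj V"
  shows "Assoc V a (Unit V) (Unit V) \<cdot> ((rinv a \<boxtimes> Idn V (Unit V)) \<cdot> rinv a) =
    (Idn V a \<boxtimes> linv (Unit V)) \<cdot> rinv a" (is "?l = ?r")
proof -
  let ?I = "Unit V"
  have "(Idn V a \<boxtimes> Lunit V ?I) \<cdot> ?l =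
      (Runit V a \<boxtimes> Idn V ?I) \<cdot> ((rinv a \<boxtimes> Idn V ?I) \<cdot> rinv a)"
    by (rule assoc_subst[OF triangle]) (use assms in simp_all)
  also have "\<dots> = (Idn V a \<boxtimes> Lunit V ?I) \<cdot> ?r" using assms by simp
  finally have e: "(Idn V a \<boxtimes> Lunit V ?I) \<cdot> ?l = (Idn V a \<boxtimes> Lunit V ?I) \<cdot> ?r" .
  have i: "iso V (Idn V a \<boxtimes> Lunit V ?I)"
    unfolding iso_def inverses_def
    by (rule exI[of _ "Idn V a \<boxtimes> linv ?I"]) (use assms in \<open>simp add: hom_iff\<close>)
  show ?thesis by (rule iso_cancel_left[OF i _ _ _ _ e]) (use assms in simp_all)
qed

lemma transpose:
  assumes "x \<in> Obj V" "y \<in> Obj V" "z \<in> Obj V" "f \<in> hom V (z \<otimes> x) y"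
  shows "transpose V z x y f \<in> hom V z (Ihom V x y)" "Ev V x y \<cdot> (transpose V z x y f \<boxtimes> Idn V x) = f"
  using theI'[OF Ev_universal[OF assms]] unfolding transpose_def by blast+

lemma transpose_eqI:
  assumes "x \<in> Obj V" "y \<in> Obj V" "g \<in> hom V z (Ihom V x y)" "Ev V x y \<cdot> (g \<boxtimes> Idn V x) = f"
  shows "transpose V z x y f = g"
proof -
  have z: "z \<in> Obj V" using assms(3) hom_Obj by blast
  have "f \<in> hom V (z \<otimes> x) y" using assms z by (auto simp: hom_iff)
  from Ev_universal[OF assms(1,2) z this] transpose[OF assms(1,2) z this] assms(3,4)
  show ?thesis by blast
qed

lemma IhomA:
  assumes "h \<in> hom V v' v" "k \<in> hom V w w'"
  shows "IhomA V h k \<in> hom V (Ihom V v w) (Ihom V v' w')"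
    "Ev V v' w' \<cdot> (IhomA V h k \<boxtimes> Idn V v') = k \<cdot> (Ev V v w \<cdot> (Idn V (Ihom V v w) \<boxtimes> h))"
proof -
  have O: "v' \<in> Obj V" "v \<in> Obj V" "w \<in> Obj V" "w' \<in> Obj V" using assms hom_Obj by blast+
  have d: "Cod V h = v" "Dom V h = v'" "Dom V k = w" "Cod V k = w'" using assms by (simp_all add: hom_iff)
  have "k \<cdot> (Ev V v w \<cdot> (Idn V (Ihom V v w) \<boxtimes> h)) \<in> hom V (Ihom V v w \<otimes> v') w'"
    using assms O by (auto simp: hom_iff)
  note t = transpose[OF O(1,4) Ihom_Obj[OF O(2,3)] this]
  show "IhomA V h k \<in> hom V (Ihom V v w) (Ihom V v' w')"
    "Ev V v' w' \<cdot> (IhomA V h k \<boxtimes> Idn V v') = k \<cdot> (Ev V v w \<cdot> (Idn V (Ihom V v w) \<boxtimes> h))"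
    using t unfolding IhomA_def d by blast+
qed

end

section \<open>The underlying category of an enriched category\<close>

lemma underlying_Obj [simp]: "Obj (underlying V C) = Eob C"
  by (simp add: underlying_def)

lemma underlying_hom:
  "f \<in> hom (underlying V C) x y \<longleftrightarrow>
     x \<in> Eob C \<and> y \<in> Eob C \<and> f = (x, y, point f) \<and> point f \<in> hom V (Unit V) (Hob C x y)"
  by (cases f) (auto simp: hom_def underlying_def point_def)

lemma point_hom: "f \<in> hom (underlying V C) x y \<Longrightarrow> point f \<in> hom V (Unit V) (Hob C x y)"
  unfolding underlying_hom by blast

lemma underlying_homE:
  assumes "f \<in> hom (underlying V C) x y"
  obtains u where "f = (x, y, u)" "point f = u"
  using assms unfolding underlying_hom by blast

locale closed_enriched_category = closed_symmetric_monoidal_category V + enriched_category V C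
  for V :: "('o, 'a, 'z) smcat_scheme" (structure) and C :: "('c, 'o, 'a) ecat"
begin

abbreviation C0 where "C0 \<equiv> underlying V C"

declare Hob_Obj [simp]

lemma Ecmp_simps [simp]:
  assumes "x \<in> Eob C" "y \<in> Eob C" "z \<in> Eob C"
  shows "Ecmp C x y z \<in> Arr V" "Dom V (Ecmp C x y z) = Hob C y z \<otimes> Hob C x y"
    "Cod V (Ecmp C x y z) = Hob C x z"
  using Ecmp_hom[OF assms] by (simp_all add: hom_iff)

lemma point_simps:
  assumes "f \<in> hom (C0) x y"
  shows "x \<in> Eob C" "y \<in> Eob C" "point f \<in> Arr V" "Dom V (point f) = Unit V" "Cod V (point f) = Hob C x y"
  using conjunct1[OF assms[unfolded underlying_hom]] point_hom[OF assms]
    conjunct1[OF conjunct2[OF assms[unfolded underlying_hom]]] by (simp_all add: hom_iff)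

lemma hom_of_point:
  assumes "x \<in> Eob C" "y \<in> Eob C" "u \<in> hom V (Unit V) (Hob C x y)"
  shows "(x, y, u) \<in> hom (C0) x y" "point (x, y, u) = u"
  using assms by (simp_all add: underlying_hom point_def)

lemma post_eq:
  assumes "g \<in> hom (C0) y z"
  shows "post V C x g = Ecmp C x y z \<cdot> ((point g \<boxtimes> Idn V (Hob C x y)) \<cdot> linv (Hob C x y))"
  using assms by (rule underlying_homE) (simp add: post_def point_def)

lemma pre_eq:
  assumes "f \<in> hom (C0) x y"
  shows "pre V C f z = Ecmp C x y z \<cdot> ((Idn V (Hob C y z) \<boxtimes> point f) \<cdot> rinv (Hob C y z))"
  using assms by (rule underlying_homE) (simp add: pre_def point_def)

lemma point_Cmp:
  assumes "f \<in> hom (C0) x y" "g \<in> hom (C0) y z"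
  shows "point (g \<cdot>\<^bsub>C0\<^esub> f) =
    Ecmp C x y z \<cdot> ((point g \<boxtimes> point f) \<cdot> linv (Unit V))"
proof -
  obtain u v where "f = (x, y, u)" "g = (y, z, v)" using assms underlying_homE by metis
  then show ?thesis by (simp add: underlying_def point_def)
qed

lemma post_hom: "g \<in> hom (C0) y z \<Longrightarrow> x \<in> Eob C \<Longrightarrow> post V C x g \<in> hom V (Hob C x y) (Hob C x z)"
  using point_simps[of g y z] by (simp add: post_eq hom_iff)

lemma pre_hom: "f \<in> hom (C0) x y \<Longrightarrow> z \<in> Eob C \<Longrightarrow> pre V C f z \<in> hom V (Hob C y z) (Hob C x z)"
  using point_simps[of f x y] by (simp add: pre_eq hom_iff)

lemma point_Cmp_post:
  assumes f: "f \<in> hom (C0) x y" and g: "g \<in> hom (C0) y z"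
  shows "point (g \<cdot>\<^bsub>C0\<^esub> f) = post V C x g \<cdot> point f"
proof -
  note F = point_simps[OF f] and G = point_simps[OF g]
  have "linv (Hob C x y) \<cdot> point f =
      (Idn V (Unit V) \<boxtimes> point f) \<cdot> linv (Unit V)"
    using Linv_natural[of "point f"] F by simp
  then show ?thesis unfolding point_Cmp[OF f g] post_eq[OF g] using F G by simp
qed

lemma point_Cmp_pre:
  assumes f: "f \<in> hom (C0) x y" and g: "g \<in> hom (C0) y z"
  shows "point (g \<cdot>\<^bsub>C0\<^esub> f) = pre V C f z \<cdot> point g"
proof -
  note F = point_simps[OF f] and G = point_simps[OF g]
  have "rinv (Hob C y z) \<cdot> point g =
      (point g \<boxtimes> Idn V (Unit V)) \<cdot> linv (Unit V)"
    using Rinv_natural[of "point g"] F G by (simp add: Lunit_Unit)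
  then show ?thesis unfolding point_Cmp[OF f g] pre_eq[OF f] using F G by simp
qed

lemma pre_Idn:
  assumes "x \<in> Eob C" "y \<in> Eob C"
  shows "pre V C (Idn (C0) x) y = Idn V (Hob C x y)"
proof -
  have "(Ecmp C x x y \<cdot> (Idn V (Hob C x y) \<boxtimes> Eid C x)) \<cdot> rinv (Hob C x y) =
      pre V C (Idn (C0) x) y"
    using assms Eid_hom[OF assms(1)] by (simp add: pre_def underlying_def hom_iff)
  then show ?thesis unfolding Ecmp_Eid[OF assms] using assms by simp
qed

lemma post_Idn:
  assumes "x \<in> Eob C" "y \<in> Eob C"
  shows "post V C x (Idn (C0) y) = Idn V (Hob C x y)"
proof -
  have "(Ecmp C x y y \<cdot> (Eid C y \<boxtimes> Idn V (Hob C x y))) \<cdot> linv (Hob C x y) =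
      post V C x (Idn (C0) y)"
    using assms Eid_hom[OF assms(2)] by (simp add: post_def underlying_def hom_iff)
  then show ?thesis unfolding Eid_Ecmp[OF assms] using assms by simp
qed

text \<open>Enriched associativity moves both points into the right tensor factor; what is left is
  \<open>Rinv_TenO\<close>.\<close>

lemma pre_Cmp:
  assumes f: "f \<in> hom (C0) x y" and g: "g \<in> hom (C0) y z" and w: "w \<in> Eob C"
    and gf: "g \<cdot>\<^bsub>C0\<^esub> f \<in> hom (C0) x z"
  shows "pre V C (g \<cdot>\<^bsub>C0\<^esub> f) w = pre V C f w \<cdot> pre V C g w"
proof -
  note F = point_simps[OF f] and G = point_simps[OF g]
  let ?u = "point f" and ?v = "point g" and ?I = "Unit V"
  let ?A = "Hob C z w" and ?B = "Hob C y z" and ?D = "Hob C x y"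
  let ?R = "rinv ?A" and ?E = "Ecmp C y z w"
  have "pre V C f w \<cdot> pre V C g w =
      Ecmp C x y w \<cdot> ((Idn V (Hob C y w) \<boxtimes> ?u) \<cdot> (rinv (Hob C y w) \<cdot> pre V C g w))"
    unfolding pre_eq[OF f] using F G w pre_hom[OF g w] by (simp add: hom_iff)
  also have "rinv (Hob C y w) \<cdot> pre V C g w =
      (pre V C g w \<boxtimes> Idn V ?I) \<cdot> ?R"
    using Rinv_natural[of "pre V C g w"] pre_hom[OF g w] by (simp add: hom_iff)
  also have "(Idn V (Hob C y w) \<boxtimes> ?u) \<cdot> ((pre V C g w \<boxtimes> Idn V ?I) \<cdot> ?R) =
      (?E \<boxtimes> Idn V ?D) \<cdot> (((Idn V ?A \<boxtimes> ?v) \<boxtimes> ?u) \<cdot> ((?R \<boxtimes> Idn V ?I) \<cdot> ?R))"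
    unfolding pre_eq[OF g] using F G w by simp
  also have "Ecmp C x y w \<cdot> \<dots> =
      (Ecmp C x y w \<cdot> (?E \<boxtimes> Idn V ?D)) \<cdot> (((Idn V ?A \<boxtimes> ?v) \<boxtimes> ?u) \<cdot> ((?R \<boxtimes> Idn V ?I) \<cdot> ?R))"
    using F G w by simp
  also have "\<dots> = (Ecmp C x z w \<cdot> (Idn V ?A \<boxtimes> Ecmp C x y z)) \<cdot>
      ((Assoc V ?A ?B ?D \<cdot> ((Idn V ?A \<boxtimes> ?v) \<boxtimes> ?u)) \<cdot> ((?R \<boxtimes> Idn V ?I) \<cdot> ?R))"
    unfolding Ecmp_assoc[OF F(1,2) G(2) w] using F G w by (simp del: interchange interchange_comp)
  also have "Assoc V ?A ?B ?D \<cdot> ((Idn V ?A \<boxtimes> ?v) \<boxtimes> ?u) = (Idn V ?A \<boxtimes> (?v \<boxtimes> ?u)) \<cdot> Assoc V ?A ?I ?I"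
    by (rule Assoc_natural) (use F G w in \<open>auto simp: hom_iff\<close>)
  also have "\<dots> \<cdot> ((?R \<boxtimes> Idn V ?I) \<cdot> ?R) =
      (Idn V ?A \<boxtimes> (?v \<boxtimes> ?u)) \<cdot> (Assoc V ?A ?I ?I \<cdot> ((?R \<boxtimes> Idn V ?I) \<cdot> ?R))"
    using F G w by (simp del: interchange interchange_comp)
  also have "\<dots> = (Idn V ?A \<boxtimes> (?v \<boxtimes> ?u)) \<cdot> ((Idn V ?A \<boxtimes> linv ?I) \<cdot> ?R)"
    unfolding Rinv_TenO[OF Hob_Obj[OF G(2) w]] ..
  also have "(Ecmp C x z w \<cdot> (Idn V ?A \<boxtimes> Ecmp C x y z)) \<cdot> \<dots> = pre V C (g \<cdot>\<^bsub>C0\<^esub> f) w"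
    unfolding pre_eq[OF gf] point_Cmp[OF f g] using F G w by simp
  finally show ?thesis ..
qed

text \<open>Enriched associativity moves both points out of the left tensor factor; what is left is
  \<open>Linv_TenO\<close>.\<close>

lemma post_Cmp:
  assumes f: "f \<in> hom (C0) x y" and g: "g \<in> hom (C0) y z" and w: "w \<in> Eob C"
    and gf: "g \<cdot>\<^bsub>C0\<^esub> f \<in> hom (C0) x z"
  shows "post V C w (g \<cdot>\<^bsub>C0\<^esub> f) = post V C w g \<cdot> post V C w f"
proof -
  note F = point_simps[OF f] and G = point_simps[OF g]
  let ?u = "point f" and ?v = "point g" and ?I = "Unit V"
  let ?A = "Hob C w x" and ?B = "Hob C x y" and ?D = "Hob C y z"
  let ?L = "linv ?A" and ?E = "Ecmp C w x y"
  let ?J = "(linv ?I \<boxtimes> Idn V ?A) \<cdot> ?L"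
  have "post V C w (g \<cdot>\<^bsub>C0\<^esub> f) =
      (Ecmp C w x z \<cdot> (Ecmp C x y z \<boxtimes> Idn V ?A)) \<cdot> (((?v \<boxtimes> ?u) \<boxtimes> Idn V ?A) \<cdot> ?J)"
    unfolding post_eq[OF gf] point_Cmp[OF f g] using F G w by simp
  also have "\<dots> = (Ecmp C w y z \<cdot> (Idn V ?D \<boxtimes> ?E)) \<cdot>
      ((Assoc V ?D ?B ?A \<cdot> ((?v \<boxtimes> ?u) \<boxtimes> Idn V ?A)) \<cdot> ?J)"
    unfolding Ecmp_assoc[OF w F(1,2) G(2)] using F G w by (simp del: interchange interchange_comp)
  also have "Assoc V ?D ?B ?A \<cdot> ((?v \<boxtimes> ?u) \<boxtimes> Idn V ?A) = (?v \<boxtimes> (?u \<boxtimes> Idn V ?A)) \<cdot> Assoc V ?I ?I ?A"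
    by (rule Assoc_natural) (use F G w in \<open>auto simp: hom_iff\<close>)
  also have "\<dots> \<cdot> ?J = (?v \<boxtimes> (?u \<boxtimes> Idn V ?A)) \<cdot> (Assoc V ?I ?I ?A \<cdot> ?J)"
    using F G w by (simp del: interchange interchange_comp)
  also have "\<dots> = (?v \<boxtimes> (?u \<boxtimes> Idn V ?A)) \<cdot> ((Idn V ?I \<boxtimes> ?L) \<cdot> ?L)"
    unfolding Linv_TenO[OF Hob_Obj[OF w F(1)]] ..
  also have "(Ecmp C w y z \<cdot> (Idn V ?D \<boxtimes> ?E)) \<cdot> \<dots> =
      Ecmp C w y z \<cdot> ((?v \<boxtimes> Idn V (Hob C w y)) \<cdot> ((Idn V ?I \<boxtimes> post V C w f) \<cdot> ?L))"
    unfolding post_eq[OF f] using F G w by simp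
  also have "(Idn V ?I \<boxtimes> post V C w f) \<cdot> ?L = linv (Hob C w y) \<cdot> post V C w f"
    using Linv_natural[of "post V C w f"] post_hom[OF f w] by (simp add: hom_iff)
  also have "Ecmp C w y z \<cdot> ((?v \<boxtimes> Idn V (Hob C w y)) \<cdot> (linv (Hob C w y) \<cdot> post V C w f)) =
      post V C w g \<cdot> post V C w f"
    unfolding post_eq[OF g] using F G w post_hom[OF f w] by (simp add: hom_iff)
  finally show ?thesis .
qed

end

section \<open>Tensoring with a cofibrant object\<close>

lemma (in category) terminal_eq: "terminal C t \<Longrightarrow> f \<in> hom C x t \<Longrightarrow> g \<in> hom C x t \<Longrightarrow> f = g"
  unfolding terminal_def using hom_Obj(1) by metis

lemma (in category) terminal_arr:
  assumes "terminal C t" "x \<in> Obj C"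
  obtains f where "f \<in> hom C x t"
  using assms by (auto simp: terminal_def)

lemma pushout_productD:
  assumes "pushout_product_axiom A MA B MB E ME TA"
    and "i \<in> hom A x y" "i \<in> cof MA" "k \<in> hom B a b" "k \<in> cof MB"
    and "is_pushout E (TA (Idn A x) k) (TA i (Idn B a)) p q"
    and "u \<in> hom E (Cod E p) (Cod E (TA i k))"
    and "u \<cdot>\<^bsub>E\<^esub> p = TA i (Idn B b)" "u \<cdot>\<^bsub>E\<^esub> q = TA (Idn A y) k"
  shows "u \<in> cof ME" "i \<in> weq MA \<or> k \<in> weq MB \<Longrightarrow> u \<in> weq ME"
  using assms unfolding pushout_product_axiom_def by blast+

text \<open>The span \<open>e \<otimes> b \<leftarrow> e \<otimes> a \<rightarrow> x \<otimes> a\<close> starts at two initial objects, so its pushout is \<open>x \<otimes> a\<close> and the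
  pushout product of \<open>e \<rightarrow> x\<close> with \<open>k\<close> is \<open>x \<otimes> k\<close>.\<close>

lemma pushout_product_fixed_left:
  assumes "bifunctor A B E TO TA" "category A" "category B" "category E"
    and pp: "pushout_product_axiom A MA B MB E ME TA"
    and i: "i \<in> hom A e x" "i \<in> cof MA" and k: "k \<in> hom B a b" "k \<in> cof MB"
    and I: "initial E (TO e a)" "initial E (TO e b)"
  shows "TA (Idn A x) k \<in> cof ME" "k \<in> weq MB \<Longrightarrow> TA (Idn A x) k \<in> weq ME"
proof -
  interpret bifunctor A B E TO TA by fact
  interpret A: category A by fact
  interpret B: category B by fact
  interpret E: category E by fact
  have O: "e \<in> Obj A" "x \<in> Obj A" "a \<in> Obj B" "b \<in> Obj B" using i k A.hom_Obj B.hom_Obj by blast+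
  have f: "TA (Idn A e) k \<in> hom E (TO e a) (TO e b)" and g: "TA i (Idn B a) \<in> hom E (TO e a) (TO x a)"
    and ik: "TA i k \<in> hom E (TO e a) (TO x b)" and ib: "TA i (Idn B b) \<in> hom E (TO e b) (TO x b)"
    and u: "TA (Idn A x) k \<in> hom E (TO x a) (TO x b)"
    using bif_hom i k A.Idn_hom B.Idn_hom O by blast+
  have xa: "TO x a \<in> Obj E" using E.hom_Obj u by blast
  obtain p where p: "p \<in> hom E (TO e b) (TO x a)" using E.initial_arr[OF I(2) xa] by blast
  let ?q = "Idn E (TO x a)"
  have q: "?q \<in> hom E (TO x a) (TO x a)" using E.Idn_hom[OF xa] .
  have dc: "Dom E (TA (Idn A e) k) = TO e a" "Cod E (TA (Idn A e) k) = TO e b"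
    "Dom E (TA i (Idn B a)) = TO e a" "Cod E (TA i (Idn B a)) = TO x a"
    "Dom E p = TO e b" "Cod E p = TO x a" "Cod E (TA i k) = TO x b"
    "Dom E ?q = TO x a" "Cod E ?q = TO x a"
    using f g p ik q by (simp_all add: hom_iff)
  have pf: "p \<cdot>\<^bsub>E\<^esub> TA (Idn A e) k = ?q \<cdot>\<^bsub>E\<^esub> TA i (Idn B a)"
    by (rule E.initial_eq[OF I(1) E.Cmp_hom[OF f p] E.Cmp_hom[OF g q]])
  have "\<exists>!h. h \<in> hom E (TO x a) c \<and> h \<cdot>\<^bsub>E\<^esub> p = u \<and> h \<cdot>\<^bsub>E\<^esub> ?q = v"
    if "u \<in> hom E (TO e b) c" "v \<in> hom E (TO x a) c" for c u v
  proof (rule ex1I[of _ v])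
    show "v \<in> hom E (TO x a) c \<and> v \<cdot>\<^bsub>E\<^esub> p = u \<and> v \<cdot>\<^bsub>E\<^esub> ?q = v"
      using that E.initial_eq[OF I(2) E.Cmp_hom[OF p that(2)] that(1)] E.Cmp_Idn by blast
  qed (use E.Cmp_Idn in metis)
  then have "is_pushout E (TA (Idn A e) k) (TA i (Idn B a)) p ?q"
    unfolding is_pushout_def dc using f g p q pf by (auto simp: hom_iff)
  moreover have "TA (Idn A x) k \<cdot>\<^bsub>E\<^esub> p = TA i (Idn B b)"
    by (rule E.initial_eq[OF I(2) E.Cmp_hom[OF p u] ib])
  moreover have "TA (Idn A x) k \<cdot>\<^bsub>E\<^esub> ?q = TA (Idn A x) k" using E.Cmp_Idn[OF u] .
  moreover have "TA (Idn A x) k \<in> hom E (Cod E p) (Cod E (TA i k))" unfolding dc by (rule u)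
  ultimately show "TA (Idn A x) k \<in> cof ME" "k \<in> weq MB \<Longrightarrow> TA (Idn A x) k \<in> weq ME"
    using pushout_productD[OF pp i k] by blast+
qed

lemma is_pushout_swap: "is_pushout C f g p q \<Longrightarrow> is_pushout C g f q p"
  unfolding is_pushout_def by (simp, metis)

text \<open>The pushout-product axiom is symmetric in the two variables of the bifunctor.\<close>

lemma pushout_product_fixed_right:
  assumes "bifunctor A B E TO TA" "category A" "category B" "category E"
    and pp: "pushout_product_axiom A MA B MB E ME TA"
    and i: "i \<in> hom A x y" "i \<in> cof MA" and k: "k \<in> hom B e b" "k \<in> cof MB"
    and I: "initial E (TO x e)" "initial E (TO y e)"
  shows "TA i (Idn B b) \<in> cof ME" "i \<in> weq MA \<Longrightarrow> TA i (Idn B b) \<in> weq ME"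
proof -
  have b: "bifunctor B A E (\<lambda>v x. TO x v) (\<lambda>k f. TA f k)"
    using assms(1) by (simp add: bifunctor_def)
  have p: "pushout_product_axiom B MB A MA E ME (\<lambda>k f. TA f k)"
    unfolding pushout_product_axiom_def
  proof (intro allI impI, elim conjE)
    fix v w j x y f p q u
    assume j: "j \<in> hom B v w" "j \<in> cof MB" and f: "f \<in> hom A x y" "f \<in> cof MA"
      and po: "is_pushout E (TA f (Idn B v)) (TA (Idn A x) j) p q"
      and u: "u \<in> hom E (Cod E p) (Cod E (TA f j))"
        "u \<cdot>\<^bsub>E\<^esub> p = TA (Idn A y) j" "u \<cdot>\<^bsub>E\<^esub> q = TA f (Idn B w)"
    have "u \<in> hom E (Cod E q) (Cod E (TA f j))" using po u(1) by (simp add: is_pushout_def)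
    from pushout_productD[OF pp f j is_pushout_swap[OF po] this u(3,2)]
    show "u \<in> cof ME \<and> (j \<in> weq MB \<or> f \<in> weq MA \<longrightarrow> u \<in> weq ME)" by blast
  qed
  note left = pushout_product_fixed_left[OF b assms(3,2,4) p k i I]
  show "TA i (Idn B b) \<in> cof ME" "i \<in> weq MA \<Longrightarrow> TA i (Idn B b) \<in> weq ME"
    by (rule left, assumption?)+
qed

context model_category
begin

lemma cofibrant_initial_cof:
  assumes "cofibrant C M x"
  obtains e i where "initial C e" "i \<in> hom C e x" "i \<in> cof M"
  using assms ex_initial initial_arr cofibrant_Obj[OF assms] unfolding cofibrant_def by metis

lemma zz_Bwd_solve:
  assumes "m \<in> hom C b a" "m \<in> weq M" "k \<in> hom C b y" "u \<in> hom C a y"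
    and "zz a y [Bwd m, Fwd k] [Fwd u]"
  shows "ho_eq b y (u \<cdot> m) k"
proof -
  have 1: "zz b y ([Fwd m] @ [Bwd m, Fwd k]) ([Fwd m] @ [Fwd u])"
    by (rule zz_append_right[OF zigzag_Fwd[OF assms(1)] assms(5)])
  have 2: "zz b y ([Fwd m, Bwd m] @ [Fwd k]) [Fwd k]"
    by (rule zz_cancel_prefix[OF zz_Fwd_Bwd[OF assms(2,1)] zigzag_Fwd[OF assms(3)]])
  have "zz b y [Fwd m, Fwd u] [Fwd k]" using zz_trans[OF zz_sym[OF 1]] 2 by simp
  then show ?thesis by (rule zz_trans[OF zz_Cmp'[OF assms(1,4)]])
qed

end

context closed_symmetric_monoidal_category
begin

text \<open>The functor \<open>- \<otimes> a\<close> is a left adjoint.\<close>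

lemma initial_TenO_left:
  assumes e: "initial V e" and a: "a \<in> Obj V" shows "initial V (e \<otimes> a)"
  unfolding initial_def
proof (intro conjI ballI)
  have eO: "e \<in> Obj V" using e by (simp add: initial_def)
  then show "e \<otimes> a \<in> Obj V" using a by simp
  fix y assume y: "y \<in> Obj V"
  obtain t where t: "t \<in> hom V e (Ihom V a y)" using initial_arr[OF e] Ihom_Obj[OF a y] by blast
  show "\<exists>!f. f \<in> hom V (e \<otimes> a) y"
  proof
    show "Ev V a y \<cdot> (t \<boxtimes> Idn V a) \<in> hom V (e \<otimes> a) y" using t a y by (auto simp: hom_iff)
    fix f assume f: "f \<in> hom V (e \<otimes> a) y"
    show "f = Ev V a y \<cdot> (t \<boxtimes> Idn V a)"
      using transpose[OF a y eO f] initial_eq[OF e _ t] by metis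
  qed
qed

lemma initial_TenO_right:
  assumes e: "initial V e" and a: "a \<in> Obj V" shows "initial V (a \<otimes> e)"
proof -
  have "e \<in> Obj V" using e by (simp add: initial_def)
  then show ?thesis
    using initial_iso[OF initial_TenO_left[OF e a] Symm_hom Symm_hom Symm_Symm] a by blast
qed

lemma transpose_pre:
  assumes "k \<in> hom V v' v" "h \<in> hom V (v \<otimes> x) y" "x \<in> Obj V"
  shows "transpose V v' x y (h \<cdot> (k \<boxtimes> Idn V x)) = transpose V v x y h \<cdot> k"
proof -
  have O: "v \<in> Obj V" "y \<in> Obj V" using assms hom_Obj by blast+
  note t = transpose[OF assms(3) O(2,1) assms(2)]
  show ?thesis
  proof (rule transpose_eqI[OF assms(3) O(2) Cmp_hom[OF assms(1) t(1)]])
    have "Ev V x y \<cdot> ((transpose V v x y h \<cdot> k) \<boxtimes> Idn V x) =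
        Ev V x y \<cdot> ((transpose V v x y h \<boxtimes> Idn V x) \<cdot> (k \<boxtimes> Idn V x))"
      using t(1) assms(1,3) by (simp add: hom_iff)
    also have "\<dots> = h \<cdot> (k \<boxtimes> Idn V x)"
      by (rule assoc_subst[OF t(2)]) (use t(1) assms(1,3) O in \<open>simp_all add: hom_iff\<close>)
    finally show "Ev V x y \<cdot> ((transpose V v x y h \<cdot> k) \<boxtimes> Idn V x) = h \<cdot> (k \<boxtimes> Idn V x)" .
  qed
qed

lemma transpose_post:
  assumes "h \<in> hom V (v \<otimes> x) y" "p \<in> hom V y y'" "x \<in> Obj V" "v \<in> Obj V"
  shows "transpose V v x y' (p \<cdot> h) = IhomA V (Idn V x) p \<cdot> transpose V v x y h"
proof -
  have O: "y \<in> Obj V" "y' \<in> Obj V" using assms hom_Obj by blast+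
  note t = transpose[OF assms(3) O(1) assms(4,1)] and G = IhomA[OF Idn_hom[OF assms(3)] assms(2)]
  show ?thesis
  proof (rule transpose_eqI[OF assms(3) O(2) Cmp_hom[OF t(1) G(1)]])
    have "Ev V x y' \<cdot> ((IhomA V (Idn V x) p \<cdot> transpose V v x y h) \<boxtimes> Idn V x) =
        Ev V x y' \<cdot> ((IhomA V (Idn V x) p \<boxtimes> Idn V x) \<cdot> (transpose V v x y h \<boxtimes> Idn V x))"
      using t(1) G(1) assms(3) by (simp add: hom_iff)
    also have "\<dots> = (p \<cdot> (Ev V x y \<cdot> (Idn V (Ihom V x y) \<boxtimes> Idn V x))) \<cdot> (transpose V v x y h \<boxtimes> Idn V x)"
      by (rule assoc_subst[OF G(2)]) (use t(1) G(1) assms(3) O in \<open>simp_all add: hom_iff\<close>)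
    also have "\<dots> = p \<cdot> (Ev V x y \<cdot> (transpose V v x y h \<boxtimes> Idn V x))"
      using t(1) assms(2,3) O by (simp add: hom_iff)
    finally show "Ev V x y' \<cdot> ((IhomA V (Idn V x) p \<cdot> transpose V v x y h) \<boxtimes> Idn V x) = p \<cdot> h"
      using t(2) by simp
  qed
qed

lemma transpose_bij:
  assumes "x \<in> Obj V" "y \<in> Obj V" "v \<in> Obj V"
  shows "bij_betw (transpose V v x y) (hom V (v \<otimes> x) y) (hom V v (Ihom V x y))"
proof (rule bij_betw_byWitness[where f' = "\<lambda>g. Ev V x y \<cdot> (g \<boxtimes> Idn V x)"])
  show "\<forall>f\<in>hom V (v \<otimes> x) y. Ev V x y \<cdot> (transpose V v x y f \<boxtimes> Idn V x) = f"
    "transpose V v x y ` hom V (v \<otimes> x) y \<subseteq> hom V v (Ihom V x y)"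
    using transpose[OF assms] by blast+
  show "\<forall>g\<in>hom V v (Ihom V x y). transpose V v x y (Ev V x y \<cdot> (g \<boxtimes> Idn V x)) = g"
    using transpose_eqI[OF assms(1,2)] by blast
  show "(\<lambda>g. Ev V x y \<cdot> (g \<boxtimes> Idn V x)) ` hom V v (Ihom V x y) \<subseteq> hom V (v \<otimes> x) y"
    using assms by (auto simp: hom_iff)
qed

lemma Ihom_Unit_iso:
  assumes "w \<in> Obj V"
  shows "Ihom_Unit_iso V w \<in> hom V w (Ihom V (Unit V) w)"
    "Ev V (Unit V) w \<cdot> (Ihom_Unit_iso V w \<boxtimes> Idn V (Unit V)) = Runit V w"
  using transpose[OF Unit_Obj assms assms Runit_hom[OF assms]] unfolding Ihom_Unit_iso_def .

text \<open>Points of an internal hom are arrows.\<close>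

lemma untranspose_Unit_bij:
  assumes v: "v \<in> Obj V" and w: "w \<in> Obj V"
  shows "bij_betw (\<lambda>t. Ev V v w \<cdot> ((t \<boxtimes> Idn V v) \<cdot> linv v))
    (hom V (Unit V) (Ihom V v w)) (hom V v w)"
proof (rule bij_betw_byWitness[where f' = "\<lambda>f. transpose V (Unit V) v w (f \<cdot> Lunit V v)"])
  let ?I = "Unit V"
  have f: "f \<cdot> Lunit V v \<in> hom V (?I \<otimes> v) w" if "f \<in> hom V v w" for f
    using that v by (simp add: hom_iff)
  show "\<forall>t\<in>hom V ?I (Ihom V v w).
      transpose V ?I v w ((Ev V v w \<cdot> ((t \<boxtimes> Idn V v) \<cdot> linv v)) \<cdot> Lunit V v) = t"
    using v w by (intro ballI transpose_eqI) (auto simp: hom_iff)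
  show "\<forall>f\<in>hom V v w. Ev V v w \<cdot>
      ((transpose V ?I v w (f \<cdot> Lunit V v) \<boxtimes> Idn V v) \<cdot> linv v) = f"
  proof
    fix g assume g: "g \<in> hom V v w"
    note t = transpose[OF v w Unit_Obj f[OF g]]
    have "Ev V v w \<cdot> ((transpose V ?I v w (g \<cdot> Lunit V v) \<boxtimes> Idn V v) \<cdot> linv v) =
        (g \<cdot> Lunit V v) \<cdot> linv v"
      by (rule assoc_subst[OF t(2)]) (use t(1) v w in \<open>simp_all add: hom_iff\<close>)
    then show "Ev V v w \<cdot> ((transpose V ?I v w (g \<cdot> Lunit V v) \<boxtimes> Idn V v) \<cdot> linv v) = g"
      using g v by (simp add: hom_iff)
  qed
  show "(\<lambda>t. Ev V v w \<cdot> ((t \<boxtimes> Idn V v) \<cdot> linv v)) ` hom V ?I (Ihom V v w) \<subseteq> hom V v w"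
    using v w by (auto simp: hom_iff)
  show "(\<lambda>f. transpose V ?I v w (f \<cdot> Lunit V v)) ` hom V v w \<subseteq> hom V ?I (Ihom V v w)"
    using transpose(1)[OF v w Unit_Obj f] by blast
qed

end

context symmetric_monoidal_model_category
begin

lemma tensor_Ihom_adjunction:
  assumes Q: "cofibrant V M Q"
  shows "quillen_adjunction V M V M (\<lambda>v. v \<otimes> Q) (\<lambda>k. k \<boxtimes> Idn V Q) (Ihom V Q) (IhomA V (Idn V Q))
    (\<lambda>v y. transpose V v Q y)"
proof -
  note QO = cofibrant_Obj[OF Q]
  obtain e j where e: "initial V e" "j \<in> hom V e Q" "j \<in> cof M" using cofibrant_initial_cof[OF Q] by blast
  note pp = pushout_product_fixed_right[OF bifunctor_axioms category_axioms category_axioms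
      category_axioms pushout_product _ _ e(2,3)]
  show ?thesis
  proof
    fix k assume k: "k \<in> cof M"
    have O: "Dom V k \<in> Obj V" "Cod V k \<in> Obj V" using cof_in_Arr[OF k] by simp_all
    show "k \<boxtimes> Idn V Q \<in> cof M" "k \<in> weq M \<Longrightarrow> k \<boxtimes> Idn V Q \<in> weq M"
      using pp[OF arr_hom[OF cof_in_Arr[OF k]] k] initial_TenO_right[OF e(1)] O by blast+
  qed (use QO transpose_bij[OF QO] transpose_pre transpose_post IhomA(1)[OF Idn_hom[OF QO]]
      in \<open>simp_all add: bif_hom Idn_hom\<close>)
qed

text \<open>Call the map \<open>e : W \<rightarrow> \<V>(Q, W)\<close>. For \<open>u : a \<rightarrow> W\<close> the composite \<open>e u\<close> is the adjunct of \<open>u\<close> precomposed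
  with \<open>m a : a \<otimes> Q \<rightarrow> a\<close>, and the unit axiom makes \<open>m a\<close> a weak equivalence for cofibrant \<open>a\<close>. So \<open>e\<close>
  induces bijections on the maps from all cofibrant objects in the homotopy category.\<close>

lemma Ihom_cofibrant_replacement_weq:
  assumes q: "cofibrant_replacement V M (Unit V) Q q" and W: "fibrant V M W"
  shows "IhomA V q (Idn V W) \<cdot> Ihom_Unit_iso V W \<in> weq M"
proof -
  have Q: "cofibrant V M Q" "q \<in> hom V Q (Unit V)" using q by (simp_all add: cofibrant_replacement_def)
  note QO = cofibrant_Obj[OF Q(1)] and WO = fibrant_Obj[OF W]
  interpret A: quillen_adjunction V M V M "\<lambda>v. v \<otimes> Q" "\<lambda>k. k \<boxtimes> Idn V Q" "Ihom V Q" "IhomA V (Idn V Q)"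
    "\<lambda>v y. transpose V v Q y" by (rule tensor_Ihom_adjunction[OF Q(1)])
  let ?e = "IhomA V q (Idn V W) \<cdot> Ihom_Unit_iso V W" and ?I = "Unit V"
  \<comment> \<open>the map \<open>z \<otimes> Q \<rightarrow> z\<close> of the unit axiom\<close>
  define m where "m z = Runit V z \<cdot> (Idn V z \<boxtimes> q)" for z
  have m: "m z \<in> hom V (z \<otimes> Q) z" if "z \<in> Obj V" for z
    using that Q(2) by (simp add: m_def hom_iff)
  have mw: "m z \<in> weq M" if "cofibrant V M z" for z using unit_axiom[OF that q] by (simp add: m_def)
  note \<iota> = Ihom_Unit_iso[OF WO] and G = IhomA[OF Q(2) Idn_hom[OF WO]]
  have eh: "?e \<in> hom V W (Ihom V Q W)" using Cmp_hom[OF \<iota>(1) G(1)] .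
  have "Ev V Q W \<cdot> (?e \<boxtimes> Idn V Q) =
      Ev V Q W \<cdot> ((IhomA V q (Idn V W) \<boxtimes> Idn V Q) \<cdot> (Ihom_Unit_iso V W \<boxtimes> Idn V Q))"
    using \<iota>(1) G(1) QO by (simp add: hom_iff)
  also have "\<dots> = (Idn V W \<cdot> (Ev V ?I W \<cdot> (Idn V (Ihom V ?I W) \<boxtimes> q))) \<cdot> (Ihom_Unit_iso V W \<boxtimes> Idn V Q)"
    by (rule assoc_subst[OF G(2)]) (use \<iota>(1) G(1) QO WO in \<open>simp_all add: hom_iff\<close>)
  also have "\<dots> = Ev V ?I W \<cdot> ((Ihom_Unit_iso V W \<boxtimes> Idn V ?I) \<cdot> (Idn V W \<boxtimes> q))"
    using \<iota>(1) Q(2) WO QO by (simp add: hom_iff)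
  also have "\<dots> = m W" unfolding m_def
    by (rule assoc_subst[OF \<iota>(2)]) (use \<iota>(1) Q(2) WO in \<open>simp_all add: hom_iff\<close>)
  finally have e: "transpose V W Q W (m W) = ?e" by (rule transpose_eqI[OF QO WO eh])
  have eu: "?e \<cdot> u = transpose V a Q W (u \<cdot> m a)" if u: "u \<in> hom V a W" for a u
  proof -
    have aO: "a \<in> Obj V" using hom_Obj[OF u] by blast
    have "?e \<cdot> u = transpose V a Q W (m W \<cdot> (u \<boxtimes> Idn V Q))"
      using transpose_pre[OF u m[OF WO] QO] e by simp
    also have "m W \<cdot> (u \<boxtimes> Idn V Q) = (Runit V W \<cdot> (u \<boxtimes> Idn V ?I)) \<cdot> (Idn V a \<boxtimes> q)"
      using u Q(2) WO aO QO by (simp add: m_def hom_iff)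
    also have "\<dots> = u \<cdot> m a"
      unfolding Runit_natural[OF u] m_def using u Q(2) aO by (simp add: hom_iff)
    finally show ?thesis .
  qed
  show ?thesis
  proof (rule weq_if_post_bijective[OF eh W A.GO_fibrant[OF W]])
    fix a u u' assume a: "cofibrant V M a" and u: "u \<in> hom V a W" "u' \<in> hom V a W"
      and h: "ho_eq a (Ihom V Q W) (?e \<cdot> u) (?e \<cdot> u')"
    note ma = m[OF cofibrant_Obj[OF a]]
    have "ho_eq (a \<otimes> Q) W (u \<cdot> m a) (u' \<cdot> m a)"
      using h A.adj_ho_eq[OF a W Cmp_hom[OF ma u(1)] Cmp_hom[OF ma u(2)]]
      unfolding eu[OF u(1)] eu[OF u(2)] by blast
    then show "ho_eq a W u u'" by (rule ho_eq_pre_cancel[OF _ u ma mw[OF a]])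
  next
    fix a k assume a: "cofibrant V M a" and k: "k \<in> hom V a (Ihom V Q W)"
    note ma = m[OF cofibrant_Obj[OF a]]
    obtain h where h: "h \<in> hom V (a \<otimes> Q) W" "transpose V a Q W h = k" using A.adj_surj[OF WO k] by blast
    have "zigzag V (weq M) a [Bwd (m a), Fwd h] W"
      using zigzag_append[OF zigzag_Bwd[OF ma mw[OF a]] zigzag_Fwd[OF h(1)]] by auto
    then obtain u where u: "u \<in> hom V a W" "zz a W [Bwd (m a), Fwd h] [Fwd u]"
      using cofibrant_zigzag_representable[OF _ a W] by blast
    have "ho_eq (a \<otimes> Q) W (u \<cdot> m a) h" by (rule zz_Bwd_solve[OF ma mw[OF a] h(1) u])
    then have "ho_eq a (Ihom V Q W) (?e \<cdot> u) k"
      using A.adj_ho_eq[OF a W Cmp_hom[OF ma u(1)] h(1)]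
      unfolding eu[OF u(1)] h(2) by blast
    then show "\<exists>u\<in>hom V a W. ho_eq a (Ihom V Q W) (?e \<cdot> u) k" using u by blast
  qed
qed

end

context model_category
begin

lemma localization_eq_iff:
  assumes "f \<in> hom C x y" "g \<in> hom C x y"
  shows "localization C M f = localization C M g \<longleftrightarrow> ho_eq x y f g"
proof -
  have d: "Dom C f = x" "Cod C f = y" "Dom C g = x" "Cod C g = y" using assms by (simp_all add: hom_iff)
  show ?thesis unfolding localization_def d
    using ho_eq_refl[OF assms(2)] by (blast intro: zz_trans zz_sym)
qed

lemma localization_image_iff:
  assumes F: "F \<subseteq> hom C x y"
  shows "localization C M ` F = ho_hom C M x y \<longleftrightarrow>
    (\<forall>s. zigzag C (weq M) x s y \<longrightarrow> (\<exists>f \<in> F. zz x y s [Fwd f]))"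
proof -
  define cls where "cls s = {t. zz x y s t}" for s
  have ho: "ho_hom C M x y = {cls s | s. zigzag C (weq M) x s y}"
    unfolding ho_hom_def quotient_def cls_def by auto
  have cls_eq: "cls s = cls t \<longleftrightarrow> zz x y s t" if "zigzag C (weq M) x t y" for s t
    unfolding cls_def using zz_refl[OF that] by (blast intro: zz_trans zz_sym)
  have loc: "localization C M f = cls [Fwd f]" "zigzag C (weq M) x [Fwd f] y" if "f \<in> F" for f
    using subsetD[OF F that] zigzag_Fwd[of f x y] by (simp_all add: localization_def cls_def hom_iff)
  show ?thesis
  proof
    assume L: "localization C M ` F = ho_hom C M x y"
    show "\<forall>s. zigzag C (weq M) x s y \<longrightarrow> (\<exists>f \<in> F. zz x y s [Fwd f])"
    proof (intro allI impI)
      fix s assume "zigzag C (weq M) x s y"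
      then have "cls s \<in> localization C M ` F" unfolding L ho by blast
      then obtain f where "f \<in> F" "cls s = cls [Fwd f]" using loc(1) by auto
      then show "\<exists>f \<in> F. zz x y s [Fwd f]" using cls_eq[OF loc(2)] by blast
    qed
  next
    assume R: "\<forall>s. zigzag C (weq M) x s y \<longrightarrow> (\<exists>f \<in> F. zz x y s [Fwd f])"
    show "localization C M ` F = ho_hom C M x y"
    proof (intro equalityI subsetI)
      fix K assume "K \<in> localization C M ` F"
      then obtain f where "f \<in> F" "K = cls [Fwd f]" using loc(1) by blast
      then show "K \<in> ho_hom C M x y" unfolding ho using loc(2) by blast
    next
      fix K assume "K \<in> ho_hom C M x y"
      then obtain s where s: "K = cls s" "zigzag C (weq M) x s y" unfolding ho by blast
      then obtain f where f: "f \<in> F" "zz x y s [Fwd f]" using R by blast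
      then show "K \<in> localization C M ` F" using s(1) cls_eq[OF loc(2)[OF f(1)]] loc(1)[OF f(1)] by auto
    qed
  qed
qed

end

section \<open>Enriched model categories satisfying SM7\<close>

lemma is_pullbackI:
  assumes "category C" and f: "f \<in> hom C a d" and g: "g \<in> hom C b d" and p: "p \<in> hom C z a" and q: "q \<in> hom C z b"
    and "f \<cdot>\<^bsub>C\<^esub> p = g \<cdot>\<^bsub>C\<^esub> q"
    and "\<And>c u v. u \<in> hom C c a \<Longrightarrow> v \<in> hom C c b \<Longrightarrow> f \<cdot>\<^bsub>C\<^esub> u = g \<cdot>\<^bsub>C\<^esub> v \<Longrightarrow>
      \<exists>h. h \<in> hom C c z \<and> p \<cdot>\<^bsub>C\<^esub> h = u \<and> q \<cdot>\<^bsub>C\<^esub> h = v"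
    and "\<And>c h h'. h \<in> hom C c z \<Longrightarrow> h' \<in> hom C c z \<Longrightarrow> p \<cdot>\<^bsub>C\<^esub> h = p \<cdot>\<^bsub>C\<^esub> h' \<Longrightarrow> q \<cdot>\<^bsub>C\<^esub> h = q \<cdot>\<^bsub>C\<^esub> h' \<Longrightarrow> h = h'"
  shows "is_pullback C f g p q"
proof -
  have dc: "Dom C f = a" "Cod C f = d" "Dom C g = b" "Cod C g = d" "Dom C p = z" "Cod C p = a"
    "Dom C q = z" "Cod C q = b" and "f \<in> Arr C" "g \<in> Arr C" "p \<in> Arr C" "q \<in> Arr C"
    using f g p q by (simp_all add: hom_iff)
  moreover have "\<exists>!h. h \<in> hom C c z \<and> p \<cdot>\<^bsub>C\<^esub> h = u \<and> q \<cdot>\<^bsub>C\<^esub> h = v"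
    if uv: "u \<in> hom C c a" "v \<in> hom C c b" "f \<cdot>\<^bsub>C\<^esub> u = g \<cdot>\<^bsub>C\<^esub> v" for c u v
    using assms(7)[OF uv] assms(8) by metis
  ultimately show ?thesis unfolding is_pullback_def dc using assms(6) by blast
qed

locale SM7_category = closed_enriched_category V C + symmetric_monoidal_model_category V MV +
  U: enriched_model_category V C MC
  for V :: "('o, 'a, 'z) smcat_scheme" (structure) and MV :: "'a model_structure"
    and C :: "('c, 'o, 'a) ecat" and MC :: "('c, 'a) uarr model_structure" +
  assumes SM7: "SM7 V MV C MC"
begin

lemma SM7_corner:
  assumes "i \<in> hom C0 a b" "i \<in> cof MC" "p \<in> hom C0 x y" "p \<in> fib MC"
    and "is_pullback V (post V C a p) (pre V C i y) r s" "u \<in> hom V (Hob C b x) (Dom V r)"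
    and "r \<cdot> u = pre V C i x" "s \<cdot> u = post V C b p"
  shows "u \<in> fib MV" "i \<in> weq MC \<or> p \<in> weq MC \<Longrightarrow> u \<in> weq MV"
  using SM7 assms unfolding SM7_def by blast+

text \<open>SM7 for \<open>e \<rightarrow> x\<close> with \<open>e\<close> initial: as \<open>\<C>(e, y)\<close> and \<open>\<C>(e, z)\<close> are terminal, the pullback is
  \<open>\<C>(x, z)\<close> and the corner map is postcomposition with \<open>p\<close>.\<close>

lemma post_acyclic_fib_weq:
  assumes x: "cofibrant C0 MC x" and p: "p \<in> hom C0 y z" "p \<in> fib MC" "p \<in> weq MC"
  shows "post V C x p \<in> weq MV"
proof -
  obtain e i where e: "initial C0 e" and i: "i \<in> hom C0 e x" "i \<in> cof MC"
    using U.cofibrant_initial_cof[OF x] by blast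
  have O: "e \<in> Eob C" "x \<in> Eob C" "y \<in> Eob C" "z \<in> Eob C"
    using U.hom_Obj[OF i(1)] U.hom_Obj[OF p(1)] by simp_all
  note ty = U.enriched_initial[OF e O(3)] and tz = U.enriched_initial[OF e O(4)]
  obtain r where r: "r \<in> hom V (Hob C x z) (Hob C e y)" using terminal_arr[OF ty Hob_Obj[OF O(2,4)]] by blast
  note po = post_hom[OF p(1) O(1)] post_hom[OF p(1) O(2)]
    and pr = pre_hom[OF i(1) O(3)] pre_hom[OF i(1) O(4)]
  have I: "Idn V (Hob C x z) \<in> hom V (Hob C x z) (Hob C x z)" using O Idn_hom by simp
  have "is_pullback V (post V C e p) (pre V C i z) r (Idn V (Hob C x z))"
  proof (rule is_pullbackI[OF category_axioms po(1) pr(2) r I])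
    show "post V C e p \<cdot> r = pre V C i z \<cdot> Idn V (Hob C x z)"
      by (rule terminal_eq[OF tz Cmp_hom[OF r po(1)] Cmp_hom[OF I pr(2)]])
    fix c u v assume u: "u \<in> hom V c (Hob C e y)" and v: "v \<in> hom V c (Hob C x z)"
    show "\<exists>h. h \<in> hom V c (Hob C x z) \<and> r \<cdot> h = u \<and> Idn V (Hob C x z) \<cdot> h = v"
      using v terminal_eq[OF ty Cmp_hom[OF v r] u] Idn_Cmp by blast
  qed (use Idn_Cmp in metis)
  moreover have "post V C x p \<in> hom V (Hob C x y) (Dom V r)" using po(2) r by (simp add: hom_iff)
  moreover have "r \<cdot> post V C x p = pre V C i y" by (rule terminal_eq[OF ty Cmp_hom[OF po(2) r] pr(1)])
  moreover have "Idn V (Hob C x z) \<cdot> post V C x p = post V C x p" using Idn_Cmp[OF po(2)] .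
  ultimately show ?thesis using SM7_corner(2)[OF i p(1,2)] p(3) by blast
qed

text \<open>SM7 for \<open>e \<rightarrow> x\<close> and \<open>y \<rightarrow> d\<close> with \<open>e\<close> initial and \<open>d\<close> terminal: all corners of the pullback are
  terminal, so the corner map is the map from \<open>\<C>(x, y)\<close> to a terminal object.\<close>

lemma Hob_fibrant:
  assumes x: "cofibrant C0 MC x" and y: "fibrant C0 MC y"
  shows "fibrant V MV (Hob C x y)"
  unfolding fibrant_def
proof (intro conjI allI impI; (elim conjE)?)
  obtain e i where e: "initial C0 e" and i: "i \<in> hom C0 e x" "i \<in> cof MC"
    using U.cofibrant_initial_cof[OF x] by blast
  obtain d where d: "terminal C0 d" using U.ex_terminal by blast
  obtain p where p: "p \<in> hom C0 y d" using U.terminal_arr[OF d U.fibrant_Obj[OF y]] by blast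
  have pf: "p \<in> fib MC" using y d p unfolding fibrant_def by blast
  have O: "e \<in> Eob C" "x \<in> Eob C" "y \<in> Eob C" "d \<in> Eob C"
    using U.hom_Obj[OF i(1)] U.hom_Obj[OF p(1)] by simp_all
  show "Hob C x y \<in> Obj V" using O by simp
  note ty = U.enriched_initial[OF e O(3)] and td = U.enriched_initial[OF e O(4)]
    and tx = U.enriched_terminal[OF d O(2)]
  fix t f assume t: "terminal V t" and f: "f \<in> hom V (Hob C x y) t"
  have tO: "t \<in> Obj V" using hom_Obj f by blast
  obtain r where r: "r \<in> hom V t (Hob C e y)" using terminal_arr[OF ty tO] by blast
  obtain s where s: "s \<in> hom V t (Hob C x d)" using terminal_arr[OF tx tO] by blast
  note po = post_hom[OF p O(1)] post_hom[OF p O(2)]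
    and pr = pre_hom[OF i(1) O(3)] pre_hom[OF i(1) O(4)]
  have "is_pullback V (post V C e p) (pre V C i d) r s"
  proof (rule is_pullbackI[OF category_axioms po(1) pr(2) r s])
    show "post V C e p \<cdot> r = pre V C i d \<cdot> s"
      by (rule terminal_eq[OF td Cmp_hom[OF r po(1)] Cmp_hom[OF s pr(2)]])
    fix c u v assume u: "u \<in> hom V c (Hob C e y)" and v: "v \<in> hom V c (Hob C x d)"
    obtain h where h: "h \<in> hom V c t" using terminal_arr[OF t] hom_Obj[OF u] by blast
    show "\<exists>h. h \<in> hom V c t \<and> r \<cdot> h = u \<and> s \<cdot> h = v"
      using h terminal_eq[OF ty Cmp_hom[OF h r] u] terminal_eq[OF tx Cmp_hom[OF h s] v] by blast
  qed (use terminal_eq[OF t] in blast)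
  moreover have "f \<in> hom V (Hob C x y) (Dom V r)" using f r by (simp add: hom_iff)
  moreover have "r \<cdot> f = pre V C i y" by (rule terminal_eq[OF ty Cmp_hom[OF f r] pr(1)])
  moreover have "s \<cdot> f = post V C x p" by (rule terminal_eq[OF tx Cmp_hom[OF f s] po(2)])
  ultimately show "f \<in> fib MV" using SM7_corner(1)[OF i p pf] by blast
qed

lemma post_retraction:
  assumes "d \<in> hom C0 z y" "v \<in> hom C0 y z" "d \<cdot>\<^bsub>C0\<^esub> v = Idn C0 y" "x \<in> Eob C"
  shows "post V C x d \<cdot> post V C x v = Idn V (Hob C x y)"
proof -
  have "y \<in> Eob C" using U.hom_Obj[OF assms(1)] by simp
  then show ?thesis using post_Cmp[OF assms(2,1,4) U.Cmp_hom[OF assms(2,1)]] assms(3,4) post_Idn by simp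
qed

text \<open>The arrows factor through a path object of \<open>y\<close>, and by SM7 its endpoint maps are still weak
  equivalences after applying \<open>\<C>(x, -)\<close>.\<close>

lemma point_ho_eq:
  assumes x: "cofibrant C0 MC x" and y: "fibrant C0 MC y"
    and f: "f \<in> hom C0 x y" "g \<in> hom C0 x y" and e: "U.ho_eq x y f g"
  shows "ho_eq (Unit V) (Hob C x y) (point f) (point g)"
proof -
  obtain P d0 d1 w where P: "path_object C0 MC y P d0 d1 w" using U.path_object_ex[OF U.fibrant_Obj[OF y]] by blast
  obtain K where K: "K \<in> hom C0 x P" "d0 \<cdot>\<^bsub>C0\<^esub> K = f" "d1 \<cdot>\<^bsub>C0\<^esub> K = g"
    using U.ho_eq_path_homotopy[OF e f x y P] by blast
  note D = U.path_objectD[OF P]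
  have O: "x \<in> Eob C" "y \<in> Eob C" using U.hom_Obj[OF f(1)] by simp_all
  note G = post_hom[OF D(1) O(1)] post_hom[OF D(2) O(1)] post_hom[OF D(3) O(1)]
  have eq: "post V C x d0 \<cdot> post V C x w = Idn V (Hob C x y)" "post V C x d1 \<cdot> post V C x w = Idn V (Hob C x y)"
    using post_retraction[OF D(1,3,5) O(1)] post_retraction[OF D(2,3,6) O(1)] by blast+
  have "post V C x w \<in> weq MV"
    using weq_cancel_left[OF G(3,1) post_acyclic_fib_weq[OF x D(1) U.path_object_acyclic[OF y P]]]
      eq Idn_weq O by simp
  from ho_eq_path[OF G(3) this G(1,2) _ point_hom[OF K(1)]]
  show ?thesis using eq point_Cmp_post[OF K(1) D(1)] point_Cmp_post[OF K(1) D(2)] K by simp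
qed

text \<open>Every homotopy class is the class of an arrow, and both maps defined on classes by \<open>the_elem\<close> are
  constant on it; injectivity on classes makes \<open>inv_into\<close> return the class of \<open>f\<close>.\<close>

lemma canonical_map_localization:
  assumes x: "cofibrant C0 MC x" and y: "fibrant C0 MC y" and f: "f \<in> hom C0 x y"
  shows "canonical_map V MV C MC x y (localization C0 MC f) = localization V MV (point f)"
proof -
  let ?R = "homotopy_rel C0 MC x y"
  have cls: "?R `` {g} = {h \<in> hom C0 x y. U.ho_eq x y g h}" if "g \<in> hom C0 x y" for g
    using that by (auto simp: U.homotopy_rel_iff_ho_eq[OF x y])
  have img: "F ` (?R `` {g}) = {F g}"
    if g: "g \<in> hom C0 x y" and F: "\<And>h. h \<in> hom C0 x y \<Longrightarrow> U.ho_eq x y g h \<Longrightarrow> F h = F g"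
    for g and F :: "('c, 'a) uarr \<Rightarrow> 'b step list set"
    unfolding cls[OF g] using F g U.ho_eq_refl[OF g] by blast
  have to_ho: "class_to_ho C0 MC (?R `` {g}) = localization C0 MC g" if g: "g \<in> hom C0 x y" for g
  proof -
    have "localization C0 MC ` (?R `` {g}) = {localization C0 MC g}"
      using U.localization_eq_iff[OF g] by (intro img[OF g]) blast
    then show ?thesis unfolding class_to_ho_def by simp
  qed
  have to_Hob: "class_to_ho_Hob V MV (?R `` {f}) = localization V MV (point f)"
  proof -
    have "(\<lambda>f. localization V MV (point f)) ` (?R `` {f}) = {localization V MV (point f)}"
    proof (rule img[OF f])
      fix h assume h: "h \<in> hom C0 x y" and e: "U.ho_eq x y f h"
      show "localization V MV (point h) = localization V MV (point f)"
        using localization_eq_iff[OF point_hom[OF f] point_hom[OF h]] point_ho_eq[OF x y f h e] by simp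
    qed
    then show ?thesis unfolding class_to_ho_Hob_def by simp
  qed
  have "inj_on (class_to_ho C0 MC) (hom C0 x y // ?R)"
  proof (rule inj_onI)
    fix K L assume "K \<in> hom C0 x y // ?R" "L \<in> hom C0 x y // ?R"
      and eq: "class_to_ho C0 MC K = class_to_ho C0 MC L"
    then obtain g h where g: "g \<in> hom C0 x y" "K = ?R `` {g}" and h: "h \<in> hom C0 x y" "L = ?R `` {h}"
      unfolding quotient_def by blast
    have "U.ho_eq x y g h" using eq to_ho g h U.localization_eq_iff by simp
    then show "K = L" unfolding g(2) h(2) cls[OF g(1)] cls[OF h(1)]
      by (blast intro: zz_trans zz_sym)
  qed
  moreover have "?R `` {f} \<in> hom C0 x y // ?R" using f unfolding quotient_def by blast
  ultimately have "inv_into (hom C0 x y // ?R) (class_to_ho C0 MC) (localization C0 MC f) = ?R `` {f}"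
    using to_ho[OF f] inv_into_f_f by metis
  then show ?thesis unfolding canonical_map_def using to_Hob by simp
qed

end

context SM7_category
begin

lemma pi0_of_mapping_space_iff:
  "pi0_of_mapping_space V MV C MC \<longleftrightarrow>
    (\<forall>x y. cofibrant C0 MC x \<and> fibrant C0 MC y \<longrightarrow>
      (\<forall>f \<in> hom C0 x y. \<forall>g \<in> hom C0 x y.
        ho_eq (Unit V) (Hob C x y) (point f) (point g) \<longrightarrow> U.ho_eq x y f g) \<and>
      (\<forall>s. zigzag V (weq MV) (Unit V) s (Hob C x y) \<longrightarrow>
        (\<exists>f \<in> hom C0 x y. zz (Unit V) (Hob C x y) s [Fwd (point f)])))"
  (is "_ \<longleftrightarrow> (\<forall>x y. _ \<longrightarrow> ?inj x y \<and> ?surj x y)")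
proof -
  have "bij_betw (canonical_map V MV C MC x y) (ho_hom C0 MC x y) (ho_hom V MV (Unit V) (Hob C x y)) \<longleftrightarrow>
      ?inj x y \<and> ?surj x y"
    if x: "cofibrant C0 MC x" and y: "fibrant C0 MC y" for x y
  proof -
    note can = canonical_map_localization[OF x y]
    have ho: "ho_hom C0 MC x y = localization C0 MC ` hom C0 x y"
      using U.localization_image_iff[OF subset_refl] U.cofibrant_zigzag_representable[OF _ x y] by metis
    have "inj_on (canonical_map V MV C MC x y) (ho_hom C0 MC x y) \<longleftrightarrow> ?inj x y"
      unfolding ho inj_on_def ball_simps
      by (simp add: can U.localization_eq_iff localization_eq_iff[OF point_hom point_hom])
    moreover have "canonical_map V MV C MC x y ` ho_hom C0 MC x y = localization V MV ` (point ` hom C0 x y)"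
      unfolding ho image_image using can by (intro image_cong) simp_all
    moreover have "localization V MV ` (point ` hom C0 x y) = ho_hom V MV (Unit V) (Hob C x y) \<longleftrightarrow> ?surj x y"
      using localization_image_iff[of "point ` hom C0 x y" "Unit V" "Hob C x y"]
      by (simp add: image_subset_iff point_hom)
    ultimately show ?thesis unfolding bij_betw_def by simp
  qed
  then show ?thesis unfolding pi0_of_mapping_space_def by blast
qed

text \<open>As a weak equivalence, restriction along \<open>f\<close> is invertible on zigzags out of the unit. By the \<open>\<pi>\<^sub>0\<close>
  condition the zigzags \<open>1 \<rightarrow> \<C>(y, z)\<close> amount to the maps \<open>y \<rightarrow> z\<close> in the homotopy category, so
  \<open>weq_if_pre_bijective\<close> applies.\<close>

theorem pi0_imp_detection:
  assumes "pi0_of_mapping_space V MV C MC"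
  shows "detection_property V MV C MC"
  unfolding detection_property_def
proof (intro allI impI, elim conjE)
  fix x y f assume x: "cofibrant C0 MC x" and y: "cofibrant C0 MC y" and f: "f \<in> hom C0 x y"
    and w: "\<forall>z. fibrant C0 MC z \<longrightarrow> pre V C f z \<in> weq MV"
  have inj: "U.ho_eq a z g h"
    if "cofibrant C0 MC a" "fibrant C0 MC z" "g \<in> hom C0 a z" "h \<in> hom C0 a z"
      "ho_eq (Unit V) (Hob C a z) (point g) (point h)" for a z g h
    using assms that unfolding pi0_of_mapping_space_iff by blast
  have surj: "\<exists>g \<in> hom C0 a z. zz (Unit V) (Hob C a z) s [Fwd (point g)]"
    if "cofibrant C0 MC a" "fibrant C0 MC z" "zigzag V (weq MV) (Unit V) s (Hob C a z)" for a z s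
    using assms that unfolding pi0_of_mapping_space_iff by blast
  show "f \<in> weq MC"
  proof (rule U.weq_if_pre_bijective[OF f x y])
    fix z u u' assume z: "fibrant C0 MC z" and u: "u \<in> hom C0 y z" "u' \<in> hom C0 y z"
      and e: "U.ho_eq x z (u \<cdot>\<^bsub>C0\<^esub> f) (u' \<cdot>\<^bsub>C0\<^esub> f)"
    have zO: "z \<in> Eob C" using U.fibrant_Obj[OF z] by simp
    have "ho_eq (Unit V) (Hob C x z) (pre V C f z \<cdot> point u) (pre V C f z \<cdot> point u')"
      using point_ho_eq[OF x z U.Cmp_hom[OF f u(1)] U.Cmp_hom[OF f u(2)] e]
      unfolding point_Cmp_pre[OF f u(1)] point_Cmp_pre[OF f u(2)] .
    then have "ho_eq (Unit V) (Hob C y z) (point u) (point u')"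
      using ho_eq_post_cancel[OF _ point_hom[OF u(1)] point_hom[OF u(2)] pre_hom[OF f zO]] w z by blast
    then show "U.ho_eq y z u u'" by (rule inj[OF y z u])
  next
    fix z k assume z: "fibrant C0 MC z" and k: "k \<in> hom C0 x z"
    have zO: "z \<in> Eob C" using U.fibrant_Obj[OF z] by simp
    note P = pre_hom[OF f zO]
    have Pw: "pre V C f z \<in> weq MV" using w z by blast
    have zs: "zigzag V (weq MV) (Unit V) ([Fwd (point k)] @ [Bwd (pre V C f z)]) (Hob C y z)"
      by (rule zigzag_append[OF zigzag_Fwd[OF point_hom[OF k]] zigzag_Bwd[OF P Pw]])
    obtain u where u: "u \<in> hom C0 y z"
      "zz (Unit V) (Hob C y z) ([Fwd (point k)] @ [Bwd (pre V C f z)]) [Fwd (point u)]"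
      using surj[OF y z zs] by blast
    have 1: "zz (Unit V) (Hob C x z) (([Fwd (point k)] @ [Bwd (pre V C f z)]) @ [Fwd (pre V C f z)])
        ([Fwd (point u)] @ [Fwd (pre V C f z)])"
      by (rule zz_append_left[OF u(2) zigzag_Fwd[OF P]])
    have 2: "zz (Unit V) (Hob C x z) ([Fwd (point k)] @ [Bwd (pre V C f z), Fwd (pre V C f z)]) [Fwd (point k)]"
      by (rule zz_cancel_suffix[OF zz_Bwd_Fwd[OF Pw P] zigzag_Fwd[OF point_hom[OF k]]])
    have "zz (Unit V) (Hob C x z) [Fwd (point u), Fwd (pre V C f z)] [Fwd (point k)]"
      using zz_trans[OF zz_sym[OF 1]] 2 by simp
    then have "ho_eq (Unit V) (Hob C x z) (point (u \<cdot>\<^bsub>C0\<^esub> f)) (point k)"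
      unfolding point_Cmp_pre[OF f u(1)] by (rule zz_trans[OF zz_Cmp'[OF point_hom[OF u(1)] P]])
    then show "\<exists>u\<in>hom C0 y z. U.ho_eq x z (u \<cdot>\<^bsub>C0\<^esub> f) k"
      using inj[OF x z U.Cmp_hom[OF f u(1)] k] u(1) by blast
  qed
qed

end

section \<open>Weak tensorings\<close>

locale weakly_tensored = SM7_category V MV C MC + T: weak_tensoring V MV C MC T
  for V :: "('o, 'a, 'z) smcat_scheme" (structure) and MV :: "'a model_structure"
    and C :: "('c, 'o, 'a) ecat" and MC :: "('c, 'a) uarr model_structure"
    and T :: "('c, 'o, 'a) wtens"
begin

lemma WA_cof:
  assumes x: "cofibrant C0 MC x" and k: "k \<in> cof MV"
  shows "WA T (Idn C0 x) k \<in> cof MC" "k \<in> weq MV \<Longrightarrow> WA T (Idn C0 x) k \<in> weq MC"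
proof -
  obtain e i where e: "initial C0 e" and i: "i \<in> hom C0 e x" "i \<in> cof MC"
    using U.cofibrant_initial_cof[OF x] by blast
  have kh: "k \<in> hom V (Dom V k) (Cod V k)" "Dom V k \<in> Obj V" "Cod V k \<in> Obj V"
    using cof_in_Arr[OF k] by (simp_all add: hom_iff)
  note pp = pushout_product_fixed_left[OF T.bifunctor_axioms U.category_axioms category_axioms
      U.category_axioms T.external_pushout_product i kh(1) k T.WO_initial_left[OF e kh(2)]
      T.WO_initial_left[OF e kh(3)]]
  show "WA T (Idn C0 x) k \<in> cof MC" "k \<in> weq MV \<Longrightarrow> WA T (Idn C0 x) k \<in> weq MC"
    using pp by blast+
qed

lemma WO_cofibrant:
  assumes x: "cofibrant C0 MC x" and v: "cofibrant V MV v"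
  shows "cofibrant C0 MC (WO T x v)"
proof -
  obtain e j where e: "initial V e" and j: "j \<in> hom V e v" "j \<in> cof MV"
    using cofibrant_initial_cof[OF v] by blast
  have xO: "x \<in> Eob C" using U.cofibrant_Obj[OF x] by simp
  note I = T.WO_initial_right[OF xO e]
  have w: "WA T (Idn C0 x) j \<in> hom C0 (WO T x e) (WO T x v)"
    using T.bif_hom[OF U.Idn_hom j(1)] xO by simp
  have "cofibrant C0 MC (WO T x e)"
  proof (rule U.cofibrantI)
    show "WO T x e \<in> Obj C0" using I by (simp add: initial_def)
    fix p a b f assume p: "p \<in> hom C0 a b" and f: "f \<in> hom C0 (WO T x e) b"
    obtain u where u: "u \<in> hom C0 (WO T x e) a" using U.initial_arr[OF I] U.hom_Obj[OF p] by blast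
    show "\<exists>u. u \<in> hom C0 (WO T x e) a \<and> p \<cdot>\<^bsub>C0\<^esub> u = f"
      using u U.initial_eq[OF I U.Cmp_hom[OF u p] f] by blast
  qed
  then show ?thesis by (rule U.cof_from_cofibrant[OF _ w WA_cof(1)[OF x j(2)]])
qed

lemma HobA_pre: "f \<in> hom C0 x' x \<Longrightarrow> y \<in> Eob C \<Longrightarrow> HobA V C f (Idn C0 y) = pre V C f y"
  unfolding HobA_def
  using U.hom_Obj[of f x' x] pre_hom[of f x' x y] post_Idn[of x' y]
  by (simp add: hom_iff U.Idn_simps)

lemma HobA_post: "x \<in> Eob C \<Longrightarrow> g \<in> hom C0 y y' \<Longrightarrow> HobA V C (Idn C0 x) g = post V C x g"
  unfolding HobA_def
  using U.hom_Obj[of g y y'] post_hom[of g y y' x] pre_Idn[of x y]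
  by (simp add: hom_iff U.Idn_simps)

lemma Phi_pre:
  assumes h: "h \<in> hom V v' v" and x: "x \<in> Eob C" and y: "y \<in> Eob C"
  shows "Phi T v' x y \<cdot> pre V C (WA T (Idn C0 x) h) y = IhomA V h (Idn V (Hob C x y)) \<cdot> Phi T v x y"
proof -
  have "WA T (Idn C0 x) h \<in> hom C0 (WO T x v') (WO T x v)" using T.bif_hom[OF U.Idn_hom h] x by simp
  then show ?thesis
    using T.Phi_natural[OF h U.Idn_hom U.Idn_hom, of x y] x y
    by (simp add: HobA_pre HobA_pre[OF U.Idn_hom] pre_Idn)
qed

lemma Phi_post:
  assumes v: "v \<in> Obj V" and x: "x \<in> Eob C" and p: "p \<in> hom C0 y y'"
  shows "Phi T v x y' \<cdot> post V C (WO T x v) p = IhomA V (Idn V v) (post V C x p) \<cdot> Phi T v x y"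
proof -
  have "WO T x v \<in> Eob C" using T.bif_Obj[of x v] x v by simp
  then show ?thesis
    using T.Phi_natural[OF Idn_hom[OF v] U.Idn_hom p, of x] x v
    by (simp add: HobA_post[OF _ p] T.bif_Idn)
qed

text \<open>Naturality of \<open>\<phi>\<close> in \<open>q\<close>, combined with the compatibility of \<open>\<phi>\<close> and \<open>\<rho>\<close>, identifies \<open>\<phi>\<close> after restriction
  with a map that depends on \<open>\<V>\<close> alone.\<close>

lemma external_unit_pre:
  assumes q: "q \<in> hom V Q (Unit V)" and x: "x \<in> Eob C" and z: "z \<in> Eob C"
  shows "Phi T Q x z \<cdot> pre V C (Rho T x \<cdot>\<^bsub>C0\<^esub> WA T (Idn C0 x) q) z =
    IhomA V q (Idn V (Hob C x z)) \<cdot> Ihom_Unit_iso V (Hob C x z)"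
proof -
  have QO: "Q \<in> Obj V" using hom_Obj[OF q] by blast
  have W: "WA T (Idn C0 x) q \<in> hom C0 (WO T x Q) (WO T x (Unit V))"
    using T.bif_hom[OF U.Idn_hom q] x by simp
  note R = T.Rho_hom[OF x]
  note PR = pre_hom[OF R z] and PW = pre_hom[OF W z] and P = T.Phi_hom[OF QO x z]
    T.Phi_hom[OF Unit_Obj x z] and I = IhomA(1)[OF q Idn_hom[OF Hob_Obj[OF x z]]]
  have "Phi T Q x z \<cdot> pre V C (Rho T x \<cdot>\<^bsub>C0\<^esub> WA T (Idn C0 x) q) z =
      (Phi T Q x z \<cdot> pre V C (WA T (Idn C0 x) q) z) \<cdot> pre V C (Rho T x) z"
    unfolding pre_Cmp[OF W R z U.Cmp_hom[OF W R]] by (rule Cmp_assoc[OF PR PW P(1), symmetric])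
  also have "\<dots> = IhomA V q (Idn V (Hob C x z)) \<cdot> (Phi T (Unit V) x z \<cdot> pre V C (Rho T x) z)"
    unfolding Phi_pre[OF q x z] by (rule Cmp_assoc[OF PR P(2) I])
  finally show ?thesis unfolding T.Phi_Rho[OF x z] .
qed

theorem detection_imp_external_unit:
  assumes D: "detection_property V MV C MC"
  shows "external_unit_axiom V MV C MC T"
  unfolding external_unit_axiom_def
proof (intro allI impI, elim conjE)
  fix Q q x assume q: "cofibrant_replacement V MV (Unit V) Q q" and x: "cofibrant C0 MC x"
  let ?f = "Rho T x \<cdot>\<^bsub>C0\<^esub> WA T (Idn C0 x) q"
  have Q: "cofibrant V MV Q" "q \<in> hom V Q (Unit V)" using q by (simp_all add: cofibrant_replacement_def)
  have xO: "x \<in> Eob C" using U.cofibrant_Obj[OF x] by simp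
  have f: "?f \<in> hom C0 (WO T x Q) x"
    using U.Cmp_hom[OF T.bif_hom[OF U.Idn_hom Q(2)] T.Rho_hom] xO by simp
  have "pre V C ?f z \<in> weq MV" if z: "fibrant C0 MC z" for z
  proof -
    have zO: "z \<in> Eob C" using U.fibrant_Obj[OF z] by simp
    have "Phi T Q x z \<cdot> pre V C ?f z \<in> weq MV"
      unfolding external_unit_pre[OF Q(2) xO zO]
      by (rule Ihom_cofibrant_replacement_weq[OF q Hob_fibrant[OF x z]])
    then show ?thesis
      using weq_cancel_left[OF pre_hom[OF f zO] T.Phi_hom[OF cofibrant_Obj[OF Q(1)] xO zO]
          T.Phi_weq[OF Q(1) x z]] by blast
  qed
  then show "?f \<in> weq MC" using D WO_cofibrant[OF x Q(1)] x f unfolding detection_property_def by blast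
qed

text \<open>The adjunct of \<open>h : x \<otimes> v \<rightarrow> y\<close>: \<open>\<phi>\<close> takes the point of \<open>h\<close> to a point of \<open>\<V>(v, \<C>(x, y))\<close>, which is an
  arrow \<open>v \<rightarrow> \<C>(x, y)\<close>.\<close>

definition adj :: "'c \<Rightarrow> 'o \<Rightarrow> 'c \<Rightarrow> ('c, 'a) uarr \<Rightarrow> 'a" where
  "adj x v y h = Ev V v (Hob C x y) \<cdot>
     (((Phi T v x y \<cdot> point h) \<boxtimes> Idn V v) \<cdot> linv v)"

lemma adj_pre:
  assumes k: "k \<in> hom V v' v" and x: "x \<in> Eob C" and h: "h \<in> hom C0 (WO T x v) y"
  shows "adj x v' y (h \<cdot>\<^bsub>C0\<^esub> WA T (Idn C0 x) k) = adj x v y h \<cdot> k"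
proof -
  have O: "v \<in> Obj V" "v' \<in> Obj V" "y \<in> Eob C" using hom_Obj[OF k] U.hom_Obj[OF h] by simp_all
  have W: "WA T (Idn C0 x) k \<in> hom C0 (WO T x v') (WO T x v)" using T.bif_hom[OF U.Idn_hom k] x by simp
  let ?w = "Hob C x y" and ?t = "Phi T v x y \<cdot> point h" and ?l = "\<lambda>v. linv v"
  have wO: "?w \<in> Obj V" using x O by simp
  note P = T.Phi_hom[OF O(1) x O(3)] T.Phi_hom[OF O(2) x O(3)] and G = IhomA[OF k Idn_hom[OF wO]]
  have t: "?t \<in> hom V (Unit V) (Ihom V v ?w)" using Cmp_hom[OF point_hom[OF h] P(1)] .
  have "Phi T v' x y \<cdot> point (h \<cdot>\<^bsub>C0\<^esub> WA T (Idn C0 x) k) =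
      (Phi T v' x y \<cdot> pre V C (WA T (Idn C0 x) k) y) \<cdot> point h"
    unfolding point_Cmp_pre[OF W h] by (rule Cmp_assoc[OF point_hom[OF h] pre_hom[OF W O(3)] P(2), symmetric])
  also have "\<dots> = IhomA V k (Idn V ?w) \<cdot> ?t"
    unfolding Phi_pre[OF k x O(3)] by (rule Cmp_assoc[OF point_hom[OF h] P(1) G(1)])
  finally have e: "Phi T v' x y \<cdot> point (h \<cdot>\<^bsub>C0\<^esub> WA T (Idn C0 x) k) = IhomA V k (Idn V ?w) \<cdot> ?t" .
  have "adj x v' y (h \<cdot>\<^bsub>C0\<^esub> WA T (Idn C0 x) k) =
      Ev V v' ?w \<cdot> ((IhomA V k (Idn V ?w) \<boxtimes> Idn V v') \<cdot> ((?t \<boxtimes> Idn V v') \<cdot> ?l v'))"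
    unfolding adj_def e using t G(1) O wO by (simp add: hom_iff)
  also have "\<dots> = (Idn V ?w \<cdot> (Ev V v ?w \<cdot> (Idn V (Ihom V v ?w) \<boxtimes> k))) \<cdot> ((?t \<boxtimes> Idn V v') \<cdot> ?l v')"
    by (rule assoc_subst[OF G(2)]) (use t G(1) O wO in \<open>simp_all add: hom_iff\<close>)
  also have "\<dots> = Ev V v ?w \<cdot> ((?t \<boxtimes> Idn V v) \<cdot> ((Idn V (Unit V) \<boxtimes> k) \<cdot> ?l v'))"
    using t k O wO by (simp add: hom_iff)
  also have "(Idn V (Unit V) \<boxtimes> k) \<cdot> ?l v' = ?l v \<cdot> k"
    using Linv_natural[of k] k by (simp add: hom_iff)
  also have "Ev V v ?w \<cdot> ((?t \<boxtimes> Idn V v) \<cdot> (?l v \<cdot> k)) = adj x v y h \<cdot> k"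
    unfolding adj_def using t k O wO by (simp add: hom_iff)
  finally show ?thesis .
qed

lemma adj_post:
  assumes v: "v \<in> Obj V" and x: "x \<in> Eob C" and h: "h \<in> hom C0 (WO T x v) y" and p: "p \<in> hom C0 y y'"
  shows "adj x v y' (p \<cdot>\<^bsub>C0\<^esub> h) = post V C x p \<cdot> adj x v y h"
proof -
  have O: "y \<in> Eob C" "y' \<in> Eob C" "WO T x v \<in> Eob C"
    using U.hom_Obj[OF p] U.hom_Obj[OF h] by simp_all
  let ?w = "Hob C x y" and ?w' = "Hob C x y'" and ?t = "Phi T v x y \<cdot> point h"
    and ?l = "linv v" and ?p = "post V C x p"
  have wO: "?w \<in> Obj V" "?w' \<in> Obj V" using x O by simp_all
  note P = T.Phi_hom[OF v x O(1)] T.Phi_hom[OF v x O(2)] and ph = post_hom[OF p x]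
  note G = IhomA[OF Idn_hom[OF v] ph]
  have t: "?t \<in> hom V (Unit V) (Ihom V v ?w)" using Cmp_hom[OF point_hom[OF h] P(1)] .
  have "Phi T v x y' \<cdot> point (p \<cdot>\<^bsub>C0\<^esub> h) = (Phi T v x y' \<cdot> post V C (WO T x v) p) \<cdot> point h"
    unfolding point_Cmp_post[OF h p] by (rule Cmp_assoc[OF point_hom[OF h] post_hom[OF p O(3)] P(2), symmetric])
  also have "\<dots> = IhomA V (Idn V v) ?p \<cdot> ?t"
    unfolding Phi_post[OF v x p] by (rule Cmp_assoc[OF point_hom[OF h] P(1) G(1)])
  finally have e: "Phi T v x y' \<cdot> point (p \<cdot>\<^bsub>C0\<^esub> h) = IhomA V (Idn V v) ?p \<cdot> ?t" .
  have "adj x v y' (p \<cdot>\<^bsub>C0\<^esub> h) =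
      Ev V v ?w' \<cdot> ((IhomA V (Idn V v) ?p \<boxtimes> Idn V v) \<cdot> ((?t \<boxtimes> Idn V v) \<cdot> ?l))"
    unfolding adj_def e using t G(1) v wO by (simp add: hom_iff)
  also have "\<dots> = (?p \<cdot> (Ev V v ?w \<cdot> (Idn V (Ihom V v ?w) \<boxtimes> Idn V v))) \<cdot> ((?t \<boxtimes> Idn V v) \<cdot> ?l)"
    by (rule assoc_subst[OF G(2)]) (use t G(1) v wO in \<open>simp_all add: hom_iff\<close>)
  also have "\<dots> = ?p \<cdot> adj x v y h"
    unfolding adj_def using t v wO ph by (simp add: hom_iff)
  finally show ?thesis .
qed

text \<open>This is what makes the chain of bijections through \<open>[x \<otimes> Q, y]\<close> agree with the canonical map.\<close>

lemma adj_unit: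
  assumes q: "q \<in> hom V Q (Unit V)" and x: "x \<in> Eob C" and g: "g \<in> hom C0 x y"
  shows "adj x Q y (g \<cdot>\<^bsub>C0\<^esub> (Rho T x \<cdot>\<^bsub>C0\<^esub> WA T (Idn C0 x) q)) = point g \<cdot> q"
proof -
  have W: "WA T (Idn C0 x) q \<in> hom C0 (WO T x Q) (WO T x (Unit V))"
    using T.bif_hom[OF U.Idn_hom q] x by simp
  have y: "y \<in> Eob C" using U.hom_Obj[OF g] by simp
  let ?w = "Hob C x y" and ?I = "Unit V" and ?g = "point g"
  note R = T.Rho_hom[OF x] and gh = point_hom[OF g] and P = T.Phi_hom[OF Unit_Obj x y]
  have wO: "?w \<in> Obj V" using x y by simp
  note \<iota> = Ihom_Unit_iso[OF wO]
  have e: "Phi T ?I x y \<cdot> point (g \<cdot>\<^bsub>C0\<^esub> Rho T x) = Ihom_Unit_iso V ?w \<cdot> ?g"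
    unfolding point_Cmp_pre[OF R g] Cmp_assoc[OF gh pre_hom[OF R y] P, symmetric] T.Phi_Rho[OF x y] ..
  have "adj x ?I y (g \<cdot>\<^bsub>C0\<^esub> Rho T x) = Ev V ?I ?w \<cdot>
      ((Ihom_Unit_iso V ?w \<boxtimes> Idn V ?I) \<cdot> ((?g \<boxtimes> Idn V ?I) \<cdot> linv ?I))"
    unfolding adj_def e using \<iota>(1) gh wO by (simp add: hom_iff)
  also have "\<dots> = Runit V ?w \<cdot> ((?g \<boxtimes> Idn V ?I) \<cdot> linv ?I)"
    by (rule assoc_subst[OF \<iota>(2)]) (use \<iota>(1) gh wO in \<open>simp_all add: hom_iff\<close>)
  also have "\<dots> = (?g \<cdot> Runit V ?I) \<cdot> linv ?I"
    by (rule assoc_subst[OF Runit_natural[OF gh]]) (use gh wO in \<open>simp_all add: hom_iff\<close>)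
  also have "\<dots> = ?g" using gh by (simp add: hom_iff flip: Lunit_Unit)
  finally have 1: "adj x ?I y (g \<cdot>\<^bsub>C0\<^esub> Rho T x) = ?g" .
  have "g \<cdot>\<^bsub>C0\<^esub> (Rho T x \<cdot>\<^bsub>C0\<^esub> WA T (Idn C0 x) q) = (g \<cdot>\<^bsub>C0\<^esub> Rho T x) \<cdot>\<^bsub>C0\<^esub> WA T (Idn C0 x) q"
    by (rule U.Cmp_assoc[OF W R g, symmetric])
  then show ?thesis using adj_pre[OF q x U.Cmp_hom[OF R g]] 1 by simp
qed

lemma adj_bij:
  assumes sc: "set_compatible V C T" and v: "v \<in> Obj V" and x: "x \<in> Eob C" and y: "y \<in> Eob C"
  shows "bij_betw (adj x v y) (hom C0 (WO T x v) y) (hom V v (Hob C x y))"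
proof -
  have xv: "WO T x v \<in> Eob C" using T.bif_Obj[of x v] x v by simp
  have "bij_betw point (hom C0 (WO T x v) y) (hom V (Unit V) (Hob C (WO T x v) y))"
    by (rule bij_betw_byWitness[where f' = "\<lambda>u. (WO T x v, y, u)"])
      (use xv y hom_of_point underlying_homE point_hom in \<open>auto simp: underlying_hom point_def\<close>)
  moreover have "bij_betw (\<lambda>u. Phi T v x y \<cdot> u)
      (hom V (Unit V) (Hob C (WO T x v) y)) (hom V (Unit V) (Ihom V v (Hob C x y)))"
    using sc v x y unfolding set_compatible_def by blast
  ultimately have "bij_betw ((\<lambda>t. Ev V v (Hob C x y) \<cdot> ((t \<boxtimes> Idn V v) \<cdot> linv v)) \<circ>
      ((\<lambda>u. Phi T v x y \<cdot> u) \<circ> point)) (hom C0 (WO T x v) y) (hom V v (Hob C x y))"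
    using untranspose_Unit_bij[OF v Hob_Obj[OF x y]] bij_betw_trans by blast
  then show ?thesis unfolding adj_def comp_def .
qed

lemma weak_tensor_Hob_adjunction:
  assumes sc: "set_compatible V C T" and x: "cofibrant C0 MC x"
  shows "quillen_adjunction V MV C0 MC (WO T x) (WA T (Idn C0 x)) (Hob C x) (post V C x) (adj x)"
proof -
  have xO: "x \<in> Eob C" using U.cofibrant_Obj[OF x] by simp
  show ?thesis
  proof
    fix v assume v: "v \<in> Obj V"
    show "WO T x v \<in> Obj C0" using T.bif_Obj[of x v] xO v by simp
    fix y assume "y \<in> Obj C0"
    then show "bij_betw (adj x v y) (hom C0 (WO T x v) y) (hom V v (Hob C x y))"
      using adj_bij[OF sc v xO] by simp
  next
    fix k v v' assume "k \<in> hom V v v'"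
    then show "WA T (Idn C0 x) k \<in> hom C0 (WO T x v) (WO T x v')"
      using T.bif_hom[OF U.Idn_hom] xO by simp
  qed (use xO post_hom adj_pre adj_post WA_cof[OF x] in simp_all)
qed

text \<open>Precomposition with the weak equivalence \<open>f : x \<otimes> Q \<rightarrow> x\<close> on one side and with \<open>q\<close> on the other
  compares maps \<open>x \<rightarrow> y\<close> with maps \<open>1 \<rightarrow> \<C>(x, y)\<close>, through \<open>adj_ho_eq\<close> for the adjunction of \<open>x \<otimes> -\<close> and
  \<open>\<C>(x, -)\<close>.\<close>

theorem external_unit_imp_pi0:
  assumes sc: "set_compatible V C T" and E: "external_unit_axiom V MV C MC T"
  shows "pi0_of_mapping_space V MV C MC"
  unfolding pi0_of_mapping_space_iff
proof (intro allI impI, elim conjE)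
  fix x y assume x: "cofibrant C0 MC x" and y: "fibrant C0 MC y"
  have O: "x \<in> Eob C" "y \<in> Eob C" using U.cofibrant_Obj[OF x] U.fibrant_Obj[OF y] by simp_all
  interpret A: quillen_adjunction V MV C0 MC "WO T x" "WA T (Idn C0 x)" "Hob C x" "post V C x" "adj x"
    by (rule weak_tensor_Hob_adjunction[OF sc x])
  obtain Q q where Q: "cofibrant V MV Q" "q \<in> hom V Q (Unit V)" "q \<in> weq MV"
    using cofibrant_replacement_ex[OF Unit_Obj] by blast
  \<comment> \<open>the map \<open>x \<otimes> Q \<rightarrow> x\<close> of the external unit axiom\<close>
  define f where "f = Rho T x \<cdot>\<^bsub>C0\<^esub> WA T (Idn C0 x) q"
  have fw: "f \<in> weq MC"
    using E Q x unfolding external_unit_axiom_def cofibrant_replacement_def f_def by blast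
  have f: "f \<in> hom C0 (WO T x Q) x"
    unfolding f_def using U.Cmp_hom[OF T.bif_hom[OF U.Idn_hom Q(2)] T.Rho_hom] O by simp
  have au: "adj x Q y (g \<cdot>\<^bsub>C0\<^esub> f) = point g \<cdot> q" if "g \<in> hom C0 x y" for g
    unfolding f_def by (rule adj_unit[OF Q(2) O(1) that])
  let ?w = "Hob C x y" and ?I = "Unit V"
  note W = Hob_fibrant[OF x y]
  show "(\<forall>g \<in> hom C0 x y. \<forall>g' \<in> hom C0 x y. ho_eq ?I ?w (point g) (point g') \<longrightarrow> U.ho_eq x y g g') \<and>
      (\<forall>s. zigzag V (weq MV) ?I s ?w \<longrightarrow> (\<exists>g \<in> hom C0 x y. zz ?I ?w s [Fwd (point g)]))"
  proof (intro conjI ballI allI impI)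
    fix g g' assume g: "g \<in> hom C0 x y" "g' \<in> hom C0 x y" and e: "ho_eq ?I ?w (point g) (point g')"
    have "ho_eq Q ?w (point g \<cdot> q) (point g' \<cdot> q)"
      by (rule ho_eq_pre[OF e point_hom[OF g(1)] point_hom[OF g(2)] Q(2)])
    then have "U.ho_eq (WO T x Q) y (g \<cdot>\<^bsub>C0\<^esub> f) (g' \<cdot>\<^bsub>C0\<^esub> f)"
      using A.adj_ho_eq[OF Q(1) y U.Cmp_hom[OF f g(1)] U.Cmp_hom[OF f g(2)]]
      unfolding au[OF g(1)] au[OF g(2)] by blast
    then show "U.ho_eq x y g g'" by (rule U.ho_eq_pre_cancel[OF _ g f fw])
  next
    fix s assume s: "zigzag V (weq MV) ?I s ?w"
    obtain u where u: "u \<in> hom V Q ?w" "zz Q ?w ([Fwd q] @ s) [Fwd u]"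
      using cofibrant_zigzag_representable[OF zigzag_append[OF zigzag_Fwd[OF Q(2)] s] Q(1) W] by blast
    obtain h where h: "h \<in> hom C0 (WO T x Q) y" "adj x Q y h = u" using A.adj_surj[OF _ u(1)] O by auto
    have "zigzag C0 (weq MC) x ([Bwd f] @ [Fwd h]) y"
      by (rule U.zigzag_append[OF U.zigzag_Bwd[OF f fw] U.zigzag_Fwd[OF h(1)]])
    then obtain g where g: "g \<in> hom C0 x y" "U.zz x y ([Bwd f] @ [Fwd h]) [Fwd g]"
      using U.cofibrant_zigzag_representable[OF _ x y] by blast
    then have g: "g \<in> hom C0 x y" "U.zz x y [Bwd f, Fwd h] [Fwd g]" by simp_all
    have "U.ho_eq (WO T x Q) y (g \<cdot>\<^bsub>C0\<^esub> f) h" by (rule U.zz_Bwd_solve[OF f fw h(1) g])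
    then have "ho_eq Q ?w (point g \<cdot> q) u"
      using A.adj_ho_eq[OF Q(1) y U.Cmp_hom[OF f g(1)] h(1)] unfolding au[OF g(1)] h(2) by blast
    then have "zz Q ?w [Fwd q, Fwd (point g)] [Fwd u]"
      by (rule zz_trans[OF zz_Cmp[OF Q(2) point_hom[OF g(1)]]])
    then have "zz Q ?w (Fwd q # s) (Fwd q # [Fwd (point g)])"
      using zz_trans[OF u(2) zz_sym] by simp
    then have "zz ?I ?w s [Fwd (point g)]"
      by (rule zz_Fwd_cancel[OF Q(3,2) s zigzag_Fwd[OF point_hom[OF g(1)]]])
    then show "\<exists>g \<in> hom C0 x y. zz ?I ?w s [Fwd (point g)]" using g(1) by blast
  qed
qed

end

theorem proposition6p4:
  fixes V :: "('o, 'a, 'z) smcat_scheme"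
    and MV :: "'a model_structure"
    and C :: "('c, 'o, 'a) ecat"
    and MC :: "('c, 'a) uarr model_structure"
    and T :: "('c, 'o, 'a) wtens"
  assumes "symmetric_monoidal_model_category V MV"
    and "enriched_model_category V C MC"
    and "SM7 V MV C MC"
    and "weak_tensoring V MV C MC T"
  shows "(pi0_of_mapping_space V MV C MC \<longrightarrow> detection_property V MV C MC) \<and>
    (detection_property V MV C MC \<longrightarrow> external_unit_axiom V MV C MC T) \<and>
    (set_compatible V C T \<longrightarrow>
      (pi0_of_mapping_space V MV C MC \<longleftrightarrow> detection_property V MV C MC) \<and>
      (detection_property V MV C MC \<longleftrightarrow> external_unit_axiom V MV C MC T))"
proof -
  interpret weakly_tensored V MV C MC T
    using assms by (simp add: weakly_tensored_def SM7_category_def closed_enriched_category_def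
        SM7_category_axioms_def symmetric_monoidal_model_category_def enriched_model_category_def)
  show ?thesis
    using pi0_imp_detection detection_imp_external_unit external_unit_imp_pi0 by blast
qed

end
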